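(* Let $\mathscr{V}_{n+1,4}$ be the typical cell of the spherical Voronoi tessellation generated by $n+1$ independent uniformly distributed random points on the unit sphere $\mathbb{S}^4\subset\mathbb{R}^{5}$. For all $n\geq 5$ we have \begin{align*} \mathbb{E} f_0(\mathscr{V}_{n+1,4})&=\frac{6435}{2048}\Big(\frac{3}{48}\Big)^{n-4}\binom n4\int_{-\pi/2}^{+\pi/2}(\cos x)^{15}\,(8+9\sin x+\sin(3x))^{n-4}\,dx,\\ \mathbb{E} f_1(\mathscr{V}_{n+1,4})&=2\,\mathbb{E} f_0(\mathscr{V}_{n+1,4}),\\ \mathbb{E} f_2(\mathscr{V}_{n+1,4})&=6\,\frac{n-1}{n+1}+\frac65\,\mathbb{E} f_0(\mathscr{V}_{n+1,4}),\\ \mathbb{E} f_3(\mathscr{V}_{n+1,4})&=6\,\frac{n-1}{n+1}+\frac15\,\mathbb{E} f_0(\mathscr{V}_{n+1,4}). \end{align*}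
   Context: In the following $d=4$. Let $\mathbb{S}^d$ be the unit sphere in $\mathbb{R}^{d+1}$ centred at the origin, $\sigma_d$ the normalized (probability) spherical Lebesgue measure on it, $\rho$ the geodesic distance on $\mathbb{S}^d$, and $e=(1,0,\ldots,0)\in\mathbb{S}^d$ the north pole. Spherical Voronoi tessellation: for $m\in\mathbb{N}$ let $X_1,\ldots,X_m$ be independent random points on $\mathbb{S}^d$ with distribution $\sigma_d$. The Voronoi cells are $C_{i,m}:=\{z\in\mathbb{S}^d:\rho(X_i,z)\leq\rho(X_j,z)\text{ for all }j\in\{1,\ldots,m\}\}$, $i\in\{1,\ldots,m\}$. Typical cell: for every $v\in\mathbb{S}^d$ fix an orthogonal transformation $O_v:\mathbb{R}^{d+1}\to\mathbb{R}^{d+1}$ with $O_v v=e$ whose matrix entries are Borel functions of $v$. Let $N$ be uniformly distributed on $\{1,\ldots,m\}$, independent of $X_1,\ldots,X_m$. The typical cell is the random spherical polytope $\mathscr{V}_{m,d}:=O_{X_N}C_{N,m}$. Faces: a spherical polytope $P$ is the intersection of $\mathbb{S}^d$ with a polyhedral convex cone $C\subset\mathbb{R}^{d+1}$ (a finite intersection of closed half-spaces whose bounding hyperplanes contain the origin). The $k$-dimensional faces of $P$ are the intersections of the $(k+1)$-dimensional faces of $C$ with $\mathbb{S}^d$, $k\in\{0,\ldots,d\}$; $f_k(P)$ is their number. *)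

theory Defs
  imports "HOL-Probability.Probability"
begin

section \<open>The unit sphere\<close>

abbreviation unit_sphere :: "'a::euclidean_space set"
  where "unit_sphere \<equiv> sphere 0 1"

abbreviation sphere_borel :: "'a::euclidean_space measure"
  where "sphere_borel \<equiv> restrict_space borel unit_sphere"

text \<open>The normalized spherical Lebesgue measure is defined as the normalized cone measure:
  the measure of a Borel set \<open>A\<close> is the relative volume, in the unit ball, of the cone over \<open>A\<close>
  (see \<open>emeasure_spherical_measure\<close> below). The origin is sent to itself by the
  projection, so it is outside the sphere; it is a null set.\<close>

definition spherical_measure :: "'a::euclidean_space measure"
  where "spherical_measure =
    restrict_space
      (distr (uniform_measure lborel (ball 0 1)) borel (\<lambda>x. x /\<^sub>R norm x))
      unit_sphere"

definition geodesic_dist :: "'a::euclidean_space \<Rightarrow> 'a \<Rightarrow> real"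
  where "geodesic_dist x y = arccos (x \<bullet> y)"


section \<open>Spherical polytopes and their faces\<close>

definition polyhedral_cone :: "'a::euclidean_space set \<Rightarrow> bool"
  where "polyhedral_cone C \<longleftrightarrow> (\<exists>A. finite A \<and> 0 \<notin> A \<and> C = (\<Inter>a\<in>A. {x. a \<bullet> x \<le> 0}))"

definition spherical_polytope :: "'a::euclidean_space set \<Rightarrow> bool"
  where "spherical_polytope P \<longleftrightarrow> (\<exists>C. polyhedral_cone C \<and> P = C \<inter> unit_sphere)"

text \<open>The cone \<open>C\<close> is determined by \<open>P\<close>, see \<open>polyhedral_cone_unique\<close> below.\<close>

definition spherical_faces :: "nat \<Rightarrow> 'a::euclidean_space set \<Rightarrow> 'a set set"
  where "spherical_faces k P =
    {G \<inter> unit_sphere | G C.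
       polyhedral_cone C \<and> P = C \<inter> unit_sphere \<and> G face_of C \<and> aff_dim G = int k + 1}"

definition face_number :: "nat \<Rightarrow> 'a::euclidean_space set \<Rightarrow> nat"
  where "face_number k P = card (spherical_faces k P)"


section \<open>The spherical Voronoi tessellation and its typical cell\<close>

definition voronoi_cell :: "nat \<Rightarrow> (nat \<Rightarrow> 'a::euclidean_space) \<Rightarrow> nat \<Rightarrow> 'a set"
  where "voronoi_cell m x i =
    {z \<in> unit_sphere. \<forall>j\<in>{1..m}. geodesic_dist (x i) z \<le> geodesic_dist (x j) z}"

definition north_pole :: "real ^ 5"
  where "north_pole = axis 1 1"

definition measurable_rotations_to_pole :: "(real ^ 5 \<Rightarrow> real ^ 5 \<Rightarrow> real ^ 5) \<Rightarrow> bool"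
  where "measurable_rotations_to_pole R \<longleftrightarrow>
    (\<forall>v\<in>unit_sphere. orthogonal_transformation (R v) \<and> R v v = north_pole) \<and>
    (\<forall>i j. (\<lambda>v. matrix (R v) $ i $ j) \<in> borel_measurable sphere_borel)"

definition typical_cell ::
  "(real ^ 5 \<Rightarrow> real ^ 5 \<Rightarrow> real ^ 5) \<Rightarrow> nat \<Rightarrow> (nat \<Rightarrow> 'w \<Rightarrow> real ^ 5) \<Rightarrow> ('w \<Rightarrow> nat) \<Rightarrow> 'w
    \<Rightarrow> (real ^ 5) set"
  where "typical_cell R m X N \<omega> =
    R (X (N \<omega>) \<omega>) ` voronoi_cell m (\<lambda>i. X i \<omega>) (N \<omega>)"

definition expected_face_number ::
  "'w measure \<Rightarrow> (real ^ 5 \<Rightarrow> real ^ 5 \<Rightarrow> real ^ 5) \<Rightarrow> nat \<Rightarrow> (nat \<Rightarrow> 'w \<Rightarrow> real ^ 5) \<Rightarrow> ('w \<Rightarrow> nat)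
    \<Rightarrow> nat \<Rightarrow> real"
  where "expected_face_number M R m X N k =
    (\<integral>\<omega>. real (face_number k (typical_cell R m X N \<omega>)) \<partial>M)"


section \<open>Basic facts about the definitions\<close>

lemma emeasure_spherical_measure:
  fixes A :: "'a::euclidean_space set"
  assumes "A \<in> sets sphere_borel"
  shows "emeasure spherical_measure A =
    emeasure lborel {x \<in> ball 0 1. x /\<^sub>R norm x \<in> A} / emeasure lborel (ball (0::'a) 1)"
proof -
  have A: "A \<subseteq> unit_sphere" "A \<in> sets borel"
    using assms by (auto simp: sets_restrict_space_iff)
  have *: "(\<lambda>x::'a. x /\<^sub>R norm x) -` A \<in> sets borel"
    using measurable_sets[OF _ A(2), of "\<lambda>x::'a. x /\<^sub>R norm x" borel] by simp
  have "emeasure spherical_measure A =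
      emeasure (uniform_measure lborel (ball 0 1)) ((\<lambda>x::'a. x /\<^sub>R norm x) -` A)"
    using A by (simp add: spherical_measure_def emeasure_restrict_space emeasure_distr)
  also have "\<dots> = emeasure lborel (ball 0 1 \<inter> (\<lambda>x::'a. x /\<^sub>R norm x) -` A)
      / emeasure lborel (ball (0::'a) 1)"
    using * by simp
  also have "ball 0 1 \<inter> (\<lambda>x::'a. x /\<^sub>R norm x) -` A = {x \<in> ball 0 1. x /\<^sub>R norm x \<in> A}"
    by auto
  finally show ?thesis .
qed

lemma sets_spherical_measure [measurable_cong]: "sets spherical_measure = sets sphere_borel"
  by (simp add: spherical_measure_def sets_restrict_space)

lemma prob_space_spherical_measure: "prob_space (spherical_measure :: 'a::euclidean_space measure)"
proof
  have S: "space (spherical_measure :: 'a measure) = unit_sphere"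
    by (simp add: spherical_measure_def space_restrict_space)
  have "unit_sphere \<in> sets (sphere_borel :: 'a measure)"
    by (simp add: sets_restrict_space_iff)
  moreover have "{x::'a \<in> ball 0 1. x /\<^sub>R norm x \<in> unit_sphere} = ball 0 1 - {0}"
    by auto
  moreover have "emeasure lborel (ball (0::'a) 1 - {0}) = emeasure lborel (ball (0::'a) 1)"
    by (intro emeasure_Diff_null_set) auto
  moreover have "emeasure lborel (ball (0::'a) 1) \<noteq> 0"
    by (simp add: emeasure_ball ennreal_eq_0_iff not_le)
  moreover have "emeasure lborel (ball (0::'a) 1) \<noteq> \<infinity>"
    using emeasure_lborel_ball_finite[of "0::'a" 1] by simp
  ultimately show "emeasure (spherical_measure :: 'a measure) (space spherical_measure) = 1"
    by (simp add: S emeasure_spherical_measure ennreal_divide_self less_top)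
qed

lemma polyhedral_cone_unique:
  assumes "polyhedral_cone C" "polyhedral_cone D" "C \<inter> unit_sphere = D \<inter> unit_sphere"
  shows "C = D"
proof -
  have scale: "x \<in> E \<longleftrightarrow> x = 0 \<or> x /\<^sub>R norm x \<in> E \<inter> unit_sphere"
    if E: "polyhedral_cone E" for E :: "'a set" and x
  proof -
    obtain A where A: "E = (\<Inter>a\<in>A. {x. a \<bullet> x \<le> 0})"
      using E by (auto simp: polyhedral_cone_def)
    show ?thesis
      by (cases "x = 0") (auto simp: A mult_le_0_iff inverse_nonnegative_iff_nonnegative)
  qed
  show ?thesis
    using scale[OF assms(1)] scale[OF assms(2)] assms(3) by blast
qed

lemma spherical_polytope_voronoi_cell:
  assumes "\<And>j. j \<in> {1..m} \<Longrightarrow> x j \<in> unit_sphere" "i \<in> {1..m}"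
  shows "spherical_polytope (voronoi_cell m x i)"
  unfolding spherical_polytope_def
proof (intro exI conjI)
  let ?A = "(\<lambda>j. x j - x i) ` {1..m} - {0}"
  show "polyhedral_cone (\<Inter>a\<in>?A. {z. a \<bullet> z \<le> 0})"
    unfolding polyhedral_cone_def by (intro exI[of _ ?A]) auto
  have "\<bar>x j \<bullet> z\<bar> \<le> 1" if "j \<in> {1..m}" "norm z = 1" for j z
    using Cauchy_Schwarz_ineq2[of "x j" z] assms(1)[OF that(1)] that(2) by simp
  then have "geodesic_dist (x i) z \<le> geodesic_dist (x j) z \<longleftrightarrow> (x j - x i) \<bullet> z \<le> 0"
    if "j \<in> {1..m}" "norm z = 1" for j z
    using that assms(2) by (simp add: geodesic_dist_def arccos_le_mono inner_diff_left)
  then show "voronoi_cell m x i = (\<Inter>a\<in>?A. {z. a \<bullet> z \<le> 0}) \<inter> unit_sphere"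
    unfolding voronoi_cell_def by auto
qed

end

theory Submission imports Defs begin

text \<open>The faces of the Voronoi cell of \<open>X\<^sub>i\<close> are cut out by the normal cones of those faces of the convex hull of
  all points that contain \<open>X\<^sub>i\<close>. As \<open>N\<close> is uniform, \<open>(n + 1) E f\<^sub>k\<close> is therefore \<open>5 - k\<close> times the expected
  number of faces of the hull with \<open>5 - k\<close> vertices, the hull being almost surely simplicial. The
  Dehn--Sommerville relations in dimension five express these numbers by the number of facets.

  For the facets, five of the points span a facet iff their hyperplane leaves all other points in one of the two
  caps it cuts off, which have measure \<open>(8 \<plusminus> (9 sin x + sin 3x)) / 16\<close> if the hyperplane has distance
  \<open>\<bar>sin x\<bar>\<close> from the origin. The law of this distance results from a stereographic projection with one of the
  five points as pole, which turns the hyperplane into the one through four independent points in a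
  four-dimensional space, followed by an affine Blaschke--Petkantschin formula.\<close>

section \<open>Changes of variables\<close>

text \<open>No surface Jacobian enters: the uniform law is a cone measure, so formulas on the sphere
  come from Lebesgue integrals over the unit ball. Nor are the normalising factors of the
  Blaschke--Petkantschin step evaluated; they merge into one constant, found by testing the formula
  on the function 1. It is the reciprocal of the integral of \<open>cos x ^ 15\<close>, that is
  6435/4096; the two caps contribute equally and double it to 6435/2048. Faces are encoded by finite
  index sets: those of the cell by the tight inequalities, those of the hull by the points on them.
  Each face number becomes a finite sum of indicators, but the events ask for the existence of a
  supporting vector, so their measurability needs a compactness argument. The Dehn--Sommerville
  relations are proved not on the hull but on its polar body about the centroid of the points, a
  simple polytope, by sweeping with a generic linear functional. The factor
  \<open>n choose 4\<close> is what remains of the (n + 1 choose 5) candidate facets, each with five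
  vertices, shared among n + 1 cells.\<close>

lemma distr_increasing_eq_lborel:
  fixes g g' :: "real \<Rightarrow> real" and A :: "real set"
  assumes A: "is_interval A" "A \<in> sets borel"
    and g: "g \<in> borel_measurable borel" "g ` A = UNIV" "strict_mono_on A g"
    and g': "g' \<in> borel_measurable borel" "\<And>x. x \<in> A \<Longrightarrow> 0 \<le> g' x"
    and deriv: "\<And>x. x \<in> A \<Longrightarrow> (g has_real_derivative g' x) (at x)"
  shows "distr (density lborel (\<lambda>x. ennreal (g' x) * indicator A x)) borel g = lborel"
proof (rule lborel_eqI[symmetric])
  note [measurable] = A(2) g(1) g'(1)
  fix l u :: real
  assume "\<And>b. b \<in> Basis \<Longrightarrow> l \<bullet> b \<le> u \<bullet> b"
  then have lu: "l \<le> u" by simp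
  obtain a b where ab: "a \<in> A" "b \<in> A" "g a = l" "g b = u"
    using g(2) by (metis UNIV_I imageE)
  have "a \<le> b"
    using lu strict_mono_on_less[OF g(3) ab(2,1)] ab(3,4) by force
  have sub: "{a..b} \<subseteq> A"
    using mem_is_interval_1_I[OF A(1) ab(1,2)] by auto
  have mono: "g x < g y \<longleftrightarrow> x < y" if "x \<in> A" "y \<in> A" for x y
    using strict_mono_on_less[OF g(3) that] .
  have eq: "g -` {l<..<u} \<inter> A = {a<..<b}"
  proof (rule set_eqI)
    fix x
    show "x \<in> g -` {l<..<u} \<inter> A \<longleftrightarrow> x \<in> {a<..<b}"
    proof (cases "x \<in> A")
      case True
      then show ?thesis
        by (simp add: ab(3,4)[symmetric] mono ab(1,2))
    next
      case False
      then show ?thesis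
        using sub by (auto simp: subset_eq)
    qed
  qed
  have "emeasure (distr (density lborel (\<lambda>x. ennreal (g' x) * indicator A x)) borel g) {l<..<u} =
      (\<integral>\<^sup>+x. ennreal (g' x) * indicator (g -` {l<..<u} \<inter> A) x \<partial>lborel)"
    by (subst emeasure_distr, simp_all, subst emeasure_density)
       (auto intro!: nn_integral_cong measurable_sets_borel[OF g(1)] split: split_indicator)
  also have "\<dots> = (\<integral>\<^sup>+x. ennreal (g' x) * indicator {a..b} x \<partial>lborel)"
    unfolding eq using AE_lborel_singleton[of a] AE_lborel_singleton[of b]
    by (intro nn_integral_cong_AE) (auto simp: indicator_def)
  also have "\<dots> = g b - g a"
    by (rule nn_integral_FTC_Icc) (use sub deriv g' \<open>a \<le> b\<close> in \<open>auto simp: has_real_derivative_iff_has_vector_derivative[symmetric] intro: has_field_derivative_at_within\<close>)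
  finally show "emeasure (distr (density lborel (\<lambda>x. ennreal (g' x) * indicator A x)) borel g) (box l u) =
      (\<Prod>b\<in>Basis. (u - l) \<bullet> b)"
    using ab lu by (simp add: box_real)
qed simp

lemma nn_integral_substitution_increasing:
  fixes g g' :: "real \<Rightarrow> real" and A :: "real set"
  assumes "is_interval A" "A \<in> sets borel"
    and "g \<in> borel_measurable borel" "g ` A = UNIV" "strict_mono_on A g"
    and "g' \<in> borel_measurable borel" "\<And>x. x \<in> A \<Longrightarrow> 0 \<le> g' x"
    and "\<And>x. x \<in> A \<Longrightarrow> (g has_real_derivative g' x) (at x)"
    and f[measurable]: "f \<in> borel_measurable borel"
  shows "(\<integral>\<^sup>+x. f x \<partial>lborel) = (\<integral>\<^sup>+x. f (g x) * ennreal (g' x) * indicator A x \<partial>lborel)"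
proof -
  note [measurable] = assms(2,3,6)
  show ?thesis
    by (subst distr_increasing_eq_lborel[OF assms(1-8), symmetric])
       (simp_all add: nn_integral_distr nn_integral_density mult_ac)
qed

text \<open>A coordinate bijection pulls boxes back to boxes with the sides permuted. This lets
  Lebesgue measure pass between different types of the same dimension, such as nested products and
  vectors.\<close>

lemma lborel_distr_basis_bij:
  fixes T :: "'a::euclidean_space \<Rightarrow> 'b::euclidean_space" and p :: "'a \<Rightarrow> 'b"
  assumes p: "bij_betw p Basis Basis"
    and T: "\<And>x b. b \<in> Basis \<Longrightarrow> T x \<bullet> p b = x \<bullet> b" and [measurable]: "T \<in> borel_measurable borel"
  shows "distr lborel borel T = lborel"
proof (rule lborel_eqI[symmetric])
  fix l u :: 'b
  assume le: "\<And>b. b \<in> Basis \<Longrightarrow> l \<bullet> b \<le> u \<bullet> b"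
  define l' u' where "l' = (\<Sum>b\<in>Basis. (l \<bullet> p b) *\<^sub>R b)" and "u' = (\<Sum>b\<in>Basis. (u \<bullet> p b) *\<^sub>R b)"
  have l'u': "l' \<bullet> b = l \<bullet> p b" "u' \<bullet> b = u \<bullet> p b" if "b \<in> Basis" for b
    using that by (auto simp: l'_def u'_def inner_sum_left inner_Basis if_distrib cong: if_cong)
  have pB: "p ` Basis = Basis" "inj_on p Basis" using p by (auto simp: bij_betw_def)
  have "T -` box l u = box l' u'"
    unfolding box_def by (subst pB(1)[symmetric], auto simp: T l'u')
  then have "emeasure (distr lborel borel T) (box l u) = emeasure lborel (box l' u')"
    by (subst emeasure_distr) auto
  also have "\<dots> = (\<Prod>b\<in>Basis. (u' - l') \<bullet> b)"
    by (rule emeasure_lborel_box) (use le pB l'u' in auto)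
  also have "(\<Prod>b\<in>Basis. (u' - l') \<bullet> b) = (\<Prod>b\<in>Basis. (u - l) \<bullet> p b)"
    by (rule prod.cong) (simp_all add: inner_diff_left l'u')
  also have "\<dots> = (\<Prod>b\<in>p ` Basis. (u - l) \<bullet> b)"
    by (subst prod.reindex) (use pB in auto)
  finally show "emeasure (distr lborel borel T) (box l u) = (\<Prod>b\<in>Basis. (u - l) \<bullet> b)"
    by (simp add: pB)
qed simp

text \<open>Preimages under \<open>A\<close> are images under its inverse \<open>B\<close>, which
  scales volume by the reciprocal of the determinant; the density makes up for it.\<close>

lemma lborel_density_distr_matrix:
  fixes A :: "real ^ 'n::{finite,wellorder} ^ 'n::_"
  assumes A: "det A \<noteq> 0"
  shows "density (distr lborel borel ((*v) A)) (\<lambda>_. ennreal \<bar>det A\<bar>) = lborel"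
proof (rule lborel_eqI[symmetric])
  fix l u :: "real ^ 'n::_"
  assume le: "\<And>b. b \<in> Basis \<Longrightarrow> l \<bullet> b \<le> u \<bullet> b"
  have inv: "invertible A"
    using A by (simp add: invertible_det_nz)
  then obtain B where AB: "A ** B = mat 1" "B ** A = mat 1"
    by (auto simp: invertible_def)
  have det: "det A * det B = 1"
    using AB(1) by (metis det_I det_mul)
  have meas: "(*v) A \<in> borel_measurable borel"
    by (intro borel_measurable_continuous_onI linear_continuous_on matrix_vector_mul_bounded_linear)
  have vim: "(*v) A -` S = (*v) B ` S" for S
  proof safe
    fix x assume "A *v x \<in> S"
    moreover have "x = B *v (A *v x)"
      by (simp add: matrix_vector_mul_assoc AB)
    ultimately show "x \<in> (*v) B ` S" by blast
  qed (simp add: matrix_vector_mul_assoc AB)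
  have S: "box l u \<in> lmeasurable" by simp
  have lin: "linear ((*v) B)" by simp
  have m: "measure lborel ((*v) A -` box l u) = \<bar>det B\<bar> * measure lborel (box l u)"
    "(*v) A -` box l u \<in> lmeasurable"
    using measure_linear_image[OF lin S]
      measurable_linear_image[OF lin S] measurable_sets_borel[OF meas, of "box l u"]
    by (simp_all add: vim measure_completion)
  have "emeasure lborel ((*v) A -` box l u) = ennreal (\<bar>det B\<bar> * measure lborel (box l u))"
    using fmeasurableD2[OF m(2)] measurable_sets_borel[OF meas, of "box l u"]
    by (simp add: m(1)[symmetric] emeasure_eq_ennreal_measure)
  then have "emeasure (density (distr lborel borel ((*v) A)) (\<lambda>_. ennreal \<bar>det A\<bar>)) (box l u) =
      ennreal \<bar>det A\<bar> * ennreal (\<bar>det B\<bar> * measure lborel (box l u))"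
    using meas by (simp add: emeasure_density nn_integral_cmult_indicator emeasure_distr)
  also have "\<dots> = ennreal (measure lborel (box l u))"
    using det by (simp add: ennreal_mult[symmetric] mult.assoc[symmetric] abs_mult[symmetric])
  also have "\<dots> = (\<Prod>b\<in>Basis. (u - l) \<bullet> b)"
    using le by (simp add: measure_lborel_box_eq)
  finally show "emeasure (density (distr lborel borel ((*v) A)) (\<lambda>_. ennreal \<bar>det A\<bar>)) (box l u) =
      (\<Prod>b\<in>Basis. (u - l) \<bullet> b)" .
qed simp

lemma nn_integral_lborel_translation:
  fixes t :: "'a::euclidean_space"
  assumes [measurable]: "f \<in> borel_measurable borel"
  shows "(\<integral>\<^sup>+x. f (t + x) \<partial>lborel) = (\<integral>\<^sup>+x. f x \<partial>lborel)"
proof -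
  have "lborel = distr lborel borel (\<lambda>x. t + x)"
    using lborel_affine[of 1 t] by (simp add: density_1)
  then have "(\<integral>\<^sup>+x. f x \<partial>lborel) = (\<integral>\<^sup>+x. f x \<partial>distr lborel borel (\<lambda>x. t + x))"
    by simp
  also have "\<dots> = (\<integral>\<^sup>+x. f (t + x) \<partial>lborel)"
    by (subst nn_integral_distr) auto
  finally show ?thesis by simp
qed

lemma nn_integral_lborel_scale:
  fixes c :: real and f :: "'a::euclidean_space \<Rightarrow> ennreal"
  assumes c: "c > 0" and [measurable]: "f \<in> borel_measurable borel"
  shows "(\<integral>\<^sup>+x. f x \<partial>lborel) = ennreal (c ^ DIM('a)) * (\<integral>\<^sup>+x. f (c *\<^sub>R x) \<partial>lborel)"
proof -
  have "lborel = density (distr lborel borel (\<lambda>x::'a. c *\<^sub>R x)) (\<lambda>_. ennreal (c ^ DIM('a)))"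
    using lborel_affine[of c "0::'a"] c by simp
  then have "(\<integral>\<^sup>+x. f x \<partial>lborel) =
      (\<integral>\<^sup>+x. f x \<partial>density (distr lborel borel (\<lambda>x::'a. c *\<^sub>R x)) (\<lambda>_. ennreal (c ^ DIM('a))))"
    by simp
  also have "\<dots> = ennreal (c ^ DIM('a)) * (\<integral>\<^sup>+x. f (c *\<^sub>R x) \<partial>lborel)"
    by (subst nn_integral_density) (auto simp: nn_integral_distr nn_integral_cmult)
  finally show ?thesis .
qed

lemma nn_integral_lborel_affine_matrix:
  fixes A :: "real ^ 'n::{finite,wellorder} ^ 'n::_"
  assumes A: "det A \<noteq> 0" and f[measurable]: "f \<in> borel_measurable borel"
  shows "(\<integral>\<^sup>+x. f x \<partial>lborel) = ennreal \<bar>det A\<bar> * (\<integral>\<^sup>+x. f (t + A *v x) \<partial>lborel)"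
proof -
  have [measurable]: "(*v) A \<in> borel_measurable borel"
    by (intro borel_measurable_continuous_onI linear_continuous_on matrix_vector_mul_bounded_linear)
  have "(\<integral>\<^sup>+x. f x \<partial>lborel) = (\<integral>\<^sup>+x. f (t + x) \<partial>lborel)"
    by (rule nn_integral_lborel_translation[OF f, symmetric])
  also have "\<dots> = (\<integral>\<^sup>+x. f (t + x) \<partial>density (distr lborel borel ((*v) A)) (\<lambda>_. ennreal \<bar>det A\<bar>))"
    by (simp only: lborel_density_distr_matrix[OF A])
  also have "\<dots> = ennreal \<bar>det A\<bar> * (\<integral>\<^sup>+x. f (t + A *v x) \<partial>lborel)"
    by (subst nn_integral_density) (auto simp: nn_integral_distr nn_integral_cmult)
  finally show ?thesis .
qed

lemma distr_lborel_orthogonal: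
  fixes f :: "real ^ 'n::{finite,wellorder} \<Rightarrow> real ^ 'n::_"
  assumes f: "orthogonal_transformation f"
  shows "distr lborel borel f = lborel"
proof -
  have det: "\<bar>det (matrix f)\<bar> = 1"
    using f det_orthogonal_matrix[of "matrix f"] by (auto simp: orthogonal_transformation_matrix)
  have f': "f = (*v) (matrix f)"
    using f by (simp add: orthogonal_transformation_def fun_eq_iff matrix_works)
  show ?thesis
    using lborel_density_distr_matrix[of "matrix f"] det f' by (simp add: density_1)
qed

section \<open>The uniform distribution on the sphere and stereographic projection\<close>

text \<open>The uniform law as a measure on the whole space, concentrated on the sphere: integrands
  then need measurability only with respect to \<open>borel\<close>, and all Fubini arguments stay
  within Borel spaces. \<open>distr_spherical_measure\<close> links it with
  \<open>spherical_measure\<close>.\<close>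

definition sphere_law :: "'a::euclidean_space measure"
  where "sphere_law = distr (uniform_measure lborel (ball 0 1)) borel sgn"

lemma sets_sphere_law [simp, measurable_cong]: "sets sphere_law = sets borel"
  and space_sphere_law [simp]: "space sphere_law = UNIV"
  by (simp_all add: sphere_law_def)

lemma emeasure_unit_ball_pos_finite:
  "emeasure lborel (ball (0::'a::euclidean_space) 1) \<noteq> 0"
  "emeasure lborel (ball (0::'a::euclidean_space) 1) \<noteq> \<infinity>"
  using emeasure_lborel_ball_finite[of "0::'a" 1]
  by (simp_all add: emeasure_ball ennreal_eq_0_iff not_le)

lemma prob_space_sphere_law: "prob_space (sphere_law :: 'a::euclidean_space measure)"
  unfolding sphere_law_def
proof (intro prob_space.prob_space_distr prob_space_uniform_measure)
  show "sgn \<in> uniform_measure lborel (ball 0 1) \<rightarrow>\<^sub>M (borel::'a measure)"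
    unfolding sgn_div_norm by simp
qed (use emeasure_unit_ball_pos_finite[where 'a='a] in auto)

lemma borel_measurable_sgn_vec [measurable]:
  "sgn \<in> borel_measurable (borel :: 'a::euclidean_space measure)"
  unfolding sgn_div_norm by simp

lemma nn_integral_sphere_law:
  fixes f :: "'a::euclidean_space \<Rightarrow> ennreal"
  assumes [measurable]: "f \<in> borel_measurable borel"
  shows "(\<integral>\<^sup>+x. f x \<partial>sphere_law) =
    (\<integral>\<^sup>+x. f (sgn x) * indicator (ball 0 1) x \<partial>lborel) / emeasure lborel (ball (0::'a) 1)"
  unfolding sphere_law_def by (subst nn_integral_distr) (auto simp: nn_integral_uniform_measure)

lemma AE_sphere_law_norm: "AE x in sphere_law. norm (x::'a::euclidean_space) = 1"
proof -
  have "AE x in uniform_measure lborel (ball (0::'a) 1). norm (sgn x) = 1"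
    using AE_lborel_singleton[of "0::'a"]
    by (intro AE_uniform_measureI) (auto simp: norm_sgn)
  then show ?thesis
    unfolding sphere_law_def by (subst AE_distr_iff) auto
qed

lemma distr_spherical_measure: "distr spherical_measure borel (\<lambda>x. x) = (sphere_law :: 'a::euclidean_space measure)"
proof (rule measure_eqI)
  fix A :: "'a set" assume "A \<in> sets (distr spherical_measure borel (\<lambda>x. x))"
  then have A[measurable]: "A \<in> sets borel" by simp
  have id: "(\<lambda>x. x) \<in> (spherical_measure :: 'a measure) \<rightarrow>\<^sub>M borel"
    by (simp add: measurable_cong_sets[OF sets_spherical_measure refl] measurable_restrict_space1)
  have sp: "space (spherical_measure :: 'a measure) = unit_sphere"
    by (simp add: spherical_measure_def space_restrict_space)
  have law: "distr (uniform_measure lborel (ball 0 1)) borel (\<lambda>x::'a. x /\<^sub>R norm x) = sphere_law"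
    unfolding sphere_law_def by (simp add: sgn_div_norm fun_eq_iff cong: distr_cong)
  have "emeasure (distr spherical_measure borel (\<lambda>x. x)) A = emeasure spherical_measure (A \<inter> unit_sphere)"
    using id by (simp add: emeasure_distr sp)
  also have "\<dots> = emeasure sphere_law (A \<inter> unit_sphere)"
    unfolding spherical_measure_def law by (subst emeasure_restrict_space) auto
  also have "\<dots> = emeasure sphere_law A"
    using AE_sphere_law_norm[where 'a='a] by (intro emeasure_eq_AE) auto
  finally show "emeasure (distr spherical_measure borel (\<lambda>x. x)) A = emeasure sphere_law A" .
qed simp

text \<open>Inverse stereographic projection from the pole \<open>(0, -1)\<close>, the one point of
  the sphere that is missed; the origin goes to \<open>(0, 1)\<close>.\<close>

definition stereo :: "'b::euclidean_space \<Rightarrow> 'b \<times> real"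
  where "stereo y = ((2 / (1 + (norm y)\<^sup>2)) *\<^sub>R y, (1 - (norm y)\<^sup>2) / (1 + (norm y)\<^sup>2))"

lemma one_plus_norm_square_pos: "0 < 1 + (norm y)\<^sup>2"
  by (simp add: add_pos_nonneg)

text \<open>The vector is \<open>s * (1 + norm y ^ 2)\<close> times \<open>stereo y\<close>, so the
  coordinates \<open>s\<close> and \<open>y\<close> separate radius from direction by polynomial
  formulas.\<close>

lemma norm_homogeneous_stereo:
  fixes y :: "'b::euclidean_space"
  assumes "s > 0"
  shows "norm ((2 * s) *\<^sub>R y, s - s * (norm y)\<^sup>2) = s * (1 + (norm y)\<^sup>2)"
proof -
  have "(norm ((2 * s) *\<^sub>R y, s - s * (norm y)\<^sup>2))\<^sup>2 = (s * (1 + (norm y)\<^sup>2))\<^sup>2"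
    by (simp add: norm_Pair power_mult_distrib) (simp add: power2_eq_square algebra_simps)
  then show ?thesis
    using assms by (simp add: power2_eq_iff_nonneg)
qed

lemma sgn_homogeneous_stereo:
  fixes y :: "'b::euclidean_space"
  assumes "s > 0"
  shows "sgn ((2 * s) *\<^sub>R y, s - s * (norm y)\<^sup>2) = stereo y"
proof -
  define q where "q = 1 + (norm y)\<^sup>2"
  have q: "q > 0" "(norm y)\<^sup>2 = q - 1"
    using one_plus_norm_square_pos[of y] by (simp_all add: q_def)
  have "inverse (s * q) * (2 * s) = 2 / q" "inverse (s * q) * (s - s * (q - 1)) = (2 - q) / q"
    using assms q(1) by (simp_all add: field_simps)
  then show ?thesis
    unfolding sgn_div_norm norm_homogeneous_stereo[OF assms] stereo_def by (simp add: q(2))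
qed

lemma borel_measurable_stereo [measurable]: "stereo \<in> borel_measurable borel"
  unfolding stereo_def by measurable

lemma nn_integral_lborel_Pair:
  fixes f :: "'a::euclidean_space \<times> 'b::euclidean_space \<Rightarrow> ennreal"
  assumes "f \<in> borel_measurable borel"
  shows "(\<integral>\<^sup>+x. f x \<partial>lborel) = (\<integral>\<^sup>+x. \<integral>\<^sup>+y. f (x, y) \<partial>lborel \<partial>lborel)"
  using lborel.nn_integral_fst[of f lborel] assms by (simp add: lborel_prod)

lemma nn_integral_power_interval:
  assumes "0 \<le> a"
  shows "(\<integral>\<^sup>+s. ennreal (s ^ n) * indicator {0<..<a} s \<partial>lborel) = ennreal (a ^ Suc n / Suc n)"
proof -
  have "(\<integral>\<^sup>+s. ennreal (s ^ n) * indicator {0<..<a} s \<partial>lborel) =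
      (\<integral>\<^sup>+s. ennreal (s ^ n) * indicator {0..a} s \<partial>lborel)"
    using AE_lborel_singleton[of 0] AE_lborel_singleton[of a]
    by (intro nn_integral_cong_AE, eventually_elim) (auto simp: indicator_def)
  also have "\<dots> = ennreal (a ^ Suc n / Suc n - 0 ^ Suc n / Suc n)"
  proof (intro nn_integral_FTC_Icc)
    fix s :: real
    show "((\<lambda>s. s ^ Suc n / Suc n) has_real_derivative s ^ n) (at s)"
      using DERIV_cdivide[OF DERIV_pow[of "Suc n" s UNIV], of "real (Suc n)"]
      by (simp del: of_nat_Suc power_Suc)
  qed (use assms in auto)
  finally show ?thesis by simp
qed

text \<open>For \<open>c > 0\<close> the map from \<open>s\<close> to \<open>s - c / s\<close>
  increases from the positive half line onto the reals. With \<open>c = (norm w / 2) ^ 2\<close> and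
  \<open>w = 2 s y\<close> it produces the last coordinate \<open>s - s * norm y ^ 2\<close> of the
  homogeneous stereographic coordinates.\<close>

lemma nn_integral_shifted_reciprocal:
  fixes f :: "real \<Rightarrow> ennreal"
  assumes c: "c > 0" and f: "f \<in> borel_measurable borel"
  shows "(\<integral>\<^sup>+x. f x \<partial>lborel) = (\<integral>\<^sup>+s. f (s - c / s) * ennreal (1 + c / s\<^sup>2) * indicator {0<..} s \<partial>lborel)"
proof (rule nn_integral_substitution_increasing[OF _ _ _ _ _ _ _ _ f])
  show "is_interval {0::real<..}"
    by (simp add: is_interval_convex_1)
  show "(\<lambda>s. s - c / s) ` {0<..} = (UNIV :: real set)"
  proof (safe, simp_all)
    fix x :: real
    \<comment> \<open>The preimage of \<open>x\<close> is the positive root of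
      \<open>s ^ 2 - x * s - c\<close>.\<close>
    define r where "r = sqrt (x\<^sup>2 + 4 * c)"
    have r: "r\<^sup>2 = x\<^sup>2 + 4 * c" "r \<ge> 0"
      using c by (simp_all add: r_def)
    have "\<bar>x\<bar> < r"
      using c by (intro power_less_imp_less_base[OF _ r(2), of _ 2]) (simp add: r)
    then have pos: "0 < (x + r) / 2" by simp
    have "(x + r) / 2 - c / ((x + r) / 2) = x"
      using pos r(1) by (simp add: field_simps power2_eq_square)
    with pos show "x \<in> (\<lambda>s. s - c / s) ` {0<..}"
      by (intro image_eqI[of _ _ "(x + r) / 2"]) auto
  qed
  show "strict_mono_on {0<..} (\<lambda>s. s - c / s)"
    using c by (intro strict_mono_onI) (auto intro!: diff_strict_mono divide_strict_left_mono)
  show "((\<lambda>s. s - c / s) has_real_derivative 1 + c / s\<^sup>2) (at s)" if "s \<in> {0<..}" for s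
    using that by (auto intro!: derivative_eq_intros simp: power2_eq_square)
qed (use c in auto)

text \<open>In the ball, substitute first \<open>s\<close> for the last coordinate and then
  \<open>w = 2 s y\<close>. The Jacobians are \<open>1 + norm y ^ 2\<close> and
  \<open>(2 * s) ^ DIM('b)\<close>, the direction is \<open>stereo y\<close>, and the ball becomes
  \<open>s < 1 / (1 + norm y ^ 2)\<close>; integrating out \<open>s\<close> leaves the weight in
  \<open>y\<close>.\<close>

lemma nn_integral_sphere_law_stereo:
  fixes f :: "'b::euclidean_space \<times> real \<Rightarrow> ennreal"
  assumes [measurable]: "f \<in> borel_measurable borel"
  shows "(\<integral>\<^sup>+x. f x \<partial>sphere_law) =
    ennreal (2 ^ DIM('b) / Suc (DIM('b))) / emeasure lborel (ball (0::'b \<times> real) 1) *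
    (\<integral>\<^sup>+y. f (stereo y) * ennreal (1 / (1 + (norm y)\<^sup>2) ^ DIM('b)) \<partial>lborel)"
proof -
  let ?n = "DIM('b)"
  have [measurable]: "ball (0 :: 'b \<times> real) 1 \<in> sets borel"
    by simp
  have "(\<integral>\<^sup>+x. f (sgn x) * indicator (ball 0 1) x \<partial>lborel) =
      (\<integral>\<^sup>+w. \<integral>\<^sup>+t. f (sgn (w, t)) * indicator (ball 0 1) (w, t) \<partial>lborel \<partial>(lborel :: 'b measure))"
    by (rule nn_integral_lborel_Pair) measurable
  also have "\<dots> = (\<integral>\<^sup>+w. \<integral>\<^sup>+s. f (sgn (w, s - (norm w / 2)\<^sup>2 / s)) *
      indicator (ball 0 1) (w, s - (norm w / 2)\<^sup>2 / s) *
      ennreal (1 + (norm w / 2)\<^sup>2 / s\<^sup>2) * indicator {0<..} s \<partial>lborel \<partial>(lborel :: 'b measure))"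
    \<comment> \<open>The origin is discarded because the substitution needs a positive
      parameter.\<close>
    using AE_lborel_singleton[of "0::'b"]
  proof (intro nn_integral_cong_AE, eventually_elim)
    fix w :: 'b assume "w \<noteq> 0"
    then have "(norm w / 2)\<^sup>2 > 0" by simp
    from nn_integral_shifted_reciprocal[OF this, of "\<lambda>t. f (sgn (w, t)) * indicator (ball 0 1) (w, t)"]
    show "(\<integral>\<^sup>+t. f (sgn (w, t)) * indicator (ball 0 1) (w, t) \<partial>lborel) =
        (\<integral>\<^sup>+s. f (sgn (w, s - (norm w / 2)\<^sup>2 / s)) * indicator (ball 0 1) (w, s - (norm w / 2)\<^sup>2 / s) *
        ennreal (1 + (norm w / 2)\<^sup>2 / s\<^sup>2) * indicator {0<..} s \<partial>lborel)"
      by simp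
  qed
  also have "\<dots> = (\<integral>\<^sup>+s. \<integral>\<^sup>+w. f (sgn (w, s - (norm w / 2)\<^sup>2 / s)) *
      indicator (ball 0 1) (w, s - (norm w / 2)\<^sup>2 / s) *
      ennreal (1 + (norm w / 2)\<^sup>2 / s\<^sup>2) * indicator {0<..} s \<partial>(lborel :: 'b measure) \<partial>lborel)"
    by (rule lborel_pair.Fubini') measurable
  also have "\<dots> = (\<integral>\<^sup>+s. \<integral>\<^sup>+y. f (stereo y) * ennreal (1 + (norm y)\<^sup>2) * (ennreal ((2 * s) ^ ?n) *
      indicator ({0<..} \<inter> {s. s * (1 + (norm y)\<^sup>2) < 1}) s) \<partial>(lborel :: 'b measure) \<partial>lborel)"
  proof (rule nn_integral_cong)
    fix s :: real
    show "(\<integral>\<^sup>+w. f (sgn (w, s - (norm w / 2)\<^sup>2 / s)) *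
      indicator (ball 0 1) (w, s - (norm w / 2)\<^sup>2 / s) *
      ennreal (1 + (norm w / 2)\<^sup>2 / s\<^sup>2) * indicator {0<..} s \<partial>(lborel :: 'b measure)) =
      (\<integral>\<^sup>+y. f (stereo y) * ennreal (1 + (norm y)\<^sup>2) * (ennreal ((2 * s) ^ ?n) *
      indicator ({0<..} \<inter> {s. s * (1 + (norm y)\<^sup>2) < 1}) s) \<partial>lborel)" (is "?L = ?R")
    proof (cases "s > 0")
      case True
      have "?L = ennreal ((2 * s) ^ ?n) * (\<integral>\<^sup>+y. f (sgn ((2 * s) *\<^sub>R y, s - (norm ((2 * s) *\<^sub>R y) / 2)\<^sup>2 / s)) *
        indicator (ball 0 1) ((2 * s) *\<^sub>R y, s - (norm ((2 * s) *\<^sub>R y) / 2)\<^sup>2 / s) *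
        ennreal (1 + (norm ((2 * s) *\<^sub>R y) / 2)\<^sup>2 / s\<^sup>2) * indicator {0<..} s \<partial>lborel)"
        by (rule nn_integral_lborel_scale) (use True in auto)
      also have "\<dots> = ennreal ((2 * s) ^ ?n) * (\<integral>\<^sup>+y. f (stereo y) * ennreal (1 + (norm y)\<^sup>2) *
          indicator ({0<..} \<inter> {s. s * (1 + (norm y)\<^sup>2) < 1}) s \<partial>lborel)"
      proof (intro arg_cong[of _ _ "(*) _"] nn_integral_cong)
        fix y :: 'b
        have 1: "(norm ((2 * s) *\<^sub>R y) / 2)\<^sup>2 / s = s * (norm y)\<^sup>2"
          "(norm ((2 * s) *\<^sub>R y) / 2)\<^sup>2 / s\<^sup>2 = (norm y)\<^sup>2"
          using True by (simp_all add: power2_eq_square)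
        have 2: "((2 * s) *\<^sub>R y, s - s * (norm y)\<^sup>2) \<in> ball 0 1 \<longleftrightarrow> s \<in> {0<..} \<inter> {s. s * (1 + (norm y)\<^sup>2) < 1}"
          using True one_plus_norm_square_pos[of y]
          unfolding mem_ball_0 norm_homogeneous_stereo[OF True] by (simp add: field_simps)
        show "f (sgn ((2 * s) *\<^sub>R y, s - (norm ((2 * s) *\<^sub>R y) / 2)\<^sup>2 / s)) *
            indicator (ball 0 1) ((2 * s) *\<^sub>R y, s - (norm ((2 * s) *\<^sub>R y) / 2)\<^sup>2 / s) *
            ennreal (1 + (norm ((2 * s) *\<^sub>R y) / 2)\<^sup>2 / s\<^sup>2) * indicator {0<..} s =
            f (stereo y) * ennreal (1 + (norm y)\<^sup>2) * indicator ({0<..} \<inter> {s. s * (1 + (norm y)\<^sup>2) < 1}) s"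
          unfolding 1 sgn_homogeneous_stereo[OF True] indicator_def 2 using True by (simp add: mult_ac)
      qed
      also have "\<dots> = ?R"
        by (subst nn_integral_cmult[symmetric]) (auto simp: mult_ac)
      finally show ?thesis .
    next
      case False
      then show ?thesis by (simp add: indicator_def)
    qed
  qed
  also have "\<dots> = (\<integral>\<^sup>+y. \<integral>\<^sup>+s. f (stereo y) * ennreal (1 + (norm y)\<^sup>2) * (ennreal ((2 * s) ^ ?n) *
      indicator ({0<..} \<inter> {s. s * (1 + (norm y)\<^sup>2) < 1}) s) \<partial>lborel \<partial>(lborel :: 'b measure))"
    by (rule lborel_pair.Fubini') measurable
  also have "\<dots> = (\<integral>\<^sup>+y. f (stereo y) * ennreal (1 / (1 + (norm y)\<^sup>2) ^ ?n) * ennreal (2 ^ ?n / Suc ?n) \<partial>lborel)"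
  proof (intro nn_integral_cong)
    fix y :: 'b
    define q where "q = 1 + (norm y)\<^sup>2"
    have q: "q > 0" unfolding q_def by (rule one_plus_norm_square_pos)
    have iv: "{0<..} \<inter> {s. s * (1 + (norm y)\<^sup>2) < 1} = {0<..<1 / q}"
      using q by (auto simp: q_def[symmetric] field_simps)
    have "(\<integral>\<^sup>+s. f (stereo y) * ennreal q * (ennreal ((2 * s) ^ ?n) * indicator {0<..<1 / q} s) \<partial>lborel) =
        f (stereo y) * ennreal q * (\<integral>\<^sup>+s. ennreal (2 ^ ?n) * (ennreal (s ^ ?n) * indicator {0<..<1 / q} s) \<partial>lborel)"
      by (subst nn_integral_cmult[symmetric])
         (auto intro!: nn_integral_cong simp: power_mult_distrib ennreal_mult split: split_indicator)
    also have "\<dots> = f (stereo y) * (ennreal q * (ennreal (2 ^ ?n) * ennreal ((1 / q) ^ Suc ?n / Suc ?n)))"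
      using q by (subst nn_integral_cmult, simp, subst nn_integral_power_interval) (simp_all add: mult.assoc)
    also have "\<dots> = f (stereo y) * (ennreal (1 / q ^ ?n) * ennreal (2 ^ ?n / Suc ?n))"
      using q by (simp add: ennreal_mult[symmetric] power_divide)
    finally show "(\<integral>\<^sup>+s. f (stereo y) * ennreal (1 + (norm y)\<^sup>2) * (ennreal ((2 * s) ^ ?n) *
      indicator ({0<..} \<inter> {s. s * (1 + (norm y)\<^sup>2) < 1}) s) \<partial>lborel) =
      f (stereo y) * ennreal (1 / (1 + (norm y)\<^sup>2) ^ ?n) * ennreal (2 ^ ?n / Suc ?n)"
      unfolding iv by (simp add: q_def mult_ac)
  qed
  also have "\<dots> = ennreal (2 ^ ?n / Suc ?n) *
      (\<integral>\<^sup>+y. f (stereo y) * ennreal (1 / (1 + (norm y)\<^sup>2) ^ ?n) \<partial>lborel)"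
    by (subst nn_integral_multc) (simp_all add: mult.commute)
  finally show ?thesis
    by (simp add: nn_integral_sphere_law divide_ennreal_def mult_ac)
qed

section \<open>Spherical caps\<close>

text \<open>The integral of \<open>3 / 4 * (1 - t ^ 2)\<close> from -1 to \<open>h\<close>: the
  distribution function of one coordinate of a uniform point on the unit sphere of a
  five-dimensional space.\<close>

definition cap_cdf :: "real \<Rightarrow> real"
  where "cap_cdf h = (2 + 3 * h - h ^ 3) / 4"

lemma cap_cdf_nonneg:
  assumes "-1 \<le> h" "h \<le> 1"
  shows "0 \<le> cap_cdf h"
proof -
  have "0 \<le> (1 + h)\<^sup>2 * (2 - h) / 4"
    using assms by simp
  also have "\<dots> = cap_cdf h"
    by (simp add: cap_cdf_def power2_eq_square power3_eq_cube algebra_simps)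
  finally show ?thesis .
qed

lemma cap_cdf_minus: "cap_cdf (- h) = 1 - cap_cdf h"
  by (simp add: cap_cdf_def field_simps)

text \<open>Layer-cake argument: the radial weight is its value at radius \<open>r\<close> plus the
  integral of minus its derivative over the radii from \<open>norm y\<close> to \<open>r\<close>.
  After Fubini only volumes of four-dimensional balls, \<open>pi ^ 2 / 2 * t ^ 4\<close>,
  remain.\<close>

lemma nn_integral_cball_dim4:
  fixes r :: real
  assumes dim: "DIM('b::euclidean_space) = 4" and r: "0 \<le> r"
  shows "(\<integral>\<^sup>+y. indicator (cball 0 r) y * ennreal (1 / (1 + (norm (y::'b))\<^sup>2) ^ 4) \<partial>lborel) =
    ennreal (pi\<^sup>2 / 6 * (1 - 3 / (1 + r\<^sup>2)\<^sup>2 + 2 / (1 + r\<^sup>2) ^ 3))"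
proof -
  have q: "0 < 1 + t\<^sup>2" for t :: real
    by (simp add: add_pos_nonneg)
  have [measurable]: "cball (0::'b) r \<in> sets borel" for r
    by (simp add: borel_closed)
  have layer: "indicator (cball 0 r) y * ennreal (1 / (1 + (norm y)\<^sup>2) ^ 4) =
      ennreal (1 / (1 + r\<^sup>2) ^ 4) * indicator (cball 0 r) y +
      (\<integral>\<^sup>+t. ennreal (8 * t / (1 + t\<^sup>2) ^ 5) * (indicator {0..r} t * indicator {(y, t). norm y \<le> t} (y, t)) \<partial>lborel)"
    for y :: 'b
  proof (cases "norm y \<le> r")
    case True
    have "(\<integral>\<^sup>+t. ennreal (8 * t / (1 + t\<^sup>2) ^ 5) * indicator {norm y..r} t \<partial>lborel) =
        ennreal (- 1 / (1 + r\<^sup>2) ^ 4 - (- 1 / (1 + (norm y)\<^sup>2) ^ 4))"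
    proof (intro nn_integral_FTC_Icc[where F = "\<lambda>t. - 1 / (1 + t\<^sup>2) ^ 4"])
      fix t :: real assume t: "t \<in> {norm y..r}"
      show "((\<lambda>t. - 1 / (1 + t\<^sup>2) ^ 4) has_real_derivative 8 * t / (1 + t\<^sup>2) ^ 5) (at t)"
        using q[of t]
        by (auto intro!: derivative_eq_intros simp: divide_simps)
      show "0 \<le> 8 * t / (1 + t\<^sup>2) ^ 5"
        using q[of t] t order_trans[OF norm_ge_zero, of y t] by simp
    qed (use True in auto)
    moreover have "(\<integral>\<^sup>+t. ennreal (8 * t / (1 + t\<^sup>2) ^ 5) * indicator {norm y..r} t \<partial>lborel) =
        (\<integral>\<^sup>+t. ennreal (8 * t / (1 + t\<^sup>2) ^ 5) * (indicator {0..r} t * indicator {(y, t). norm y \<le> t} (y, t)) \<partial>lborel)"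
      by (intro nn_integral_cong) (auto simp: indicator_def dest: order_trans[OF norm_ge_zero])
    moreover have "1 / (1 + r\<^sup>2) ^ 4 \<le> 1 / (1 + (norm y)\<^sup>2) ^ 4"
      using True q[of "norm y"] by (intro divide_left_mono power_mono add_left_mono zero_less_power mult_pos_pos) (auto simp: q)
    ultimately show ?thesis
      using True q[of r] by (simp add: ennreal_plus[symmetric] del: ennreal_plus)
  next
    case False
    then have "(\<lambda>t. ennreal (8 * t / (1 + t\<^sup>2) ^ 5) * (indicator {0..r} t * indicator {(y, t). norm y \<le> t} (y, t))) = (\<lambda>_. 0)"
      by (auto simp: indicator_def fun_eq_iff)
    then show ?thesis using False by simp
  qed
  have [measurable]: "{(y::'b, t). norm y \<le> t} \<in> sets (borel \<Otimes>\<^sub>M borel)"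
    unfolding borel_prod case_prod_beta
    by (intro borel_closed closed_Collect_le continuous_intros)
  have "(\<integral>\<^sup>+y. indicator (cball 0 r) y * ennreal (1 / (1 + (norm (y::'b))\<^sup>2) ^ 4) \<partial>lborel) =
      ennreal (1 / (1 + r\<^sup>2) ^ 4) * emeasure lborel (cball (0::'b) r) +
      (\<integral>\<^sup>+y. \<integral>\<^sup>+t. ennreal (8 * t / (1 + t\<^sup>2) ^ 5) * (indicator {0..r} t * indicator {(y, t). norm y \<le> t} (y::'b, t)) \<partial>lborel \<partial>lborel)"
    unfolding layer by (subst nn_integral_add) (auto simp: nn_integral_cmult_indicator)
  also have "(\<integral>\<^sup>+y. \<integral>\<^sup>+t. ennreal (8 * t / (1 + t\<^sup>2) ^ 5) * (indicator {0..r} t * indicator {(y, t). norm y \<le> t} (y::'b, t)) \<partial>lborel \<partial>lborel) =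
      (\<integral>\<^sup>+t. \<integral>\<^sup>+y. ennreal (8 * t / (1 + t\<^sup>2) ^ 5) * (indicator {0..r} t * indicator {(y, t). norm y \<le> t} (y::'b, t)) \<partial>lborel \<partial>lborel)"
    by (rule lborel_pair.Fubini') measurable
  also have "\<dots> = (\<integral>\<^sup>+t. ennreal (4 * pi\<^sup>2 * t ^ 5 / (1 + t\<^sup>2) ^ 5) * indicator {0..r} t \<partial>lborel)"
  proof (rule nn_integral_cong)
    fix t :: real
    have "(\<integral>\<^sup>+y. ennreal (8 * t / (1 + t\<^sup>2) ^ 5) * (indicator {0..r} t * indicator {(y, t). norm y \<le> t} (y::'b, t)) \<partial>lborel) =
        ennreal (8 * t / (1 + t\<^sup>2) ^ 5) * (indicator {0..r} t * emeasure lborel (cball (0::'b) t))"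
    proof -
      have "(\<integral>\<^sup>+y. indicator {(y, t). norm y \<le> t} (y::'b, t) \<partial>lborel) = (\<integral>\<^sup>+y. indicator (cball 0 t) (y::'b) \<partial>lborel)"
        by (intro nn_integral_cong) (auto simp: indicator_def)
      then show ?thesis
        by (subst nn_integral_cmult, simp, subst nn_integral_cmult) auto
    qed
    also have "\<dots> = ennreal (4 * pi\<^sup>2 * t ^ 5 / (1 + t\<^sup>2) ^ 5) * indicator {0..r} t"
    proof (cases "t \<in> {0..r}")
      case True
      then show ?thesis
        using q[of t] by (simp add: emeasure_cball dim eval_unit_ball_vol ennreal_mult[symmetric] eval_nat_numeral)
    qed simp
    finally show "(\<integral>\<^sup>+y. ennreal (8 * t / (1 + t\<^sup>2) ^ 5) * (indicator {0..r} t * indicator {(y, t). norm y \<le> t} (y::'b, t)) \<partial>lborel) =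
        ennreal (4 * pi\<^sup>2 * t ^ 5 / (1 + t\<^sup>2) ^ 5) * indicator {0..r} t" .
  qed
  also have "\<dots> = ennreal (pi\<^sup>2 * (1 / 6 - 1 / (1 + r\<^sup>2)\<^sup>2 + 4 / (3 * (1 + r\<^sup>2) ^ 3) - 1 / (2 * (1 + r\<^sup>2) ^ 4)) -
      pi\<^sup>2 * (1 / 6 - 1 / (1 + 0\<^sup>2)\<^sup>2 + 4 / (3 * (1 + 0\<^sup>2) ^ 3) - 1 / (2 * (1 + 0\<^sup>2) ^ 4)))"
  \<comment> \<open>In the variable \<open>v = 1 + t ^ 2\<close> the integrand becomes
    \<open>2 * pi ^ 2 * (v - 1) ^ 2 / v ^ 5\<close>, which is integrated termwise; the constant 1/6
    makes the primitive vanish at \<open>t = 0\<close>.\<close>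
  proof (intro nn_integral_FTC_Icc[where
      F = "\<lambda>t. pi\<^sup>2 * (1 / 6 - 1 / (1 + t\<^sup>2)\<^sup>2 + 4 / (3 * (1 + t\<^sup>2) ^ 3) - 1 / (2 * (1 + t\<^sup>2) ^ 4))"])
    fix t :: real assume t: "t \<in> {0..r}"
    define v where "v = 1 + t\<^sup>2"
    have v: "v > 0" using q by (simp add: v_def)
    have 1: "((\<lambda>v. pi\<^sup>2 * (1 / 6 - 1 / v\<^sup>2 + 4 / (3 * v ^ 3) - 1 / (2 * v ^ 4))) has_real_derivative
        2 * pi\<^sup>2 * (v - 1)\<^sup>2 / v ^ 5) (at v)"
      apply (rule derivative_eq_intros refl | (use v in simp; fail))+
      using v apply (simp add: divide_simps)
      apply (simp add: eval_nat_numeral algebra_simps)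
      done
    have 2: "((\<lambda>t. 1 + t\<^sup>2) has_real_derivative 2 * t) (at t)"
      by (auto intro!: derivative_eq_intros)
    have eq: "2 * pi\<^sup>2 * (1 + t\<^sup>2 - 1)\<^sup>2 / (1 + t\<^sup>2) ^ 5 * (2 * t) = 4 * pi\<^sup>2 * t ^ 5 / (1 + t\<^sup>2) ^ 5"
      by (simp add: eval_nat_numeral)
    show "((\<lambda>t. pi\<^sup>2 * (1 / 6 - 1 / (1 + t\<^sup>2)\<^sup>2 + 4 / (3 * (1 + t\<^sup>2) ^ 3) - 1 / (2 * (1 + t\<^sup>2) ^ 4)))
        has_real_derivative 4 * pi\<^sup>2 * t ^ 5 / (1 + t\<^sup>2) ^ 5) (at t)"
      using DERIV_chain2[OF 1[unfolded v_def] 2] unfolding eq .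
    show "0 \<le> 4 * pi\<^sup>2 * t ^ 5 / (1 + t\<^sup>2) ^ 5"
      using q[of t] t by simp
  qed (use r in auto)
  finally have "(\<integral>\<^sup>+y. indicator (cball 0 r) y * ennreal (1 / (1 + (norm (y::'b))\<^sup>2) ^ 4) \<partial>lborel) =
      ennreal (1 / (1 + r\<^sup>2) ^ 4) * ennreal (pi\<^sup>2 / 2 * r ^ 4) +
      ennreal (pi\<^sup>2 * (1 / 6 - 1 / (1 + r\<^sup>2)\<^sup>2 + 4 / (3 * (1 + r\<^sup>2) ^ 3) - 1 / (2 * (1 + r\<^sup>2) ^ 4)))"
    using r by (simp add: emeasure_cball dim eval_unit_ball_vol ennreal_mult' eval_nat_numeral)
  also have "\<dots> = ennreal (1 / (1 + r\<^sup>2) ^ 4 * (pi\<^sup>2 / 2 * r ^ 4) +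
      pi\<^sup>2 * (1 / 6 - 1 / (1 + r\<^sup>2)\<^sup>2 + 4 / (3 * (1 + r\<^sup>2) ^ 3) - 1 / (2 * (1 + r\<^sup>2) ^ 4)))"
  proof -
    define v where "v = 1 + r\<^sup>2"
    have v: "v \<ge> 1" by (simp add: v_def)
    \<comment> \<open>The factored form shows nonnegativity, which is needed to add the two terms
      under one \<open>ennreal\<close>.\<close>
    have "1 / 6 - 1 / v\<^sup>2 + 4 / (3 * v ^ 3) - 1 / (2 * v ^ 4) = (v - 1) ^ 3 * (v + 3) / (6 * v ^ 4)"
      using v by (simp add: divide_simps) (simp add: eval_nat_numeral algebra_simps)
    also have "\<dots> \<ge> 0" using v by simp
    finally have "0 \<le> 1 / 6 - 1 / v\<^sup>2 + 4 / (3 * v ^ 3) - 1 / (2 * v ^ 4)" .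
    then show ?thesis
      using q[of r] by (subst ennreal_mult[symmetric]) (auto simp: v_def ennreal_plus[symmetric] simp del: ennreal_plus)
  qed
  also have "1 / (1 + r\<^sup>2) ^ 4 * (pi\<^sup>2 / 2 * r ^ 4) +
      pi\<^sup>2 * (1 / 6 - 1 / (1 + r\<^sup>2)\<^sup>2 + 4 / (3 * (1 + r\<^sup>2) ^ 3) - 1 / (2 * (1 + r\<^sup>2) ^ 4)) =
      pi\<^sup>2 / 6 * (1 - 3 / (1 + r\<^sup>2)\<^sup>2 + 2 / (1 + r\<^sup>2) ^ 3)"
  proof -
    define v where "v = 1 + r\<^sup>2"
    have v: "v > 0" "r ^ 4 = (v - 1)\<^sup>2" using q[of r] by (simp_all add: v_def eval_nat_numeral)
    show ?thesis
      unfolding v_def[symmetric] v(2) using v(1)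
      by (simp add: divide_simps) (simp add: eval_nat_numeral algebra_simps)
  qed
  finally show ?thesis .
qed

text \<open>The cap around \<open>(0, 1)\<close> is the \<open>stereo\<close> image of a ball whose
  radius is the tangent of half the angular radius of the cap.\<close>

lemma emeasure_sphere_law_cap:
  assumes dim: "DIM('b::euclidean_space) = 4" and h: "-1 < h" "h < 1"
  shows "emeasure sphere_law {x :: 'b \<times> real. h \<le> snd x} = ennreal (cap_cdf (- h))"
proof -
  define r where "r = sqrt ((1 - h) / (1 + h))"
  have r: "r \<ge> 0" "r\<^sup>2 = (1 - h) / (1 + h)"
    using h by (simp_all add: r_def)
  have iff: "h \<le> snd (stereo y) \<longleftrightarrow> y \<in> cball 0 r" for y :: 'b
  proof -
    have "h \<le> snd (stereo y) \<longleftrightarrow> (norm y)\<^sup>2 * (1 + h) \<le> 1 - h"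
      using one_plus_norm_square_pos[of y] by (simp add: stereo_def pos_le_divide_eq algebra_simps)
    also have "\<dots> \<longleftrightarrow> (norm y)\<^sup>2 \<le> r\<^sup>2"
      using h by (simp add: r pos_le_divide_eq)
    also have "\<dots> \<longleftrightarrow> norm y \<le> r"
      using r(1) by (simp add: abs_le_square_iff[symmetric])
    finally show ?thesis by simp
  qed
  have [measurable]: "{x :: 'b \<times> real. h \<le> snd x} \<in> sets borel"
    by (intro borel_closed closed_Collect_le continuous_intros)
  have "emeasure sphere_law {x :: 'b \<times> real. h \<le> snd x} =
      (\<integral>\<^sup>+x. indicator {x :: 'b \<times> real. h \<le> snd x} x \<partial>sphere_law)"
    by simp
  also have "\<dots> = ennreal (16 / 5) / emeasure lborel (ball (0::'b \<times> real) 1) *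
      (\<integral>\<^sup>+y. indicator (cball 0 r) y * ennreal (1 / (1 + (norm (y::'b))\<^sup>2) ^ 4) \<partial>lborel)"
    by (subst nn_integral_sphere_law_stereo) (simp_all add: dim indicator_def iff del: mem_cball_0)
  \<comment> \<open>The volume of the five-dimensional unit ball is \<open>8 * pi ^ 2 / 15\<close>,
    and 16/5 is the factor \<open>2 ^ 4 / Suc 4\<close> of the stereographic formula.\<close>
  also have "\<dots> = ennreal (16 / 5) / ennreal (8 * pi\<^sup>2 / 15) *
      ennreal (pi\<^sup>2 / 6 * (1 - 3 / (1 + r\<^sup>2)\<^sup>2 + 2 / (1 + r\<^sup>2) ^ 3))"
    using nn_integral_cball_dim4[OF dim r(1)]
    by (simp add: emeasure_ball dim eval_unit_ball_vol)
  also have "1 + r\<^sup>2 = 2 / (1 + h)"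
    using h by (simp add: r field_simps)
  also have "1 - 3 / (2 / (1 + h))\<^sup>2 + 2 / (2 / (1 + h)) ^ 3 = cap_cdf (- h)"
    using h by (simp add: cap_cdf_def power_divide) (simp add: eval_nat_numeral field_simps)
  also have "ennreal (16 / 5) / ennreal (8 * pi\<^sup>2 / 15) * ennreal (pi\<^sup>2 / 6 * cap_cdf (- h)) = ennreal (cap_cdf (- h))"
    using cap_cdf_nonneg[of "- h"] h by (simp add: divide_ennreal ennreal_mult[symmetric])
  finally show ?thesis .
qed

section \<open>An affine Blaschke--Petkantschin formula\<close>

lemma borel_measurable_fst_snd [measurable (raw)]:
  fixes f :: "'x \<Rightarrow> 'a::second_countable_topology \<times> 'b::second_countable_topology"
  assumes f: "f \<in> borel_measurable M"
  shows "(\<lambda>x. fst (f x)) \<in> borel_measurable M" "(\<lambda>x. snd (f x)) \<in> borel_measurable M"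
  by (rule measurable_compose[OF f], intro borel_measurable_continuous_onI continuous_intros)+

text \<open>Reorders the integrals so that all base parts precede all heights; iterated, it does
  this for four points of a product space.\<close>

lemma nn_integral_lborel_interleave:
  fixes f :: "('a::euclidean_space \<times> 'b::euclidean_space) \<times> ('c::euclidean_space \<times> 'd::euclidean_space) \<Rightarrow> ennreal"
  assumes [measurable]: "f \<in> borel_measurable borel"
  shows "(\<integral>\<^sup>+x. \<integral>\<^sup>+y. \<integral>\<^sup>+z. f (x, (y, z)) \<partial>lborel \<partial>lborel \<partial>lborel) =
    (\<integral>\<^sup>+p. \<integral>\<^sup>+q. f ((fst p, fst q), (snd p, snd q)) \<partial>lborel \<partial>lborel)"
proof -
  have [measurable]: "(\<lambda>q. f ((fst p, fst q), (snd p, snd q))) \<in> borel_measurable borel" for p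
    by measurable
  have "(\<integral>\<^sup>+x. \<integral>\<^sup>+y. \<integral>\<^sup>+z. f (x, (y, z)) \<partial>lborel \<partial>lborel \<partial>lborel) =
      (\<integral>\<^sup>+a. \<integral>\<^sup>+b. \<integral>\<^sup>+c. \<integral>\<^sup>+d. f ((a, b), (c, d)) \<partial>lborel \<partial>lborel \<partial>lborel \<partial>lborel)"
    by (subst nn_integral_lborel_Pair) auto
  also have "\<dots> = (\<integral>\<^sup>+a. \<integral>\<^sup>+c. \<integral>\<^sup>+b. \<integral>\<^sup>+d. f ((a, b), (c, d)) \<partial>lborel \<partial>lborel \<partial>lborel \<partial>lborel)"
    by (intro nn_integral_cong lborel_pair.Fubini') measurable
  also have "\<dots> = (\<integral>\<^sup>+a. \<integral>\<^sup>+c. \<integral>\<^sup>+q. f ((a, fst q), (c, snd q)) \<partial>lborel \<partial>lborel \<partial>lborel)"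
    by (intro nn_integral_cong) (subst nn_integral_lborel_Pair, auto)
  also have "\<dots> = (\<integral>\<^sup>+p. \<integral>\<^sup>+q. f ((fst p, fst q), (snd p, snd q)) \<partial>lborel \<partial>lborel)"
    by (subst nn_integral_lborel_Pair[where f = "\<lambda>p. \<integral>\<^sup>+q. f ((fst p, fst q), (snd p, snd q)) \<partial>lborel"]) auto
  finally show ?thesis .
qed

lemma nn_integral_lborel_quad:
  fixes f :: "'a::euclidean_space \<times> 'b::euclidean_space \<times> 'c::euclidean_space \<times> 'd::euclidean_space \<Rightarrow> ennreal"
  assumes [measurable]: "f \<in> borel_measurable borel"
  shows "(\<integral>\<^sup>+p. f p \<partial>lborel) = (\<integral>\<^sup>+w. \<integral>\<^sup>+x. \<integral>\<^sup>+y. \<integral>\<^sup>+z. f (w, x, y, z) \<partial>lborel \<partial>lborel \<partial>lborel \<partial>lborel)"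
  by (subst nn_integral_lborel_Pair, measurable, subst nn_integral_lborel_Pair, measurable,
      subst nn_integral_lborel_Pair, measurable)

text \<open>Heights come as nested pairs, whereas the matrix of the change of variables acts on
  \<open>real ^ 3\<close>.\<close>

lemma nn_integral_lborel_vec3:
  fixes f :: "real ^ 3 \<Rightarrow> ennreal"
  assumes [measurable]: "f \<in> borel_measurable borel"
  shows "(\<integral>\<^sup>+v. f v \<partial>lborel) = (\<integral>\<^sup>+t. f (vector [fst t, fst (snd t), snd (snd t)]) \<partial>(lborel :: (real \<times> real \<times> real) measure))"
proof -
  define T :: "real \<times> real \<times> real \<Rightarrow> real ^ 3" where "T t = vector [fst t, fst (snd t), snd (snd t)]" for t
  have lin: "linear T"
    by (rule linearI) (simp_all add: T_def vec_eq_iff forall_3)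
  have [measurable]: "T \<in> borel_measurable borel"
    by (intro borel_measurable_continuous_onI linear_continuous_on linear_conv_bounded_linear[THEN iffD1] lin)
  have B: "Basis = {(1::real, 0::real, 0::real), (0, 1, 0), (0, 0, 1)}"
    by (auto simp: Basis_prod_def zero_prod_def)
  have B3: "(Basis :: (real ^ 3) set) = {axis 1 1, axis 2 1, axis 3 1}"
    by (auto simp: Basis_vec_def UNIV_3)
  have TB: "T (1, 0, 0) = axis 1 1" "T (0, 1, 0) = axis 2 1" "T (0, 0, 1) = axis 3 1"
    by (simp_all add: T_def vec_eq_iff forall_3 axis_def)
  have "distr lborel borel T = lborel"
  proof (rule lborel_distr_basis_bij)
    show "bij_betw T Basis Basis"
      unfolding bij_betw_def B B3 by (auto simp: TB inj_on_def axis_eq_axis)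
    show "T x \<bullet> T b = x \<bullet> b" if "b \<in> Basis" for x b
      using that unfolding B by (auto simp: T_def inner_vec_def inner_prod_def sum_3)
  qed simp
  then have "(\<integral>\<^sup>+v. f v \<partial>lborel) = (\<integral>\<^sup>+v. f v \<partial>distr lborel borel T)"
    by simp
  also have "\<dots> = (\<integral>\<^sup>+t. f (T t) \<partial>lborel)"
    by (subst nn_integral_distr) auto
  finally show ?thesis by (simp add: T_def)
qed

section \<open>Base simplices and the Jacobian of the heights above them\<close>

lemma AE_lborel_hyperplane:
  fixes c :: "'a::euclidean_space"
  assumes "c \<noteq> 0"
  shows "AE x in lborel. c \<bullet> x \<noteq> d"
proof -
  have "{x. c \<bullet> x = d} \<in> sets borel"
    by (intro borel_closed closed_hyperplane)
  moreover have "{x. c \<bullet> x = d} \<in> null_sets lebesgue"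
    using negligible_hyperplane[of c d] assms by (simp add: negligible_iff_null_sets)
  ultimately have "{x. c \<bullet> x = d} \<in> null_sets lborel"
    by (auto simp: null_sets_def)
  from AE_not_in[OF this] show ?thesis by simp
qed

text \<open>Six times the volume of the tetrahedron with these vertices; it is the Jacobian in
  \<open>nn_integral_heights\<close>.\<close>

definition simplex_det :: "(real ^ 3) \<times> (real ^ 3) \<times> (real ^ 3) \<times> (real ^ 3) \<Rightarrow> real"
  where "simplex_det = (\<lambda>(z1, z2, z3, z4). \<bar>det (vector [z2 - z1, z3 - z1, z4 - z1] :: real ^ 3 ^ 3)\<bar>)"

lemma borel_measurable_simplex_det [measurable]: "simplex_det \<in> borel_measurable borel"
  unfolding simplex_det_def case_prod_beta det_3 vector_3
  by (intro borel_measurable_continuous_onI continuous_intros)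

lemma simplex_det_nonneg: "0 \<le> simplex_det Z"
  by (auto simp: simplex_det_def split: prod.split)

text \<open>Vertices are added one at a time, each avoiding a plane fixed by the earlier ones, so
  that the nested integral over the degenerate set vanishes from the inside outwards.\<close>

lemma AE_simplex_det_nonzero: "AE Z in lborel. simplex_det Z \<noteq> 0"
proof -
  let ?N = "{Z. simplex_det Z = 0}"
  have [measurable]: "?N \<in> sets borel"
    by measurable
  have inner0: "(\<integral>\<^sup>+z2. \<integral>\<^sup>+z3. \<integral>\<^sup>+z4. indicator ?N (z1, z2, z3, z4) \<partial>lborel \<partial>lborel \<partial>lborel) = 0" for z1
  proof -
    have "AE z2 in lborel. (\<integral>\<^sup>+z3. \<integral>\<^sup>+z4. indicator ?N (z1, z2, z3, z4) \<partial>lborel \<partial>lborel) = 0"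
    proof -
      have "axis (3::3) (1::real) \<noteq> 0" by simp
      from AE_lborel_hyperplane[OF this, of "z1 $ 3"]
      show ?thesis
      proof eventually_elim
        fix z2 :: "real ^ 3" assume z2: "axis 3 1 \<bullet> z2 \<noteq> z1 $ 3"
        define q where "q = z2 - z1"
        have q: "q $ 3 \<noteq> 0" using z2 by (simp add: q_def inner_axis')
        \<comment> \<open>\<open>c\<close> is orthogonal to \<open>q\<close>, and its product with
          \<open>r\<close> is, up to sign, the first coordinate of the cross product of
          \<open>q\<close> and \<open>r\<close>, which therefore does not vanish.\<close>
        define c :: "real ^ 3" where "c = vector [0, q $ 3, - q $ 2]"
        have "c \<noteq> 0" using q by (auto simp: c_def vec_eq_iff forall_3)
        from AE_lborel_hyperplane[OF this, of "c \<bullet> z1"]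
        have "AE z3 in lborel. (\<integral>\<^sup>+z4. indicator ?N (z1, z2, z3, z4) \<partial>lborel) = 0"
        proof eventually_elim
          fix z3 :: "real ^ 3" assume z3: "c \<bullet> z3 \<noteq> c \<bullet> z1"
          define r where "r = z3 - z1"
          have r: "q $ 3 * r $ 2 - q $ 2 * r $ 3 \<noteq> 0"
            using z3 by (simp add: c_def r_def inner_vec_def sum_3 algebra_simps)
          \<comment> \<open>The cross product of \<open>q\<close> and \<open>r\<close>, normal to
            the plane through \<open>z1\<close>, \<open>z2\<close> and \<open>z3\<close>.\<close>
          define v :: "real ^ 3" where "v = vector [q $ 2 * r $ 3 - q $ 3 * r $ 2,
            q $ 3 * r $ 1 - q $ 1 * r $ 3, q $ 1 * r $ 2 - q $ 2 * r $ 1]"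
          have "v \<noteq> 0" using r by (auto simp: v_def vec_eq_iff forall_3)
          from AE_lborel_hyperplane[OF this, of "v \<bullet> z1"]
          have "AE z4 in lborel. indicator ?N (z1, z2, z3, z4) = (0::ennreal)"
          proof eventually_elim
            fix z4 :: "real ^ 3" assume "v \<bullet> z4 \<noteq> v \<bullet> z1"
            then have "v \<bullet> (z4 - z1) \<noteq> 0" by (simp add: inner_diff_right)
            moreover have "det (vector [q, r, z4 - z1] :: real ^ 3 ^ 3) = v \<bullet> (z4 - z1)"
              by (simp add: det_3 v_def inner_vec_def sum_3 algebra_simps)
            ultimately show "indicator ?N (z1, z2, z3, z4) = (0::ennreal)"
              by (simp add: simplex_det_def q_def r_def)
          qed
          then show "(\<integral>\<^sup>+z4. indicator ?N (z1, z2, z3, z4) \<partial>lborel) = 0"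
            by (subst nn_integral_0_iff_AE) auto
        qed
        then show "(\<integral>\<^sup>+z3. \<integral>\<^sup>+z4. indicator ?N (z1, z2, z3, z4) \<partial>lborel \<partial>lborel) = 0"
          by (subst nn_integral_0_iff_AE) auto
      qed
    qed
    then show ?thesis by (subst nn_integral_0_iff_AE) auto
  qed
  have "emeasure lborel ?N = (\<integral>\<^sup>+Z. indicator ?N Z \<partial>lborel)"
    by simp
  also have "\<dots> = (\<integral>\<^sup>+z1. \<integral>\<^sup>+z2. \<integral>\<^sup>+z3. \<integral>\<^sup>+z4. indicator ?N (z1, z2, z3, z4) \<partial>lborel \<partial>lborel \<partial>lborel \<partial>lborel)"
    by (rule nn_integral_lborel_quad) measurable
  also have "\<dots> = 0"
    by (simp add: inner0)
  finally have "?N \<in> null_sets lborel"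
    by (intro null_setsI) auto
  from AE_not_in[OF this] show ?thesis by simp
qed

text \<open>Over an affinely independent base, four heights determine a unique affine function with
  values \<open>a + b . z\<close>. The map from its coefficients to the heights is linear, with
  determinant \<open>simplex_det\<close> up to sign.\<close>

lemma nn_integral_heights:
  fixes z1 z2 z3 z4 :: "real ^ 3" and g :: "real \<times> real \<times> real \<times> real \<Rightarrow> ennreal"
  assumes [measurable]: "g \<in> borel_measurable borel" and D: "simplex_det (z1, z2, z3, z4) \<noteq> 0"
  shows "(\<integral>\<^sup>+T. g T \<partial>lborel) = ennreal (simplex_det (z1, z2, z3, z4)) *
    (\<integral>\<^sup>+b. \<integral>\<^sup>+a. g (a + b \<bullet> z1, a + b \<bullet> z2, a + b \<bullet> z3, a + b \<bullet> z4) \<partial>lborel \<partial>lborel)"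
proof -
  define A :: "real ^ 3 ^ 3" where "A = vector [z2 - z1, z3 - z1, z4 - z1]"
  have A: "det A \<noteq> 0" "\<bar>det A\<bar> = simplex_det (z1, z2, z3, z4)"
    using D by (auto simp: A_def simplex_det_def)
  have Av: "(vec t + A *v b) $ 1 = t + b \<bullet> (z2 - z1)" "(vec t + A *v b) $ 2 = t + b \<bullet> (z3 - z1)"
    "(vec t + A *v b) $ 3 = t + b \<bullet> (z4 - z1)" for t b
    by (simp_all add: A_def matrix_vector_mult_def inner_vec_def mult.commute)
  have [measurable]: "(\<lambda>v. v $ i) \<in> borel_measurable (borel :: (real ^ 3) measure)" for i
    by (intro borel_measurable_continuous_onI continuous_intros)
  have "(\<integral>\<^sup>+T. g T \<partial>lborel) = (\<integral>\<^sup>+t1. \<integral>\<^sup>+t. g (t1, t) \<partial>lborel \<partial>lborel)"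
    by (rule nn_integral_lborel_Pair) measurable
  also have "\<dots> = (\<integral>\<^sup>+t1. \<integral>\<^sup>+v. g (t1, v $ 1, v $ 2, v $ 3) \<partial>(lborel :: (real ^ 3) measure) \<partial>lborel)"
    by (subst nn_integral_lborel_vec3) auto
  also have "\<dots> = (\<integral>\<^sup>+t1. ennreal \<bar>det A\<bar> * (\<integral>\<^sup>+b. g (t1, t1 + b \<bullet> (z2 - z1), t1 + b \<bullet> (z3 - z1), t1 + b \<bullet> (z4 - z1)) \<partial>lborel) \<partial>lborel)"
  proof (rule nn_integral_cong)
    fix t1 :: real
    have "(\<integral>\<^sup>+v. g (t1, v $ 1, v $ 2, v $ 3) \<partial>(lborel :: (real ^ 3) measure)) = ennreal \<bar>det A\<bar> *
        (\<integral>\<^sup>+b. g (t1, (vec t1 + A *v b) $ 1, (vec t1 + A *v b) $ 2, (vec t1 + A *v b) $ 3) \<partial>lborel)"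
      by (rule nn_integral_lborel_affine_matrix[OF A(1)]) measurable
    then show "(\<integral>\<^sup>+v. g (t1, v $ 1, v $ 2, v $ 3) \<partial>(lborel :: (real ^ 3) measure)) = ennreal \<bar>det A\<bar> *
        (\<integral>\<^sup>+b. g (t1, t1 + b \<bullet> (z2 - z1), t1 + b \<bullet> (z3 - z1), t1 + b \<bullet> (z4 - z1)) \<partial>lborel)"
      by (simp only: Av)
  qed
  also have "\<dots> = ennreal \<bar>det A\<bar> * (\<integral>\<^sup>+t1. \<integral>\<^sup>+b. g (t1, t1 + b \<bullet> (z2 - z1), t1 + b \<bullet> (z3 - z1), t1 + b \<bullet> (z4 - z1)) \<partial>lborel \<partial>lborel)"
    by (rule nn_integral_cmult) measurable
  also have "(\<integral>\<^sup>+t1. \<integral>\<^sup>+b. g (t1, t1 + b \<bullet> (z2 - z1), t1 + b \<bullet> (z3 - z1), t1 + b \<bullet> (z4 - z1)) \<partial>lborel \<partial>lborel) =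
      (\<integral>\<^sup>+b. \<integral>\<^sup>+t1. g (t1, t1 + b \<bullet> (z2 - z1), t1 + b \<bullet> (z3 - z1), t1 + b \<bullet> (z4 - z1)) \<partial>lborel \<partial>lborel)"
    by (rule lborel_pair.Fubini') measurable
  also have "\<dots> = (\<integral>\<^sup>+b. \<integral>\<^sup>+a. g (a + b \<bullet> z1, a + b \<bullet> z2, a + b \<bullet> z3, a + b \<bullet> z4) \<partial>lborel \<partial>lborel)"
  proof (rule nn_integral_cong)
    \<comment> \<open>Passing from the height at \<open>z1\<close> to the constant term is a
      translation by \<open>b . z1\<close>.\<close>
    fix b :: "real ^ 3"
    have "(\<integral>\<^sup>+t1. g (t1, t1 + b \<bullet> (z2 - z1), t1 + b \<bullet> (z3 - z1), t1 + b \<bullet> (z4 - z1)) \<partial>lborel) =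
        (\<integral>\<^sup>+a. g (b \<bullet> z1 + a, b \<bullet> z1 + a + b \<bullet> (z2 - z1), b \<bullet> z1 + a + b \<bullet> (z3 - z1), b \<bullet> z1 + a + b \<bullet> (z4 - z1)) \<partial>lborel)"
      by (rule nn_integral_lborel_translation[symmetric]) measurable
    then show "(\<integral>\<^sup>+t1. g (t1, t1 + b \<bullet> (z2 - z1), t1 + b \<bullet> (z3 - z1), t1 + b \<bullet> (z4 - z1)) \<partial>lborel) =
        (\<integral>\<^sup>+a. g (a + b \<bullet> z1, a + b \<bullet> z2, a + b \<bullet> z3, a + b \<bullet> z4) \<partial>lborel)"
      by (simp add: inner_diff_right algebra_simps)
  qed
  finally show ?thesis by (simp add: A)
qed

lemma det_id_plus_rank_one:
  fixes b :: "real ^ 3"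
  shows "det (\<chi> i j. (if i = j then 1 else 0) + c * b $ i * b $ j) = 1 + c * (norm b)\<^sup>2"
  unfolding power2_norm_eq_inner by (simp add: det_3 inner_vec_def sum_3) (simp add: algebra_simps)

text \<open>Each of the four volume elements contributes a factor of the determinant, and the volume
  of the tetrahedron a fifth.\<close>

lemma nn_integral_simplex_det_affine:
  fixes A :: "real ^ 3 ^ 3" and F :: "real ^ 3 \<Rightarrow> ennreal"
  assumes A: "det A \<noteq> 0" and [measurable]: "F \<in> borel_measurable borel"
  shows "(\<integral>\<^sup>+z1. \<integral>\<^sup>+z2. \<integral>\<^sup>+z3. \<integral>\<^sup>+z4. ennreal (simplex_det (z1, z2, z3, z4)) * (F z1 * F z2 * F z3 * F z4)
      \<partial>lborel \<partial>lborel \<partial>lborel \<partial>lborel) = ennreal (\<bar>det A\<bar> ^ 5) *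
    (\<integral>\<^sup>+z1. \<integral>\<^sup>+z2. \<integral>\<^sup>+z3. \<integral>\<^sup>+z4. ennreal (simplex_det (z1, z2, z3, z4)) *
      (F (v + A *v z1) * F (v + A *v z2) * F (v + A *v z3) * F (v + A *v z4))
      \<partial>lborel \<partial>lborel \<partial>lborel \<partial>lborel)"
proof -
  define T where "T z = v + A *v z" for z
  have [measurable]: "T \<in> borel_measurable borel"
    unfolding T_def by (intro borel_measurable_continuous_onI continuous_intros linear_continuous_on matrix_vector_mul_bounded_linear)
  have D: "simplex_det (T z1, T z2, T z3, T z4) = \<bar>det A\<bar> * simplex_det (z1, z2, z3, z4)" for z1 z2 z3 z4
  proof -
    have "vector [T z2 - T z1, T z3 - T z1, T z4 - T z1] =
        (vector [z2 - z1, z3 - z1, z4 - z1] :: real ^ 3 ^ 3) ** transpose A"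
      by (simp add: vec_eq_iff forall_3 T_def matrix_matrix_mult_def matrix_vector_mult_def transpose_def
          sum_3 algebra_simps)
    then show ?thesis
      by (simp add: simplex_det_def det_mul abs_mult mult.commute)
  qed
  have cov: "(\<integral>\<^sup>+z. f z \<partial>lborel) = ennreal \<bar>det A\<bar> * (\<integral>\<^sup>+z. f (T z) \<partial>lborel)"
    if "f \<in> borel_measurable borel" for f
    unfolding T_def by (rule nn_integral_lborel_affine_matrix[OF A that])
  define d where "d = ennreal \<bar>det A\<bar>"
  define G where "G = (\<lambda>(z1, z2, z3, z4). ennreal (simplex_det (z1, z2, z3, z4)) * (F z1 * F z2 * F z3 * F z4))"
  have [measurable]: "G \<in> borel_measurable borel"
    unfolding G_def case_prod_beta by measurable
  have c4: "(\<integral>\<^sup>+z4. G (z1, z2, z3, z4) \<partial>lborel) = d * (\<integral>\<^sup>+z4. G (z1, z2, z3, T z4) \<partial>lborel)" for z1 z2 z3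
    unfolding d_def by (rule cov) measurable
  have c3: "(\<integral>\<^sup>+z3. \<integral>\<^sup>+z4. G (z1, z2, z3, z4) \<partial>lborel \<partial>lborel) =
      d * (d * (\<integral>\<^sup>+z3. \<integral>\<^sup>+z4. G (z1, z2, T z3, T z4) \<partial>lborel \<partial>lborel))" for z1 z2
    unfolding c4 by (subst nn_integral_cmult, measurable)
      (rule arg_cong[where f = "(*) d"], unfold d_def, rule cov, measurable)
  have c2: "(\<integral>\<^sup>+z2. \<integral>\<^sup>+z3. \<integral>\<^sup>+z4. G (z1, z2, z3, z4) \<partial>lborel \<partial>lborel \<partial>lborel) =
      d * (d * (d * (\<integral>\<^sup>+z2. \<integral>\<^sup>+z3. \<integral>\<^sup>+z4. G (z1, T z2, T z3, T z4) \<partial>lborel \<partial>lborel \<partial>lborel)))" for z1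
    unfolding c3 by (subst nn_integral_cmult, measurable, subst nn_integral_cmult, measurable)
      (rule arg_cong[where f = "\<lambda>x. d * (d * x)"], unfold d_def, rule cov, measurable)
  have c1: "(\<integral>\<^sup>+z1. \<integral>\<^sup>+z2. \<integral>\<^sup>+z3. \<integral>\<^sup>+z4. G (z1, z2, z3, z4) \<partial>lborel \<partial>lborel \<partial>lborel \<partial>lborel) =
      d * (d * (d * (d * (\<integral>\<^sup>+z1. \<integral>\<^sup>+z2. \<integral>\<^sup>+z3. \<integral>\<^sup>+z4. G (T z1, T z2, T z3, T z4) \<partial>lborel \<partial>lborel \<partial>lborel \<partial>lborel))))"
    unfolding c2
    by (subst nn_integral_cmult, measurable, subst nn_integral_cmult, measurable, subst nn_integral_cmult, measurable)
      (rule arg_cong[where f = "\<lambda>x. d * (d * (d * x))"], unfold d_def, rule cov, measurable)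
  define H where "H = (\<lambda>(z1, z2, z3, z4). ennreal (simplex_det (z1, z2, z3, z4)) * (F (T z1) * F (T z2) * F (T z3) * F (T z4)))"
  have [measurable]: "H \<in> borel_measurable borel"
    unfolding H_def case_prod_beta by measurable
  have GT: "G (T z1, T z2, T z3, T z4) = d * H (z1, z2, z3, z4)" for z1 z2 z3 z4
    by (simp add: G_def H_def D d_def ennreal_mult simplex_det_nonneg mult.assoc)
  have c0: "(\<integral>\<^sup>+z1. \<integral>\<^sup>+z2. \<integral>\<^sup>+z3. \<integral>\<^sup>+z4. G (T z1, T z2, T z3, T z4) \<partial>lborel \<partial>lborel \<partial>lborel \<partial>lborel) =
      d * (\<integral>\<^sup>+z1. \<integral>\<^sup>+z2. \<integral>\<^sup>+z3. \<integral>\<^sup>+z4. H (z1, z2, z3, z4) \<partial>lborel \<partial>lborel \<partial>lborel \<partial>lborel)"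
    unfolding GT
    by (subst nn_integral_cmult, measurable, subst nn_integral_cmult, measurable, subst nn_integral_cmult, measurable,
        subst nn_integral_cmult, measurable)
  have "ennreal (\<bar>det A\<bar> ^ 5) = d ^ 5"
    unfolding d_def by (rule ennreal_power[symmetric]) simp
  also have "\<dots> = d * (d * (d * (d * d)))"
    by (simp add: eval_nat_numeral)
  finally have "ennreal (\<bar>det A\<bar> ^ 5) = d * (d * (d * (d * d)))" .
  then show ?thesis
    using c1[unfolded c0] by (simp add: G_def H_def T_def mult.assoc)
qed

text \<open>The weight of the stereographic formula for a chart of dimension four, with the chart
  split into base and height.\<close>

definition beta_weight :: "(real ^ 3) \<times> real \<Rightarrow> real"
  where "beta_weight y = 1 / (1 + (norm y)\<^sup>2) ^ 4"

lemma borel_measurable_beta_weight [measurable]: "beta_weight \<in> borel_measurable borel"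
  unfolding beta_weight_def by measurable

lemma beta_weight_nonneg: "0 \<le> beta_weight y"
  unfolding beta_weight_def using one_plus_norm_square_pos[of y] by simp

text \<open>Never evaluated: it is absorbed by the normalisation in
  \<open>nn_integral_hyperplane_distance\<close>.\<close>

definition simplex_const :: ennreal
  where "simplex_const = (\<integral>\<^sup>+z1. \<integral>\<^sup>+z2. \<integral>\<^sup>+z3. \<integral>\<^sup>+z4. ennreal (simplex_det (z1, z2, z3, z4)) *
    (ennreal (beta_weight (z1, 0)) * ennreal (beta_weight (z2, 0)) * ennreal (beta_weight (z3, 0)) * ennreal (beta_weight (z4, 0)))
    \<partial>lborel \<partial>lborel \<partial>lborel \<partial>lborel)"

text \<open>Completing the square in \<open>1 + \<bar>z\<bar>\<^sup>2 + (a + b \<bullet> z)\<^sup>2\<close>: the linear part of the substitution is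
  \<open>s (I + c b b\<^sup>T)\<close>, a multiple of the inverse square root of \<open>I + b b\<^sup>T\<close>.\<close>

lemma complete_square_graph:
  fixes a :: real and b :: "real ^ 3"
  defines "q \<equiv> 1 + (norm b)\<^sup>2"
  defines "s \<equiv> sqrt (1 + (a / sqrt q)\<^sup>2)"
  obtains A :: "real ^ 3 ^ 3" and v where "\<bar>det A\<bar> = s ^ 3 / sqrt q"
    "\<And>z. beta_weight (v + A *v z, a + b \<bullet> (v + A *v z)) = beta_weight (z, 0) / s ^ 8"
proof -
  have q: "q > 0" "(norm b)\<^sup>2 = q - 1" "b \<bullet> b = q - 1"
    using one_plus_norm_square_pos[of b] by (simp_all add: q_def power2_norm_eq_inner[symmetric])
  define r where "r = sqrt q"
  have r: "r > 0" "r\<^sup>2 = q" using q by (simp_all add: r_def)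
  have s: "s > 0" "s\<^sup>2 = 1 + a\<^sup>2 / q"
    using r q(1) by (simp_all add: s_def r_def[symmetric] add_pos_nonneg power_divide)
  \<comment> \<open>A root of \<open>c ^ 2 * (q - 1) + 2 * c + 1 / q = 0\<close>, which says that
    the square of \<open>I + c b b^T\<close> is the inverse of \<open>I + b b^T\<close>.\<close>
  define c where "c = - 1 / (r * (r + 1))"
  have c1: "1 + c * (q - 1) = 1 / r"
  proof -
    have "q - 1 = (r - 1) * (r + 1)"
      by (simp add: r(2)[symmetric] power2_eq_square algebra_simps)
    then have "c * (q - 1) = - (r - 1) / r"
      using r(1) by (simp add: c_def divide_simps)
    then show ?thesis using r(1) by (simp add: field_simps)
  qed
  have c2: "2 * c + c\<^sup>2 * (q - 1) + 1 / q = 0"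
    using r(1) unfolding r(2)[symmetric] c_def
    by (simp add: divide_simps) (simp add: power2_eq_square algebra_simps)
  define B :: "real ^ 3 ^ 3" where "B = (\<chi> i j. (if i = j then 1 else 0) + c * b $ i * b $ j)"
  define A where "A = s *\<^sub>R B"
  \<comment> \<open>The minimiser of \<open>1 + norm z ^ 2 + (a + b . z) ^ 2\<close>; the minimum is
    \<open>s ^ 2\<close>.\<close>
  define v where "v = - (a / q) *\<^sub>R b"
  have Bz: "B *v z = z + (c * (b \<bullet> z)) *\<^sub>R b" for z
    by (simp add: B_def vec_eq_iff matrix_vector_mult_def inner_vec_def sum_3 forall_3 algebra_simps)
  have Az: "A *v z = s *\<^sub>R (z + (c * (b \<bullet> z)) *\<^sub>R b)" for z
    unfolding A_def by (simp add: scaleR_matrix_vector_assoc[symmetric] Bz)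
  have "det A = s ^ 3 * det B"
    unfolding A_def by (simp add: det_3 power3_eq_cube algebra_simps)
  also have "det B = 1 / r"
    unfolding B_def det_id_plus_rank_one q(2) c1 ..
  finally have "\<bar>det A\<bar> = s ^ 3 / sqrt q"
    using s(1) r by (simp add: r_def)
  moreover have "beta_weight (v + A *v z, a + b \<bullet> (v + A *v z)) = beta_weight (z, 0) / s ^ 8" for z
  proof -
    define t where "t = b \<bullet> z"
    define w where "w = z + (c * t) *\<^sub>R b"
    have bw: "b \<bullet> w = t / r"
    proof -
      have "b \<bullet> w = t * (1 + c * (q - 1))"
        by (simp add: w_def inner_add_right q t_def[symmetric] algebra_simps)
      then show ?thesis by (simp add: c1)
    qed
    have ww: "w \<bullet> w = z \<bullet> z - (t / r)\<^sup>2"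
    proof -
      have "w \<bullet> w = z \<bullet> z + t\<^sup>2 * (2 * c + c\<^sup>2 * (q - 1))"
        by (simp add: w_def inner_add_left inner_add_right q t_def inner_commute power2_eq_square algebra_simps)
      also have "2 * c + c\<^sup>2 * (q - 1) = - (1 / q)" using c2 by simp
      finally show ?thesis using r by (simp add: power_divide)
    qed
    have bv: "b \<bullet> (v + A *v z) = - (a / q) * (q - 1) + s * (t / r)"
      by (simp add: Az t_def[symmetric] w_def[symmetric] v_def inner_add_right inner_diff_right q bw)
    have vv: "(v + A *v z) \<bullet> (v + A *v z) = (a / q)\<^sup>2 * (q - 1) - 2 * (a / q) * s * (t / r) + s\<^sup>2 * (z \<bullet> z - (t / r)\<^sup>2)"
      by (simp add: Az t_def[symmetric] w_def[symmetric] v_def inner_add_left inner_add_right inner_diff_left inner_diff_right q bw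
          inner_commute[of w b] ww power2_eq_square algebra_simps) (use q(1) in \<open>simp add: divide_simps algebra_simps\<close>)
    have "a + b \<bullet> (v + A *v z) = a / q + s * (t / r)"
      unfolding bv using q(1) by (simp add: field_simps)
    then have "1 + (norm (v + A *v z, a + b \<bullet> (v + A *v z)))\<^sup>2 =
        1 + ((a / q)\<^sup>2 * (q - 1) - 2 * (a / q) * s * (t / r) + s\<^sup>2 * (z \<bullet> z - (t / r)\<^sup>2)) + (a / q + s * (t / r))\<^sup>2"
      unfolding power2_norm_eq_inner inner_Pair vv by (simp add: power2_eq_square)
    also have "\<dots> = 1 + (a / q)\<^sup>2 * q + s\<^sup>2 * (z \<bullet> z)"
    proof -
      have "1 + (\<alpha>\<^sup>2 * (q - 1) - 2 * \<alpha> * s * \<tau> + s\<^sup>2 * (\<zeta> - \<tau>\<^sup>2)) + (\<alpha> + s * \<tau>)\<^sup>2 = 1 + \<alpha>\<^sup>2 * q + s\<^sup>2 * \<zeta>"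
        for \<alpha> \<tau> \<zeta> :: real
        by (simp add: power2_eq_square algebra_simps)
      then show ?thesis .
    qed
    also have "1 + (a / q)\<^sup>2 * q = s\<^sup>2"
      unfolding s(2) using q(1) by (simp add: power2_eq_square)
    finally have "1 + (norm (v + A *v z, a + b \<bullet> (v + A *v z)))\<^sup>2 = s\<^sup>2 * (1 + (norm (z, 0::real))\<^sup>2)"
      unfolding power2_norm_eq_inner inner_Pair by (simp add: algebra_simps)
    then show ?thesis
      by (simp add: beta_weight_def power_mult_distrib power_mult[symmetric])
  qed
  ultimately show thesis by (rule that)
qed

text \<open>By \<open>complete_square_graph\<close> the determinant enters as
  \<open>s ^ 15 / sqrt q ^ 5\<close> and the four weights as \<open>1 / s ^ 32\<close>, which leaves
  the exponent 17.\<close>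

lemma nn_integral_simplex_graph:
  fixes a :: real and b :: "real ^ 3"
  defines "q \<equiv> 1 + (norm b)\<^sup>2"
  shows "(\<integral>\<^sup>+z1. \<integral>\<^sup>+z2. \<integral>\<^sup>+z3. \<integral>\<^sup>+z4. ennreal (simplex_det (z1, z2, z3, z4)) *
      (ennreal (beta_weight (z1, a + b \<bullet> z1)) * ennreal (beta_weight (z2, a + b \<bullet> z2)) *
       ennreal (beta_weight (z3, a + b \<bullet> z3)) * ennreal (beta_weight (z4, a + b \<bullet> z4)))
      \<partial>lborel \<partial>lborel \<partial>lborel \<partial>lborel) =
    ennreal (1 / (sqrt (1 + (a / sqrt q)\<^sup>2) ^ 17 * sqrt q ^ 5)) * simplex_const"
proof -
  define s where "s = sqrt (1 + (a / sqrt q)\<^sup>2)"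
  have s: "s > 0" by (simp add: s_def add_pos_nonneg)
  have q: "q > 0" unfolding q_def by (rule one_plus_norm_square_pos)
  obtain A :: "real ^ 3 ^ 3" and v where A: "\<bar>det A\<bar> = s ^ 3 / sqrt q"
    and w: "\<And>z. beta_weight (v + A *v z, a + b \<bullet> (v + A *v z)) = beta_weight (z, 0) / s ^ 8"
    using complete_square_graph[of a b] unfolding q_def s_def by blast
  have w': "ennreal (beta_weight (v + A *v z, a + b \<bullet> (v + A *v z))) = ennreal (1 / s ^ 8) * ennreal (beta_weight (z, 0))" for z
    using s unfolding w by (subst ennreal_mult[symmetric]) (auto simp: beta_weight_nonneg)
  have "det A \<noteq> 0" using A s q by auto
  then have "(\<integral>\<^sup>+z1. \<integral>\<^sup>+z2. \<integral>\<^sup>+z3. \<integral>\<^sup>+z4. ennreal (simplex_det (z1, z2, z3, z4)) *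
      (ennreal (beta_weight (z1, a + b \<bullet> z1)) * ennreal (beta_weight (z2, a + b \<bullet> z2)) *
       ennreal (beta_weight (z3, a + b \<bullet> z3)) * ennreal (beta_weight (z4, a + b \<bullet> z4)))
      \<partial>lborel \<partial>lborel \<partial>lborel \<partial>lborel) = ennreal (\<bar>det A\<bar> ^ 5) *
      (\<integral>\<^sup>+z1. \<integral>\<^sup>+z2. \<integral>\<^sup>+z3. \<integral>\<^sup>+z4. ennreal (simplex_det (z1, z2, z3, z4)) *
      (ennreal (beta_weight (v + A *v z1, a + b \<bullet> (v + A *v z1))) * ennreal (beta_weight (v + A *v z2, a + b \<bullet> (v + A *v z2))) *
       ennreal (beta_weight (v + A *v z3, a + b \<bullet> (v + A *v z3))) * ennreal (beta_weight (v + A *v z4, a + b \<bullet> (v + A *v z4))))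
      \<partial>lborel \<partial>lborel \<partial>lborel \<partial>lborel)"
    by (rule nn_integral_simplex_det_affine) measurable
  also have "\<dots> = ennreal (\<bar>det A\<bar> ^ 5) *
      (\<integral>\<^sup>+z1. \<integral>\<^sup>+z2. \<integral>\<^sup>+z3. \<integral>\<^sup>+z4. ennreal (1 / s ^ 8) ^ 4 * (ennreal (simplex_det (z1, z2, z3, z4)) *
      (ennreal (beta_weight (z1, 0)) * ennreal (beta_weight (z2, 0)) *
       ennreal (beta_weight (z3, 0)) * ennreal (beta_weight (z4, 0))))
      \<partial>lborel \<partial>lborel \<partial>lborel \<partial>lborel)"
    unfolding w' by (simp add: power_numeral_reduce mult_ac)
  also have "\<dots> = ennreal (\<bar>det A\<bar> ^ 5) * (ennreal (1 / s ^ 8) ^ 4 * simplex_const)"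
    unfolding simplex_const_def by (simp add: nn_integral_cmult)
  also have "\<dots> = ennreal (\<bar>det A\<bar> ^ 5 * (1 / s ^ 8) ^ 4) * simplex_const"
    using s by (simp add: ennreal_mult ennreal_power mult.assoc)
  also have "\<bar>det A\<bar> ^ 5 * (1 / s ^ 8) ^ 4 = 1 / (s ^ 17 * sqrt q ^ 5)"
    using s q unfolding A by (simp add: power_divide power_mult[symmetric] divide_simps power_add[symmetric])
  finally show ?thesis by (simp only: s_def)
qed

text \<open>Three rounds of interleaving, from the innermost point outwards.\<close>

lemma nn_integral_lborel_pair4:
  fixes F :: "('a::euclidean_space \<times> 'b::euclidean_space) \<times> ('a \<times> 'b) \<times> ('a \<times> 'b) \<times> ('a \<times> 'b) \<Rightarrow> ennreal"
  assumes [measurable]: "F \<in> borel_measurable borel"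
  shows "(\<integral>\<^sup>+y1. \<integral>\<^sup>+y2. \<integral>\<^sup>+y3. \<integral>\<^sup>+y4. F (y1, y2, y3, y4) \<partial>lborel \<partial>lborel \<partial>lborel \<partial>lborel) =
    (\<integral>\<^sup>+Z. \<integral>\<^sup>+T. F ((fst Z, fst T), (fst (snd Z), fst (snd T)), (fst (snd (snd Z)), fst (snd (snd T))),
      (snd (snd (snd Z)), snd (snd (snd T)))) \<partial>lborel \<partial>lborel)"
proof -
  have "(\<integral>\<^sup>+y1. \<integral>\<^sup>+y2. \<integral>\<^sup>+y3. \<integral>\<^sup>+y4. F (y1, y2, y3, y4) \<partial>lborel \<partial>lborel \<partial>lborel \<partial>lborel) =
      (\<integral>\<^sup>+y1. \<integral>\<^sup>+y2. \<integral>\<^sup>+y3. \<integral>\<^sup>+z4. \<integral>\<^sup>+t4. F (y1, y2, y3, (z4, t4)) \<partial>lborel \<partial>lborel \<partial>lborel \<partial>lborel \<partial>lborel)"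
    by (intro nn_integral_cong nn_integral_lborel_Pair) measurable
  also have "\<dots> = (\<integral>\<^sup>+y1. \<integral>\<^sup>+y2. \<integral>\<^sup>+p. \<integral>\<^sup>+q. F (y1, y2, (fst p, fst q), (snd p, snd q)) \<partial>lborel \<partial>lborel \<partial>lborel \<partial>lborel)"
    by (rule nn_integral_cong, rule nn_integral_cong, rule nn_integral_lborel_interleave) measurable
  also have "\<dots> = (\<integral>\<^sup>+y1. \<integral>\<^sup>+p. \<integral>\<^sup>+q. F (y1, (fst p, fst q), (fst (snd p), fst (snd q)), (snd (snd p), snd (snd q)))
      \<partial>lborel \<partial>lborel \<partial>lborel)"
  proof (rule nn_integral_cong)
    fix y1 :: "'a \<times> 'b"
    have "(\<lambda>r. F (y1, fst r, (fst (fst (snd r)), fst (snd (snd r))), (snd (fst (snd r)), snd (snd (snd r))))) \<in> borel_measurable borel"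
      by measurable
    from nn_integral_lborel_interleave[OF this]
    show "(\<integral>\<^sup>+y2. \<integral>\<^sup>+p. \<integral>\<^sup>+q. F (y1, y2, (fst p, fst q), (snd p, snd q)) \<partial>lborel \<partial>lborel \<partial>lborel) =
        (\<integral>\<^sup>+p. \<integral>\<^sup>+q. F (y1, (fst p, fst q), (fst (snd p), fst (snd q)), (snd (snd p), snd (snd q))) \<partial>lborel \<partial>lborel)"
      by simp
  qed
  also have "\<dots> = (\<integral>\<^sup>+Z. \<integral>\<^sup>+T. F ((fst Z, fst T), (fst (snd Z), fst (snd T)), (fst (snd (snd Z)), fst (snd (snd T))),
      (snd (snd (snd Z)), snd (snd (snd T)))) \<partial>lborel \<partial>lborel)"
  proof -
    have "(\<lambda>r. F (fst r, (fst (fst (snd r)), fst (snd (snd r))), (fst (snd (fst (snd r))), fst (snd (snd (snd r)))),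
        (snd (snd (fst (snd r))), snd (snd (snd (snd r)))))) \<in> borel_measurable borel"
      by measurable
    from nn_integral_lborel_interleave[OF this] show ?thesis by simp
  qed
  finally show ?thesis .
qed

text \<open>The four points span the graph of \<open>a + b . z\<close>, whose distance from the
  origin is the absolute value of \<open>h = a / sqrt (1 + norm b ^ 2)\<close>. In the variables
  \<open>h\<close> and \<open>b\<close> the density factorises, so \<open>b\<close> contributes only
  a constant.\<close>

lemma affine_blaschke_petkantschin_beta:
  fixes \<Psi> :: "((real ^ 3) \<times> real) \<times> ((real ^ 3) \<times> real) \<times> ((real ^ 3) \<times> real) \<times> ((real ^ 3) \<times> real) \<Rightarrow> ennreal"
    and \<psi> :: "real \<Rightarrow> ennreal"
  assumes \<Psi>[measurable]: "\<Psi> \<in> borel_measurable borel" and \<psi>[measurable]: "\<psi> \<in> borel_measurable borel"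
    and eq: "\<And>z1 z2 z3 z4 a b. simplex_det (z1, z2, z3, z4) \<noteq> 0 \<Longrightarrow>
      \<Psi> ((z1, a + b \<bullet> z1), (z2, a + b \<bullet> z2), (z3, a + b \<bullet> z3), (z4, a + b \<bullet> z4)) = \<psi> (a / sqrt (1 + (norm b)\<^sup>2))"
  shows "(\<integral>\<^sup>+y1. \<integral>\<^sup>+y2. \<integral>\<^sup>+y3. \<integral>\<^sup>+y4. \<Psi> (y1, y2, y3, y4) *
      (ennreal (beta_weight y1) * ennreal (beta_weight y2) * ennreal (beta_weight y3) * ennreal (beta_weight y4))
      \<partial>lborel \<partial>lborel \<partial>lborel \<partial>lborel) =
    simplex_const * (\<integral>\<^sup>+b. ennreal (1 / (1 + (norm (b :: real ^ 3))\<^sup>2)\<^sup>2) \<partial>lborel) *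
    (\<integral>\<^sup>+h. \<psi> h * ennreal (1 / sqrt (1 + h\<^sup>2) ^ 17) \<partial>lborel)"
proof -
  define W where "W = (\<lambda>(y1, y2, y3, y4). ennreal (beta_weight y1) * ennreal (beta_weight y2) * ennreal (beta_weight y3) * ennreal (beta_weight y4))"
  have [measurable]: "W \<in> borel_measurable borel"
    unfolding W_def case_prod_beta by measurable
  define Y where "Y = (\<lambda>(a :: real, b :: real ^ 3, z :: real ^ 3). (z, a + b \<bullet> z))"
  have [measurable]: "Y \<in> borel_measurable borel"
    unfolding Y_def case_prod_beta by measurable
  have "(\<integral>\<^sup>+y1. \<integral>\<^sup>+y2. \<integral>\<^sup>+y3. \<integral>\<^sup>+y4. \<Psi> (y1, y2, y3, y4) * W (y1, y2, y3, y4) \<partial>lborel \<partial>lborel \<partial>lborel \<partial>lborel) =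
    (\<integral>\<^sup>+Z. \<integral>\<^sup>+T. (\<lambda>Y. \<Psi> Y * W Y) ((fst Z, fst T), (fst (snd Z), fst (snd T)), (fst (snd (snd Z)), fst (snd (snd T))),
      (snd (snd (snd Z)), snd (snd (snd T)))) \<partial>lborel \<partial>lborel)"
    by (subst nn_integral_lborel_pair4[symmetric]) auto
  also have "\<dots> = (\<integral>\<^sup>+Z. ennreal (simplex_det Z) * (\<integral>\<^sup>+b. \<integral>\<^sup>+a. \<psi> (a / sqrt (1 + (norm b)\<^sup>2)) *
      W (Y (a, b, fst Z), Y (a, b, fst (snd Z)), Y (a, b, fst (snd (snd Z))), Y (a, b, snd (snd (snd Z))))
      \<partial>lborel \<partial>lborel) \<partial>lborel)"
    using AE_simplex_det_nonzero
  proof (intro nn_integral_cong_AE, eventually_elim)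
    fix Z :: "(real ^ 3) \<times> (real ^ 3) \<times> (real ^ 3) \<times> (real ^ 3)"
    assume nz: "simplex_det Z \<noteq> 0"
    obtain z1 z2 z3 z4 where Z: "Z = (z1, z2, z3, z4)" by (cases Z) auto
    have "(\<integral>\<^sup>+T. (\<lambda>Y. \<Psi> Y * W Y) ((z1, fst T), (z2, fst (snd T)), (z3, fst (snd (snd T))), (z4, snd (snd (snd T)))) \<partial>lborel) =
      ennreal (simplex_det (z1, z2, z3, z4)) * (\<integral>\<^sup>+b. \<integral>\<^sup>+a. (\<lambda>Y. \<Psi> Y * W Y) ((z1, a + b \<bullet> z1), (z2, a + b \<bullet> z2), (z3, a + b \<bullet> z3), (z4, a + b \<bullet> z4)) \<partial>lborel \<partial>lborel)"
      by (subst nn_integral_heights[OF _ nz[unfolded Z]]) auto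
    then show "(\<integral>\<^sup>+T. (\<lambda>Y. \<Psi> Y * W Y) ((fst Z, fst T), (fst (snd Z), fst (snd T)), (fst (snd (snd Z)), fst (snd (snd T))),
      (snd (snd (snd Z)), snd (snd (snd T)))) \<partial>lborel) =
      ennreal (simplex_det Z) * (\<integral>\<^sup>+b. \<integral>\<^sup>+a. \<psi> (a / sqrt (1 + (norm b)\<^sup>2)) *
      W (Y (a, b, fst Z), Y (a, b, fst (snd Z)), Y (a, b, fst (snd (snd Z))), Y (a, b, snd (snd (snd Z))))
      \<partial>lborel \<partial>lborel)"
      by (simp add: Z Y_def eq[OF nz[unfolded Z]])
  qed
  also have "\<dots> = (\<integral>\<^sup>+Z. \<integral>\<^sup>+b. \<integral>\<^sup>+a. ennreal (simplex_det Z) * (\<psi> (a / sqrt (1 + (norm b)\<^sup>2)) *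
      W (Y (a, b, fst Z), Y (a, b, fst (snd Z)), Y (a, b, fst (snd (snd Z))), Y (a, b, snd (snd (snd Z)))))
      \<partial>lborel \<partial>lborel \<partial>lborel)"
    by (subst nn_integral_cmult[symmetric], measurable, subst nn_integral_cmult[symmetric], measurable)
  also have "\<dots> = (\<integral>\<^sup>+b. \<integral>\<^sup>+Z. \<integral>\<^sup>+a. ennreal (simplex_det Z) * (\<psi> (a / sqrt (1 + (norm b)\<^sup>2)) *
      W (Y (a, b, fst Z), Y (a, b, fst (snd Z)), Y (a, b, fst (snd (snd Z))), Y (a, b, snd (snd (snd Z)))))
      \<partial>lborel \<partial>lborel \<partial>lborel)"
    by (rule lborel_pair.Fubini') measurable
  also have "\<dots> = (\<integral>\<^sup>+b. \<integral>\<^sup>+a. \<integral>\<^sup>+Z. ennreal (simplex_det Z) * (\<psi> (a / sqrt (1 + (norm b)\<^sup>2)) *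
      W (Y (a, b, fst Z), Y (a, b, fst (snd Z)), Y (a, b, fst (snd (snd Z))), Y (a, b, snd (snd (snd Z)))))
      \<partial>lborel \<partial>lborel \<partial>lborel)"
    by (rule nn_integral_cong, rule lborel_pair.Fubini') measurable
  also have "\<dots> = (\<integral>\<^sup>+b. \<integral>\<^sup>+a. \<psi> (a / sqrt (1 + (norm b)\<^sup>2)) *
      (ennreal (1 / (sqrt (1 + (a / sqrt (1 + (norm b)\<^sup>2))\<^sup>2) ^ 17 * sqrt (1 + (norm b)\<^sup>2) ^ 5)) * simplex_const)
      \<partial>lborel \<partial>(lborel :: (real ^ 3) measure))"
  proof (rule nn_integral_cong, rule nn_integral_cong)
    fix a :: real and b :: "real ^ 3"
    have "(\<integral>\<^sup>+Z. ennreal (simplex_det Z) * (\<psi> (a / sqrt (1 + (norm b)\<^sup>2)) *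
      W (Y (a, b, fst Z), Y (a, b, fst (snd Z)), Y (a, b, fst (snd (snd Z))), Y (a, b, snd (snd (snd Z))))) \<partial>lborel) =
      (\<integral>\<^sup>+Z. \<psi> (a / sqrt (1 + (norm b)\<^sup>2)) * (ennreal (simplex_det Z) *
      W (Y (a, b, fst Z), Y (a, b, fst (snd Z)), Y (a, b, fst (snd (snd Z))), Y (a, b, snd (snd (snd Z))))) \<partial>lborel)"
      by (simp only: mult.left_commute)
    also have "\<dots> = \<psi> (a / sqrt (1 + (norm b)\<^sup>2)) * (\<integral>\<^sup>+Z. ennreal (simplex_det Z) *
      W (Y (a, b, fst Z), Y (a, b, fst (snd Z)), Y (a, b, fst (snd (snd Z))), Y (a, b, snd (snd (snd Z)))) \<partial>lborel)"
      by (rule nn_integral_cmult) measurable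
    also have "(\<integral>\<^sup>+Z. ennreal (simplex_det Z) *
      W (Y (a, b, fst Z), Y (a, b, fst (snd Z)), Y (a, b, fst (snd (snd Z))), Y (a, b, snd (snd (snd Z)))) \<partial>lborel) =
      (\<integral>\<^sup>+z1. \<integral>\<^sup>+z2. \<integral>\<^sup>+z3. \<integral>\<^sup>+z4. ennreal (simplex_det (z1, z2, z3, z4)) *
      W (Y (a, b, z1), Y (a, b, z2), Y (a, b, z3), Y (a, b, z4)) \<partial>lborel \<partial>lborel \<partial>lborel \<partial>lborel)"
      by (subst nn_integral_lborel_quad) auto
    also have "\<dots> = ennreal (1 / (sqrt (1 + (a / sqrt (1 + (norm b)\<^sup>2))\<^sup>2) ^ 17 * sqrt (1 + (norm b)\<^sup>2) ^ 5)) * simplex_const"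
      using nn_integral_simplex_graph[of a b] by (simp add: W_def Y_def)
    finally show "(\<integral>\<^sup>+Z. ennreal (simplex_det Z) * (\<psi> (a / sqrt (1 + (norm b)\<^sup>2)) *
      W (Y (a, b, fst Z), Y (a, b, fst (snd Z)), Y (a, b, fst (snd (snd Z))), Y (a, b, snd (snd (snd Z))))) \<partial>lborel) =
      \<psi> (a / sqrt (1 + (norm b)\<^sup>2)) *
      (ennreal (1 / (sqrt (1 + (a / sqrt (1 + (norm b)\<^sup>2))\<^sup>2) ^ 17 * sqrt (1 + (norm b)\<^sup>2) ^ 5)) * simplex_const)" .
  qed
  also have "\<dots> = (\<integral>\<^sup>+b. simplex_const * (\<integral>\<^sup>+h. \<psi> h * ennreal (1 / sqrt (1 + h\<^sup>2) ^ 17) \<partial>lborel) *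
      ennreal (1 / (1 + (norm b)\<^sup>2)\<^sup>2) \<partial>(lborel :: (real ^ 3) measure))"
  proof (rule nn_integral_cong)
    fix b :: "real ^ 3"
    \<comment> \<open>Substitute \<open>a = r * h\<close>: this cancels one power of
      \<open>1 / r ^ 5\<close> and leaves \<open>1 / r ^ 4\<close>, a factor that does not involve
      \<open>h\<close>.\<close>
    define r where "r = sqrt (1 + (norm b)\<^sup>2)"
    have r: "r > 0" "r ^ 4 = (1 + (norm b)\<^sup>2)\<^sup>2"
      using one_plus_norm_square_pos[of b] power_mult[of r 2 2] by (simp_all add: r_def)
    have s: "sqrt (1 + h\<^sup>2) > 0" for h :: real by (simp add: add_pos_nonneg)
    have "(\<integral>\<^sup>+a. \<psi> (a / r) * (ennreal (1 / (sqrt (1 + (a / r)\<^sup>2) ^ 17 * r ^ 5)) * simplex_const) \<partial>lborel) =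
        ennreal (r ^ DIM(real)) * (\<integral>\<^sup>+h. \<psi> ((r *\<^sub>R h) / r) * (ennreal (1 / (sqrt (1 + ((r *\<^sub>R h) / r)\<^sup>2) ^ 17 * r ^ 5)) * simplex_const) \<partial>lborel)"
      by (rule nn_integral_lborel_scale[OF r(1)]) measurable
    also have "\<dots> = ennreal r * (\<integral>\<^sup>+h. (ennreal (1 / r ^ 5) * simplex_const) * (\<psi> h * ennreal (1 / sqrt (1 + h\<^sup>2) ^ 17)) \<partial>lborel)"
    proof -
      have "ennreal (1 / (sqrt (1 + h\<^sup>2) ^ 17 * r ^ 5)) = ennreal (1 / r ^ 5) * ennreal (1 / sqrt (1 + h\<^sup>2) ^ 17)" for h
        using r s[of h] by (subst ennreal_mult[symmetric]) (auto simp: field_simps)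
      then show ?thesis using r by (simp add: mult_ac)
    qed
    also have "\<dots> = ennreal r * ((ennreal (1 / r ^ 5) * simplex_const) * (\<integral>\<^sup>+h. \<psi> h * ennreal (1 / sqrt (1 + h\<^sup>2) ^ 17) \<partial>lborel))"
      by (subst nn_integral_cmult) auto
    also have "\<dots> = simplex_const * (\<integral>\<^sup>+h. \<psi> h * ennreal (1 / sqrt (1 + h\<^sup>2) ^ 17) \<partial>lborel) * (ennreal r * ennreal (1 / r ^ 5))"
      by (simp only: mult_ac)
    also have "ennreal r * ennreal (1 / r ^ 5) = ennreal (1 / (1 + (norm b)\<^sup>2)\<^sup>2)"
      unfolding r(2)[symmetric] using r(1)
      by (subst ennreal_mult[symmetric]) (auto simp: eval_nat_numeral)
    finally show "(\<integral>\<^sup>+a. \<psi> (a / sqrt (1 + (norm b)\<^sup>2)) *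
      (ennreal (1 / (sqrt (1 + (a / sqrt (1 + (norm b)\<^sup>2))\<^sup>2) ^ 17 * sqrt (1 + (norm b)\<^sup>2) ^ 5)) * simplex_const) \<partial>lborel) =
      simplex_const * (\<integral>\<^sup>+h. \<psi> h * ennreal (1 / sqrt (1 + h\<^sup>2) ^ 17) \<partial>lborel) *
      ennreal (1 / (1 + (norm b)\<^sup>2)\<^sup>2)"
      by (simp only: r_def)
  qed
  also have "\<dots> = simplex_const * (\<integral>\<^sup>+b. ennreal (1 / (1 + (norm (b :: real ^ 3))\<^sup>2)\<^sup>2) \<partial>lborel) *
    (\<integral>\<^sup>+h. \<psi> h * ennreal (1 / sqrt (1 + h\<^sup>2) ^ 17) \<partial>lborel)"
    by (subst nn_integral_cmult) (simp_all only: mult_ac, measurable)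
  finally show ?thesis by (simp add: W_def)
qed

section \<open>The hyperplane through five random points\<close>

lemma distr_sphere_law_isometry:
  fixes T :: "'a::euclidean_space \<Rightarrow> 'b::euclidean_space"
  assumes lin: "linear T" and iso: "\<And>x. norm (T x) = norm x" and lb: "distr lborel borel T = lborel"
  shows "distr sphere_law borel T = sphere_law"
proof (rule measure_eqI)
  have [measurable]: "T \<in> borel_measurable borel"
    by (intro borel_measurable_continuous_onI linear_continuous_on linear_conv_bounded_linear[THEN iffD1] lin)
  have [measurable]: "ball (0::'b) 1 \<in> sets borel" by simp
  have sgnT: "T (sgn x) = sgn (T x)" for x
    by (simp add: sgn_div_norm iso linear_scale[OF lin])
  have T_ball: "T x \<in> ball 0 1 \<longleftrightarrow> x \<in> ball 0 1" for x
    by (simp add: iso)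
  have vol: "emeasure lborel (ball (0::'b) 1) = emeasure lborel (ball (0::'a) 1)"
    by (subst lb[symmetric], subst emeasure_distr) (auto intro!: arg_cong[where f = "emeasure lborel"] simp: iso)
  fix A :: "'b set" assume "A \<in> sets (distr sphere_law borel T)"
  then have [measurable]: "A \<in> sets borel" by simp
  have "emeasure (distr sphere_law borel T) A = (\<integral>\<^sup>+x. indicator A (T x) \<partial>sphere_law)"
    by (simp add: nn_integral_distr flip: nn_integral_indicator)
  also have "\<dots> = (\<integral>\<^sup>+x. indicator A (sgn (T x)) * indicator (ball 0 1) (T x) \<partial>lborel) / emeasure lborel (ball (0::'b) 1)"
    by (subst nn_integral_sphere_law) (simp_all add: sgnT vol indicator_def iso)
  also have "(\<integral>\<^sup>+x. indicator A (sgn (T x)) * indicator (ball 0 1) (T x) \<partial>lborel) =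
      (\<integral>\<^sup>+x. indicator A (sgn x) * indicator (ball 0 1) x \<partial>lborel)"
    by (subst lb[symmetric], subst nn_integral_distr) auto
  also have "\<dots> / emeasure lborel (ball (0::'b) 1) = emeasure sphere_law A"
    by (subst nn_integral_sphere_law[symmetric]) auto
  finally show "emeasure (distr sphere_law borel T) A = emeasure sphere_law A" .
qed simp

text \<open>A copy of the five-dimensional space in which the last coordinate is the axis of
  projection and the first four form the image space, itself split into base and height.\<close>

type_synonym chart = "((real ^ 3) \<times> real) \<times> real"

text \<open>A bijection of the orthonormal bases gives some isometry; an orthogonal map then carries
  the image of \<open>(0, -1)\<close> to \<open>u\<close>. So any point of the sphere can serve as
  the centre of projection.\<close>

lemma chart_isometry_exists:
  fixes u :: "real ^ 5"
  assumes u: "norm u = 1"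
  obtains T :: "chart \<Rightarrow> real ^ 5" where "linear T" "\<And>x y. T x \<bullet> T y = x \<bullet> y" "surj T"
    "T (0, -1) = u" "distr sphere_law borel T = sphere_law"
proof -
  have "card (Basis :: chart set) = card (Basis :: (real ^ 5) set)"
    by simp
  then obtain p where p: "bij_betw p (Basis :: chart set) (Basis :: (real ^ 5) set)"
    using finite_same_card_bij[OF finite_Basis finite_Basis] by blast
  define T0 where "T0 x = (\<Sum>b\<in>Basis. (x \<bullet> b) *\<^sub>R p b)" for x
  have pB: "p ` Basis = Basis" "inj_on p Basis" using p by (auto simp: bij_betw_def)
  have lin0: "linear T0"
    unfolding T0_def by (intro linearI) (simp_all add: inner_add_left scaleR_left_distrib sum.distrib scaleR_sum_right)
  have comp: "T0 x \<bullet> p b = x \<bullet> b" if b: "b \<in> Basis" for x b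
  proof -
    have "p c \<bullet> p b = (if c = b then 1 else 0)" if "c \<in> Basis" for c
    proof -
      have "p c \<in> Basis" "p b \<in> Basis"
        using imageI[OF that, of p] imageI[OF b, of p] unfolding pB(1) .
      then show ?thesis
        using inj_on_eq_iff[OF pB(2) that b] by (simp add: inner_Basis)
    qed
    then have "T0 x \<bullet> p b = (\<Sum>c\<in>Basis. (x \<bullet> c) * (if c = b then 1 else 0))"
      unfolding T0_def inner_sum_left inner_scaleR_left by (intro sum.cong refl) simp
    then show ?thesis
      using b by (simp add: if_distrib[where f = "(*) _"] cong: if_cong)
  qed
  have inner0: "T0 x \<bullet> T0 y = x \<bullet> y" for x y
  proof -
    have "T0 x \<bullet> T0 y = (\<Sum>b\<in>p ` Basis. (T0 x \<bullet> b) * (T0 y \<bullet> b))"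
      unfolding pB(1) by (rule euclidean_inner)
    also have "\<dots> = (\<Sum>b\<in>Basis. (x \<bullet> b) * (y \<bullet> b))"
      by (subst sum.reindex[OF pB(2)]) (simp add: comp)
    also have "\<dots> = x \<bullet> y"
      by (rule euclidean_inner[symmetric])
    finally show ?thesis .
  qed
  have norm0: "norm (T0 x) = norm x" for x
    by (simp add: norm_eq_sqrt_inner inner0)
  have surj0: "surj T0"
  proof (rule surjI)
    fix y
    define x where "x = (\<Sum>b\<in>Basis. (y \<bullet> p b) *\<^sub>R b)"
    have "T0 x \<bullet> b = y \<bullet> b" if b: "b \<in> Basis" for b
    proof -
      have "b \<in> p ` Basis" using b unfolding pB(1) .
      then obtain c where c: "c \<in> Basis" "b = p c" by (rule imageE)
      have "x \<bullet> c = y \<bullet> p c" unfolding x_def inner_sum_left_Basis[OF c(1)] ..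
      with comp[OF c(1), of x] show ?thesis unfolding c(2) by (rule trans)
    qed
    then show "T0 (\<Sum>b\<in>Basis. (y \<bullet> p b) *\<^sub>R b) = y"
      unfolding x_def[symmetric] by (rule euclidean_eqI)
  qed
  have meas0[measurable]: "T0 \<in> borel_measurable borel"
    by (intro borel_measurable_continuous_onI linear_continuous_on linear_conv_bounded_linear[THEN iffD1] lin0)
  have "norm (T0 (0, -1)) = 1"
    by (simp add: norm0 norm_Pair)
  then obtain f where f: "orthogonal_transformation f" "f (T0 (0, -1)) = u"
    using orthogonal_transformation_exists_1[OF _ u] by blast
  have linf: "linear f" and innerf: "\<And>x y. f x \<bullet> f y = x \<bullet> y"
    using f by (auto simp: orthogonal_transformation_def)
  have [measurable]: "f \<in> borel_measurable borel"
    by (intro borel_measurable_continuous_onI linear_continuous_on linear_conv_bounded_linear[THEN iffD1] linf)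
  show thesis
  proof
    show lin: "linear (f \<circ> T0)"
      by (rule linear_compose[OF lin0 linf])
    show inner: "(f \<circ> T0) x \<bullet> (f \<circ> T0) y = x \<bullet> y" for x y
      by (simp add: innerf inner0)
    show "surj (f \<circ> T0)"
      by (rule comp_surj[OF surj0 orthogonal_transformation_surj[OF f(1)]])
    show "(f \<circ> T0) (0, -1) = u" using f by simp
    show "distr sphere_law borel (f \<circ> T0) = sphere_law"
    proof (rule distr_sphere_law_isometry[OF lin])
      show "norm ((f \<circ> T0) x) = norm x" for x
        using inner[of x x] by (simp add: norm_eq_sqrt_inner)
      have "distr lborel borel (f \<circ> T0) = distr (distr lborel borel T0) borel f"
        by (rule distr_distr[symmetric]) auto
      also have "\<dots> = lborel"
        using lborel_distr_basis_bij[OF p comp] distr_lborel_orthogonal[OF f(1)] by simp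
      finally show "distr lborel borel (f \<circ> T0) = lborel" .
    qed
  qed
qed

lemma emeasure_sphere_law_closed_cap:
  fixes u :: "real ^ 5"
  assumes u: "norm u = 1" and h: "-1 < h" "h < 1"
  shows "emeasure sphere_law {x. h \<le> u \<bullet> x} = ennreal (cap_cdf (- h))"
proof -
  \<comment> \<open>With \<open>- u\<close> as the centre \<open>(0, -1)\<close>, the product
    \<open>u . T x\<close> is the last coordinate of \<open>x\<close>.\<close>
  have "norm (- u) = 1" using u by simp
  from chart_isometry_exists[OF this] obtain T :: "chart \<Rightarrow> real ^ 5" where
    T: "linear T" "\<And>x y. T x \<bullet> T y = x \<bullet> y" "T (0, -1) = - u" "distr sphere_law borel T = sphere_law"
    by metis
  have [measurable]: "T \<in> borel_measurable borel"
    by (intro borel_measurable_continuous_onI linear_continuous_on linear_conv_bounded_linear[THEN iffD1] T)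
  have u_eq: "u = - T (0, -1)" using T(3) by simp
  have "u \<bullet> T x = snd x" for x
    unfolding u_eq inner_minus_left T(2) by (cases x) simp
  then have "T -` {x. h \<le> u \<bullet> x} = {x. h \<le> snd x}"
    by auto
  moreover have "emeasure sphere_law {x. h \<le> u \<bullet> x} = emeasure (distr sphere_law borel T) {x. h \<le> u \<bullet> x}"
    by (simp only: T(4))
  ultimately show ?thesis
    by (subst (asm) emeasure_distr) (simp_all add: emeasure_sphere_law_cap h)
qed

lemma emeasure_sphere_law_open_cap:
  fixes u :: "real ^ 5"
  assumes u: "norm u = 1" and h: "-1 < h" "h < 1"
  shows "emeasure sphere_law {x. u \<bullet> x < h} = ennreal (cap_cdf h)"
proof -
  interpret prob_space "sphere_law :: (real ^ 5) measure" by (rule prob_space_sphere_law)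
  have "{x. u \<bullet> x < h} = space sphere_law - {x. h \<le> u \<bullet> x}"
    by auto
  then have "emeasure sphere_law {x. u \<bullet> x < h} = emeasure sphere_law (space sphere_law - {x. h \<le> u \<bullet> x})"
    by simp
  also have "\<dots> = emeasure sphere_law (space (sphere_law :: (real ^ 5) measure)) - emeasure sphere_law {x. h \<le> u \<bullet> x}"
    by (rule emeasure_compl) (simp_all add: emeasure_finite)
  also have "\<dots> = ennreal (1 - cap_cdf (- h))"
    using cap_cdf_nonneg[of "- h"] h
    by (simp add: emeasure_sphere_law_closed_cap[OF u h] emeasure_space_1[simplified] ennreal_minus[symmetric])
  finally show ?thesis by (simp add: cap_cdf_minus)
qed

text \<open>If the hyperplane meets the open ball, its two open caps have total measure
  \<open>cap_cdf h + cap_cdf (- h) = 1\<close>. Otherwise it can meet the sphere only in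
  \<open>u\<close> or \<open>- u\<close>, and these lie on a central hyperplane, to which the first
  case applies.\<close>

lemma AE_sphere_law_hyperplane:
  fixes c :: "real ^ 5"
  assumes c: "c \<noteq> 0"
  shows "AE x in sphere_law. c \<bullet> x \<noteq> d"
proof -
  interpret prob_space "sphere_law :: (real ^ 5) measure" by (rule prob_space_sphere_law)
  have inner_case: "AE x in sphere_law. u \<bullet> x \<noteq> h" if u: "norm u = 1" and h: "-1 < h" "h < 1" for u :: "real ^ 5" and h
  proof -
    have "emeasure sphere_law {x. u \<bullet> x < h} + emeasure sphere_law {x. - u \<bullet> x < - h} = ennreal (cap_cdf h) + ennreal (cap_cdf (- h))"
      using emeasure_sphere_law_open_cap[OF u h] emeasure_sphere_law_open_cap[of "- u" "- h"] u h by simp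
    also have "\<dots> = 1"
      using cap_cdf_nonneg[of h] cap_cdf_nonneg[of "- h"] h
      by (simp add: cap_cdf_minus ennreal_plus[symmetric] del: ennreal_plus)
    finally have "emeasure sphere_law ({x. u \<bullet> x < h} \<union> {x. - u \<bullet> x < - h}) = 1"
      by (subst plus_emeasure[symmetric]) auto
    also have "{x. u \<bullet> x < h} \<union> {x. - u \<bullet> x < - h} = {x \<in> space sphere_law. u \<bullet> x \<noteq> h}"
      by auto
    finally show ?thesis
      by (subst AE_iff_emeasure_eq_1) auto
  qed
  define u where "u = c /\<^sub>R norm c"
  define h where "h = d / norm c"
  have u: "norm u = 1" using c by (simp add: u_def)
  have cu: "c \<bullet> x = d \<longleftrightarrow> u \<bullet> x = h" for x
    using c by (simp add: u_def h_def field_simps)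
  show ?thesis
  proof (cases "\<bar>h\<bar> < 1")
    case True
    then show ?thesis unfolding cu by (intro inner_case u) auto
  next
    case False
    obtain v :: "real ^ 5" where v: "norm v = 1" "v \<bullet> u = 0"
    proof -
      obtain w :: "real ^ 5" where w: "w \<noteq> 0" "orthogonal u w"
        using orthogonal_to_vector_exists[of u] by auto
      then show thesis
        by (intro that[of "w /\<^sub>R norm w"]) (auto simp: orthogonal_def inner_commute)
    qed
    have "AE x in sphere_law. norm (x :: real ^ 5) = 1"
      by (rule AE_sphere_law_norm)
    moreover have "AE x in sphere_law. v \<bullet> x \<noteq> 0"
      using v by (intro inner_case) auto
    ultimately show ?thesis
    proof eventually_elim
      fix x :: "real ^ 5" assume x: "norm x = 1" "v \<bullet> x \<noteq> 0"
      show "c \<bullet> x \<noteq> d"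
      proof
        assume "c \<bullet> x = d"
        then have "1 \<le> \<bar>u \<bullet> x\<bar>" using cu False by simp
        moreover have "\<bar>u \<bullet> x\<bar> \<le> 1"
          using Cauchy_Schwarz_ineq2[of u x] u x by simp
        ultimately have "\<bar>u \<bullet> x\<bar> = norm u * norm x"
          using u x by simp
        then have "norm u *\<^sub>R x = norm x *\<^sub>R u \<or> norm u *\<^sub>R x = - norm x *\<^sub>R u"
          by (simp only: norm_cauchy_schwarz_abs_eq)
        then have "x = u \<or> x = - u" using u x by auto
        then show False using v x by auto
      qed
    qed
  qed
qed

text \<open>Substituting \<open>s = sin x\<close> turns the integrand into
  \<open>(1 - s ^ 2) ^ 7\<close>, whose binomial expansion is integrated termwise. The value
  normalises the law of the random hyperplane.\<close>

lemma nn_integral_cos_power_15: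
  "(\<integral>\<^sup>+x. ennreal (cos x ^ 15) * indicator {-(pi/2)<..<pi/2} x \<partial>lborel) = ennreal (4096 / 6435)"
proof -
  define P where "P s = s - 7 * s ^ 3 / 3 + 21 * s ^ 5 / 5 - 5 * s ^ 7 + 35 * s ^ 9 / 9 - 21 * s ^ 11 / 11 + 7 * s ^ 13 / 13 - s ^ 15 / 15" for s :: real
  have P: "(P has_real_derivative (1 - s\<^sup>2) ^ 7) (at s)" for s
  proof -
    have "(P has_real_derivative 1 - 7 * s ^ 2 + 21 * s ^ 4 - 35 * s ^ 6 + 35 * s ^ 8 - 21 * s ^ 10 + 7 * s ^ 12 - s ^ 14) (at s)"
      unfolding P_def by (auto intro!: derivative_eq_intros)
    also have "1 - 7 * s ^ 2 + 21 * s ^ 4 - 35 * s ^ 6 + 35 * s ^ 8 - 21 * s ^ 10 + 7 * s ^ 12 - s ^ 14 = (1 - s\<^sup>2) ^ 7"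
      by (simp add: eval_nat_numeral algebra_simps)
    finally show ?thesis .
  qed
  have "(\<integral>\<^sup>+x. ennreal (cos x ^ 15) * indicator {-(pi/2)<..<pi/2} x \<partial>lborel) =
      (\<integral>\<^sup>+x. ennreal (cos x ^ 15) * indicator {-(pi/2)..pi/2} x \<partial>lborel)"
    using AE_lborel_singleton[of "-(pi/2)"] AE_lborel_singleton[of "pi/2"]
    by (intro nn_integral_cong_AE, eventually_elim) (auto simp: indicator_def)
  also have "\<dots> = ennreal (P (sin (pi/2)) - P (sin (-(pi/2))))"
  proof (intro nn_integral_FTC_Icc[where F = "\<lambda>x. P (sin x)"])
    fix x :: real assume x: "x \<in> {-(pi/2)..pi/2}"
    have "((\<lambda>x. P (sin x)) has_real_derivative (1 - (sin x)\<^sup>2) ^ 7 * cos x) (at x)"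
      by (rule DERIV_chain2[OF P DERIV_sin])
    also have "(1 - (sin x)\<^sup>2) ^ 7 * cos x = cos x ^ 15"
      by (simp add: cos_squared_eq[symmetric] power_mult[symmetric] power_Suc2[symmetric])
    finally show "((\<lambda>x. P (sin x)) has_real_derivative cos x ^ 15) (at x)" .
    show "0 \<le> cos x ^ 15"
      using x by (simp add: cos_ge_zero)
  qed auto
  also have "P (sin (pi/2)) - P (sin (-(pi/2))) = 4096 / 6435"
    by (simp add: P_def)
  finally show ?thesis .
qed

text \<open>With \<open>h = tan x\<close> the quotient \<open>h / sqrt (1 + h ^ 2)\<close> is
  \<open>sin x\<close>, and \<open>cos x ^ 17\<close> times the derivative
  \<open>1 / cos x ^ 2\<close> leaves the exponent 15.\<close>

lemma nn_integral_tan_substitution: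
  assumes [measurable]: "\<psi> \<in> borel_measurable borel"
  shows "(\<integral>\<^sup>+h. \<psi> (h / sqrt (1 + h\<^sup>2)) * ennreal (1 / sqrt (1 + h\<^sup>2) ^ 17) \<partial>lborel) =
    (\<integral>\<^sup>+x. \<psi> (sin x) * ennreal (cos x ^ 15) * indicator {-(pi/2)<..<pi/2} x \<partial>lborel)"
proof -
  let ?A = "{-(pi/2)<..<pi/2}"
  have "(\<integral>\<^sup>+h. \<psi> (h / sqrt (1 + h\<^sup>2)) * ennreal (1 / sqrt (1 + h\<^sup>2) ^ 17) \<partial>lborel) =
      (\<integral>\<^sup>+x. \<psi> (tan x / sqrt (1 + (tan x)\<^sup>2)) * ennreal (1 / sqrt (1 + (tan x)\<^sup>2) ^ 17) * ennreal (1 + (tan x)\<^sup>2) *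
        indicator ?A x \<partial>lborel)"
  proof (rule nn_integral_substitution_increasing)
    show "is_interval ?A"
      by (simp add: is_interval_convex_1)
    show "tan ` ?A = UNIV"
    proof (safe, simp_all)
      fix y :: real
      show "y \<in> tan ` ?A"
        using arctan_lbound[of y] arctan_ubound[of y] by (intro image_eqI[of _ _ "arctan y"]) (auto simp: tan_arctan)
    qed
    show "strict_mono_on ?A tan"
      by (intro strict_mono_onI) (use tan_monotone in auto)
    show "(tan has_real_derivative 1 + (tan x)\<^sup>2) (at x)" if "x \<in> ?A" for x
    proof -
      have "cos x \<noteq> 0" using cos_gt_zero_pi[of x] that by auto
      then show ?thesis
        using DERIV_tan[of x] by (simp add: tan_sec power_inverse)
    qed
  qed (auto simp: tan_def[abs_def])
  also have "\<dots> = (\<integral>\<^sup>+x. \<psi> (sin x) * ennreal (cos x ^ 15) * indicator ?A x \<partial>lborel)"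
  proof (rule nn_integral_cong)
    fix x :: real
    show "\<psi> (tan x / sqrt (1 + (tan x)\<^sup>2)) * ennreal (1 / sqrt (1 + (tan x)\<^sup>2) ^ 17) * ennreal (1 + (tan x)\<^sup>2) *
        indicator ?A x = \<psi> (sin x) * ennreal (cos x ^ 15) * indicator ?A x"
    proof (cases "x \<in> ?A")
      case True
      then have c: "cos x > 0" using cos_gt_zero_pi[of x] by auto
      have t: "1 + (tan x)\<^sup>2 = (1 / cos x)\<^sup>2"
        using c tan_sec[of x] by (simp add: inverse_eq_divide)
      have s: "sqrt (1 + (tan x)\<^sup>2) = 1 / cos x"
        unfolding t using c by simp
      have "ennreal (1 / sqrt (1 + (tan x)\<^sup>2) ^ 17) * ennreal (1 + (tan x)\<^sup>2) = ennreal (cos x ^ 15)"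
        unfolding s unfolding t using c
        by (subst ennreal_mult[symmetric]) (auto simp: power_divide eval_nat_numeral)
      moreover have "tan x / sqrt (1 + (tan x)\<^sup>2) = sin x"
        unfolding s using c by (simp add: tan_def)
      ultimately show ?thesis by (simp add: mult.assoc)
    qed simp
  qed
  finally show ?thesis .
qed

lemma nn_integral_sphere_law_chart:
  assumes T: "linear T" "distr sphere_law borel T = (sphere_law :: (real ^ 5) measure)"
    and [measurable]: "f \<in> borel_measurable borel"
  shows "(\<integral>\<^sup>+x. f x \<partial>sphere_law) =
    ennreal (2 ^ 4 / 5) / emeasure lborel (ball (0::chart) 1) * (\<integral>\<^sup>+y. f (T (stereo y)) * ennreal (beta_weight y) \<partial>lborel)"
proof -
  have [measurable]: "T \<in> borel_measurable borel"
    by (intro borel_measurable_continuous_onI linear_continuous_on linear_conv_bounded_linear[THEN iffD1] T)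
  have "(\<integral>\<^sup>+x. f x \<partial>sphere_law) = (\<integral>\<^sup>+x. f (T x) \<partial>sphere_law)"
    by (subst T(2)[symmetric]) (simp add: nn_integral_distr)
  then show ?thesis
    by (simp add: nn_integral_sphere_law_stereo beta_weight_def)
qed

text \<open>Hyperplane sections of the sphere through the centre of projection correspond to affine
  hyperplanes of the chart. The last claim, uniqueness of the normal up to scaling, rests on the
  affinely independent base.\<close>

lemma affine_hull_chart_points:
  fixes T :: "chart \<Rightarrow> real ^ 5" and a :: real and b :: "real ^ 3"
  assumes T: "linear T" "\<And>x y. T x \<bullet> T y = x \<bullet> y" "surj T"
    and D: "simplex_det (z1, z2, z3, z4) \<noteq> 0"
  defines "h \<equiv> a / sqrt (1 + (norm b)\<^sup>2)"
  obtains u where "norm u = 1" "u \<bullet> T (0, -1) = h / sqrt (1 + h\<^sup>2)"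
    "\<And>z. u \<bullet> T (stereo (z, a + b \<bullet> z)) = h / sqrt (1 + h\<^sup>2)"
    "\<And>v \<eta>. v \<bullet> T (0, -1) = \<eta> \<Longrightarrow> (\<And>z. z \<in> {z1, z2, z3, z4} \<Longrightarrow> v \<bullet> T (stereo (z, a + b \<bullet> z)) = \<eta>) \<Longrightarrow>
      \<exists>r. v = r *\<^sub>R u"
proof -
  \<comment> \<open>For \<open>y = (z, t)\<close> with \<open>t - b . z = a\<close>, the product of
    \<open>w\<close> and \<open>stereo y\<close> is
    \<open>(2 * a - a * (1 - norm y ^ 2)) / (1 + norm y ^ 2) = a\<close>, which is also the value of
    \<open>w\<close> at \<open>(0, -1)\<close>.\<close>
  define w :: chart where "w = ((- b, 1), - a)"
  define \<rho> where "\<rho> = sqrt (1 + (norm b)\<^sup>2 + a\<^sup>2)"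
  have \<rho>: "\<rho> > 0" "\<rho>\<^sup>2 = 1 + (norm b)\<^sup>2 + a\<^sup>2"
    by (simp_all add: \<rho>_def add_pos_nonneg)
  have q: "1 + (norm b)\<^sup>2 > 0" by (rule one_plus_norm_square_pos)
  have H: "a / \<rho> = h / sqrt (1 + h\<^sup>2)"
  proof -
    have "1 + h\<^sup>2 = \<rho>\<^sup>2 / (1 + (norm b)\<^sup>2)"
      using q by (simp add: h_def \<rho>(2) power_divide field_simps)
    then have "sqrt (1 + h\<^sup>2) = \<rho> / sqrt (1 + (norm b)\<^sup>2)"
      using \<rho>(1) by (simp add: real_sqrt_divide)
    then show ?thesis
      using q by (simp add: h_def)
  qed
  have nw: "w \<bullet> w = \<rho>\<^sup>2"
    unfolding \<rho>(2) power2_norm_eq_inner by (simp add: w_def power2_eq_square)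
  have w_stereo: "((c, t), s) \<bullet> stereo (z, y) = (2 * (c \<bullet> z + t * y) + s * (1 - (norm (z, y))\<^sup>2)) / (1 + (norm (z, y))\<^sup>2)"
    for c z :: "real ^ 3" and t s y
    by (simp add: stereo_def inner_Pair add_divide_distrib distrib_left mult_ac)
  show thesis
  proof
    show "norm (T ((1 / \<rho>) *\<^sub>R w)) = 1"
      using \<rho>(1) by (simp add: norm_eq_sqrt_inner T(2) nw power2_eq_square)
    show "T ((1 / \<rho>) *\<^sub>R w) \<bullet> T (0, -1) = h / sqrt (1 + h\<^sup>2)"
      unfolding T(2) H[symmetric] by (simp add: w_def)
    show "T ((1 / \<rho>) *\<^sub>R w) \<bullet> T (stereo (z, a + b \<bullet> z)) = h / sqrt (1 + h\<^sup>2)" for z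
    proof -
      have "w \<bullet> stereo (z, a + b \<bullet> z) = a"
        using one_plus_norm_square_pos[of "(z, a + b \<bullet> z)"] unfolding w_def w_stereo
        by (simp add: field_simps)
      then show ?thesis
        unfolding T(2) H[symmetric] by simp
    qed
  next
    fix v \<eta> assume v1: "v \<bullet> T (0, -1) = \<eta>"
      and v2: "\<And>z. z \<in> {z1, z2, z3, z4} \<Longrightarrow> v \<bullet> T (stereo (z, a + b \<bullet> z)) = \<eta>"
    obtain v' where v': "v = T v'" using T(3) by (metis surjD)
    obtain c t s where cts: "v' = ((c, t), s)" by (metis surj_pair)
    have \<eta>: "\<eta> = - s" using v1 by (simp add: v' cts T(2))
    \<comment> \<open>Since \<open>\<eta> = - s\<close>, the quadratic terms cancel and a linear
      equation in \<open>z\<close> remains.\<close>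
    have lin: "(c + t *\<^sub>R b) \<bullet> z = - s - t * a" if "z \<in> {z1, z2, z3, z4}" for z
    proof -
      let ?Q = "(norm (z, a + b \<bullet> z))\<^sup>2"
      have "2 * (c \<bullet> z + t * (a + b \<bullet> z)) + s * (1 - ?Q) = - s * (1 + ?Q)"
        using v2[OF that] one_plus_norm_square_pos[of "(z, a + b \<bullet> z)"]
        unfolding v' cts T(2) w_stereo \<eta> by (simp add: field_simps del: norm_Pair)
      then show ?thesis
        by (simp add: inner_add_left algebra_simps del: norm_Pair)
    qed
    define A :: "real ^ 3 ^ 3" where "A = vector [z2 - z1, z3 - z1, z4 - z1]"
    have "det A \<noteq> 0"
      using D by (simp add: A_def simplex_det_def)
    moreover have "A *v (c + t *\<^sub>R b) = 0"
    proof -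
      have "(z - z1) \<bullet> (c + t *\<^sub>R b) = 0" if "z \<in> {z1, z2, z3, z4}" for z
        using lin[OF that] lin[of z1] by (simp add: inner_diff_left inner_commute)
      then have "(z2 - z1) \<bullet> (c + t *\<^sub>R b) = 0" "(z3 - z1) \<bullet> (c + t *\<^sub>R b) = 0" "(z4 - z1) \<bullet> (c + t *\<^sub>R b) = 0"
        by blast+
      then show ?thesis
        by (simp add: vec_eq_iff forall_3 matrix_vector_mul_component A_def)
    qed
    ultimately have c: "c + t *\<^sub>R b = 0"
      by (metis invertible_det_nz invertible_def matrix_left_invertible_ker)
    then have s: "s = - t * a" using lin[of z1] by simp
    have "c = - (t *\<^sub>R b)" using c by (simp add: eq_neg_iff_add_eq_0)
    then have "v' = t *\<^sub>R w"
      by (simp add: cts w_def s)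
    then have "v = (t * \<rho>) *\<^sub>R T ((1 / \<rho>) *\<^sub>R w)"
      using \<rho>(1) by (simp add: v' linear_scale[OF T(1)])
    then show "\<exists>r. v = r *\<^sub>R T ((1 / \<rho>) *\<^sub>R w)" by blast
  qed
qed

text \<open>The distance of the hyperplane through five uniform points from the origin has a density proportional to
  \<open>(1 - h\<^sup>2)\<^sup>7\<close>, here with \<open>h = sin x\<close>; the sign of \<open>h\<close> depends on the chart, which is why \<open>\<psi>\<close> has to
  return the same value for both unit normals.\<close>

lemma nn_integral_hyperplane_distance:
  fixes \<Psi> :: "(real ^ 5) \<times> (real ^ 5) \<times> (real ^ 5) \<times> (real ^ 5) \<times> (real ^ 5) \<Rightarrow> ennreal" and \<psi> :: "real \<Rightarrow> ennreal"
  assumes \<Psi>[measurable]: "\<Psi> \<in> borel_measurable borel" and \<psi>[measurable]: "\<psi> \<in> borel_measurable borel"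
    and eq: "\<And>x0 x1 x2 x3 x4 u H. norm u = 1 \<Longrightarrow> \<bar>H\<bar> < 1 \<Longrightarrow> (\<And>x. x \<in> {x0, x1, x2, x3, x4} \<Longrightarrow> u \<bullet> x = H) \<Longrightarrow>
      (\<And>v \<eta>. (\<And>x. x \<in> {x0, x1, x2, x3, x4} \<Longrightarrow> v \<bullet> x = \<eta>) \<Longrightarrow> \<exists>r. v = r *\<^sub>R u) \<Longrightarrow>
      \<Psi> (x0, x1, x2, x3, x4) = \<psi> H"
  shows "(\<integral>\<^sup>+x0. \<integral>\<^sup>+x1. \<integral>\<^sup>+x2. \<integral>\<^sup>+x3. \<integral>\<^sup>+x4. \<Psi> (x0, x1, x2, x3, x4)
      \<partial>sphere_law \<partial>sphere_law \<partial>sphere_law \<partial>sphere_law \<partial>sphere_law) =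
    (\<integral>\<^sup>+x. \<psi> (sin x) * ennreal (6435 / 4096 * cos x ^ 15) * indicator {-(pi/2)<..<pi/2} x \<partial>lborel)"
proof -
  interpret S: prob_space "sphere_law :: (real ^ 5) measure" by (rule prob_space_sphere_law)
  define d where "d = ennreal (2 ^ 4 / 5) / emeasure lborel (ball (0::chart) 1)"
  define C where "C = d * (d * (d * (d * (simplex_const * (\<integral>\<^sup>+b. ennreal (1 / (1 + (norm (b :: real ^ 3))\<^sup>2)\<^sup>2) \<partial>lborel)))))"
  \<comment> \<open>Stated for arbitrary functions because it is applied twice: to the constant 1,
    which determines \<open>C\<close>, and to \<open>\<Psi>\<close>.\<close>
  have main: "(\<integral>\<^sup>+x0. \<integral>\<^sup>+x1. \<integral>\<^sup>+x2. \<integral>\<^sup>+x3. \<integral>\<^sup>+x4. \<Phi> (x0, x1, x2, x3, x4)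
      \<partial>sphere_law \<partial>sphere_law \<partial>sphere_law \<partial>sphere_law \<partial>sphere_law) =
      C * (\<integral>\<^sup>+x. \<phi> (sin x) * ennreal (cos x ^ 15) * indicator {-(pi/2)<..<pi/2} x \<partial>lborel)"
    if [measurable]: "\<Phi> \<in> borel_measurable borel" and [measurable]: "\<phi> \<in> borel_measurable borel"
      and eq\<Phi>: "\<And>x0 x1 x2 x3 x4 u H. norm u = 1 \<Longrightarrow> \<bar>H\<bar> < 1 \<Longrightarrow> (\<And>x. x \<in> {x0, x1, x2, x3, x4} \<Longrightarrow> u \<bullet> x = H) \<Longrightarrow>
        (\<And>v \<eta>. (\<And>x. x \<in> {x0, x1, x2, x3, x4} \<Longrightarrow> v \<bullet> x = \<eta>) \<Longrightarrow> \<exists>r. v = r *\<^sub>R u) \<Longrightarrow>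
        \<Phi> (x0, x1, x2, x3, x4) = \<phi> H"
    for \<Phi> :: "(real ^ 5) \<times> (real ^ 5) \<times> (real ^ 5) \<times> (real ^ 5) \<times> (real ^ 5) \<Rightarrow> ennreal" and \<phi> :: "real \<Rightarrow> ennreal"
  proof -
    let ?R = "C * (\<integral>\<^sup>+x. \<phi> (sin x) * ennreal (cos x ^ 15) * indicator {-(pi/2)<..<pi/2} x \<partial>lborel)"
    \<comment> \<open>\<open>x0\<close> is the centre of projection. The value does not depend on
      it, so the outermost integral, against a probability measure, is trivial.\<close>
    have inner: "(\<integral>\<^sup>+x1. \<integral>\<^sup>+x2. \<integral>\<^sup>+x3. \<integral>\<^sup>+x4. \<Phi> (x0, x1, x2, x3, x4)
      \<partial>sphere_law \<partial>sphere_law \<partial>sphere_law \<partial>sphere_law) = ?R" if x0: "norm x0 = 1" for x0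
    proof -
      obtain T :: "chart \<Rightarrow> real ^ 5" where T: "linear T" "\<And>x y. T x \<bullet> T y = x \<bullet> y" "surj T"
        "T (0, -1) = x0" "distr sphere_law borel T = sphere_law"
        using chart_isometry_exists[OF x0] by blast
      have [measurable]: "T \<in> borel_measurable borel"
        by (intro borel_measurable_continuous_onI linear_continuous_on linear_conv_bounded_linear[THEN iffD1] T)
      define G where "G = (\<lambda>x. \<Phi> (x0, x))"
      have [measurable]: "G \<in> borel_measurable borel" unfolding G_def by measurable
      define S where "S y = T (stereo y)" for y
      have [measurable]: "S \<in> borel_measurable borel" unfolding S_def by measurable
      define w where "w y = ennreal (beta_weight y)" for y
      have [measurable]: "w \<in> borel_measurable borel" unfolding w_def by measurable
      have cov: "(\<integral>\<^sup>+x. f x \<partial>sphere_law) = d * (\<integral>\<^sup>+y. f (S y) * w y \<partial>lborel)" if "f \<in> borel_measurable borel" for f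
        unfolding d_def S_def w_def by (rule nn_integral_sphere_law_chart[OF T(1,5) that])
      have c4: "(\<integral>\<^sup>+x4. G (x1, x2, x3, x4) \<partial>sphere_law) = d * (\<integral>\<^sup>+y4. G (x1, x2, x3, S y4) * w y4 \<partial>lborel)" for x1 x2 x3
        by (rule cov) measurable
      have c3: "(\<integral>\<^sup>+x3. \<integral>\<^sup>+x4. G (x1, x2, x3, x4) \<partial>sphere_law \<partial>sphere_law) =
          d * (d * (\<integral>\<^sup>+y3. \<integral>\<^sup>+y4. G (x1, x2, S y3, S y4) * (w y3 * w y4) \<partial>lborel \<partial>lborel))" for x1 x2
      proof -
        have "(\<integral>\<^sup>+x3. \<integral>\<^sup>+x4. G (x1, x2, x3, x4) \<partial>sphere_law \<partial>sphere_law) =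
            d * (\<integral>\<^sup>+x3. \<integral>\<^sup>+y4. G (x1, x2, x3, S y4) * w y4 \<partial>lborel \<partial>sphere_law)"
          unfolding c4 by (rule nn_integral_cmult) measurable
        also have "(\<integral>\<^sup>+x3. \<integral>\<^sup>+y4. G (x1, x2, x3, S y4) * w y4 \<partial>lborel \<partial>sphere_law) =
            d * (\<integral>\<^sup>+y3. (\<integral>\<^sup>+y4. G (x1, x2, S y3, S y4) * w y4 \<partial>lborel) * w y3 \<partial>lborel)"
          by (rule cov) measurable
        also have "(\<integral>\<^sup>+y3. (\<integral>\<^sup>+y4. G (x1, x2, S y3, S y4) * w y4 \<partial>lborel) * w y3 \<partial>lborel) =
            (\<integral>\<^sup>+y3. \<integral>\<^sup>+y4. G (x1, x2, S y3, S y4) * (w y3 * w y4) \<partial>lborel \<partial>lborel)"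
          by (subst nn_integral_multc[symmetric]) (measurable, simp add: mult_ac)
        finally show ?thesis .
      qed
      have c2: "(\<integral>\<^sup>+x2. \<integral>\<^sup>+x3. \<integral>\<^sup>+x4. G (x1, x2, x3, x4) \<partial>sphere_law \<partial>sphere_law \<partial>sphere_law) =
          d * (d * (d * (\<integral>\<^sup>+y2. \<integral>\<^sup>+y3. \<integral>\<^sup>+y4. G (x1, S y2, S y3, S y4) * (w y2 * w y3 * w y4) \<partial>lborel \<partial>lborel \<partial>lborel)))" for x1
      proof -
        have "(\<integral>\<^sup>+x2. \<integral>\<^sup>+x3. \<integral>\<^sup>+x4. G (x1, x2, x3, x4) \<partial>sphere_law \<partial>sphere_law \<partial>sphere_law) =
            d * (d * (\<integral>\<^sup>+x2. \<integral>\<^sup>+y3. \<integral>\<^sup>+y4. G (x1, x2, S y3, S y4) * (w y3 * w y4) \<partial>lborel \<partial>lborel \<partial>sphere_law))"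
          unfolding c3 by (subst nn_integral_cmult, measurable, subst nn_integral_cmult, measurable)
        also have "(\<integral>\<^sup>+x2. \<integral>\<^sup>+y3. \<integral>\<^sup>+y4. G (x1, x2, S y3, S y4) * (w y3 * w y4) \<partial>lborel \<partial>lborel \<partial>sphere_law) =
            d * (\<integral>\<^sup>+y2. (\<integral>\<^sup>+y3. \<integral>\<^sup>+y4. G (x1, S y2, S y3, S y4) * (w y3 * w y4) \<partial>lborel \<partial>lborel) * w y2 \<partial>lborel)"
          by (rule cov) measurable
        also have "(\<integral>\<^sup>+y2. (\<integral>\<^sup>+y3. \<integral>\<^sup>+y4. G (x1, S y2, S y3, S y4) * (w y3 * w y4) \<partial>lborel \<partial>lborel) * w y2 \<partial>lborel) =
            (\<integral>\<^sup>+y2. \<integral>\<^sup>+y3. \<integral>\<^sup>+y4. G (x1, S y2, S y3, S y4) * (w y2 * w y3 * w y4) \<partial>lborel \<partial>lborel \<partial>lborel)"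
          by (subst nn_integral_multc[symmetric], measurable, subst nn_integral_multc[symmetric], measurable, simp add: mult_ac)
        finally show ?thesis .
      qed
      have c1: "(\<integral>\<^sup>+x1. \<integral>\<^sup>+x2. \<integral>\<^sup>+x3. \<integral>\<^sup>+x4. G (x1, x2, x3, x4) \<partial>sphere_law \<partial>sphere_law \<partial>sphere_law \<partial>sphere_law) =
          d * (d * (d * (d * (\<integral>\<^sup>+y1. \<integral>\<^sup>+y2. \<integral>\<^sup>+y3. \<integral>\<^sup>+y4. G (S y1, S y2, S y3, S y4) * (w y1 * w y2 * w y3 * w y4) \<partial>lborel \<partial>lborel \<partial>lborel \<partial>lborel))))"
      proof -
        have "(\<integral>\<^sup>+x1. \<integral>\<^sup>+x2. \<integral>\<^sup>+x3. \<integral>\<^sup>+x4. G (x1, x2, x3, x4) \<partial>sphere_law \<partial>sphere_law \<partial>sphere_law \<partial>sphere_law) =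
            d * (d * (d * (\<integral>\<^sup>+x1. \<integral>\<^sup>+y2. \<integral>\<^sup>+y3. \<integral>\<^sup>+y4. G (x1, S y2, S y3, S y4) * (w y2 * w y3 * w y4) \<partial>lborel \<partial>lborel \<partial>lborel \<partial>sphere_law)))"
          unfolding c2 by (subst nn_integral_cmult, measurable, subst nn_integral_cmult, measurable, subst nn_integral_cmult, measurable)
        also have "(\<integral>\<^sup>+x1. \<integral>\<^sup>+y2. \<integral>\<^sup>+y3. \<integral>\<^sup>+y4. G (x1, S y2, S y3, S y4) * (w y2 * w y3 * w y4) \<partial>lborel \<partial>lborel \<partial>lborel \<partial>sphere_law) =
            d * (\<integral>\<^sup>+y1. (\<integral>\<^sup>+y2. \<integral>\<^sup>+y3. \<integral>\<^sup>+y4. G (S y1, S y2, S y3, S y4) * (w y2 * w y3 * w y4) \<partial>lborel \<partial>lborel \<partial>lborel) * w y1 \<partial>lborel)"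
          by (rule cov) measurable
        also have "(\<integral>\<^sup>+y1. (\<integral>\<^sup>+y2. \<integral>\<^sup>+y3. \<integral>\<^sup>+y4. G (S y1, S y2, S y3, S y4) * (w y2 * w y3 * w y4) \<partial>lborel \<partial>lborel \<partial>lborel) * w y1 \<partial>lborel) =
            (\<integral>\<^sup>+y1. \<integral>\<^sup>+y2. \<integral>\<^sup>+y3. \<integral>\<^sup>+y4. G (S y1, S y2, S y3, S y4) * (w y1 * w y2 * w y3 * w y4) \<partial>lborel \<partial>lborel \<partial>lborel \<partial>lborel)"
          by (subst nn_integral_multc[symmetric], measurable, subst nn_integral_multc[symmetric], measurable,
              subst nn_integral_multc[symmetric], measurable, simp add: mult_ac)
        finally show ?thesis .
      qed
      have flat: "(\<integral>\<^sup>+y1. \<integral>\<^sup>+y2. \<integral>\<^sup>+y3. \<integral>\<^sup>+y4. G (S y1, S y2, S y3, S y4) * (w y1 * w y2 * w y3 * w y4) \<partial>lborel \<partial>lborel \<partial>lborel \<partial>lborel) =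
          simplex_const * (\<integral>\<^sup>+b. ennreal (1 / (1 + (norm (b :: real ^ 3))\<^sup>2)\<^sup>2) \<partial>lborel) *
          (\<integral>\<^sup>+h. \<phi> (h / sqrt (1 + h\<^sup>2)) * ennreal (1 / sqrt (1 + h\<^sup>2) ^ 17) \<partial>lborel)"
      proof -
        have m: "(\<lambda>Y. G (S (fst Y), S (fst (snd Y)), S (fst (snd (snd Y))), S (snd (snd (snd Y))))) \<in> borel_measurable borel"
          by measurable
        have m2: "(\<lambda>h. \<phi> (h / sqrt (1 + h\<^sup>2))) \<in> borel_measurable borel"
          by measurable
        have "G (S (z1, a + b \<bullet> z1), S (z2, a + b \<bullet> z2), S (z3, a + b \<bullet> z3), S (z4, a + b \<bullet> z4)) =
            \<phi> ((a / sqrt (1 + (norm b)\<^sup>2)) / sqrt (1 + (a / sqrt (1 + (norm b)\<^sup>2))\<^sup>2))"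
          if D: "simplex_det (z1, z2, z3, z4) \<noteq> 0" for z1 z2 z3 z4 a b
        proof -
          define h where "h = a / sqrt (1 + (norm b)\<^sup>2)"
          obtain u where u: "norm u = 1" "u \<bullet> T (0, -1) = h / sqrt (1 + h\<^sup>2)"
            "\<And>z. u \<bullet> T (stereo (z, a + b \<bullet> z)) = h / sqrt (1 + h\<^sup>2)"
            "\<And>v \<eta>. v \<bullet> T (0, -1) = \<eta> \<Longrightarrow> (\<And>z. z \<in> {z1, z2, z3, z4} \<Longrightarrow> v \<bullet> T (stereo (z, a + b \<bullet> z)) = \<eta>) \<Longrightarrow>
              \<exists>r. v = r *\<^sub>R u"
            using affine_hull_chart_points[OF T(1-3) D, of a b] unfolding h_def by blast
          have "\<bar>h / sqrt (1 + h\<^sup>2)\<bar> < 1"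
          proof -
            have "\<bar>h\<bar> < sqrt (1 + h\<^sup>2)" by (rule real_less_rsqrt) simp
            moreover have "0 < sqrt (1 + h\<^sup>2)" by (simp add: add_pos_nonneg)
            ultimately show ?thesis by (simp add: abs_divide pos_divide_less_eq)
          qed
          note lt = this
          show ?thesis
            unfolding G_def h_def[symmetric]
          proof (rule eq\<Phi>[OF u(1) lt])
            let ?P = "{x0, S (z1, a + b \<bullet> z1), S (z2, a + b \<bullet> z2), S (z3, a + b \<bullet> z3), S (z4, a + b \<bullet> z4)}"
            show "u \<bullet> x = h / sqrt (1 + h\<^sup>2)" if "x \<in> ?P" for x
              using that u(2,3) T(4) by (auto simp: S_def)
            show "\<exists>r. v = r *\<^sub>R u" if v: "\<And>x. x \<in> ?P \<Longrightarrow> v \<bullet> x = \<eta>" for v \<eta>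
            proof (rule u(4)[of v \<eta>])
              show "v \<bullet> T (0, - 1) = \<eta>" unfolding T(4) by (rule v) simp
              show "v \<bullet> T (stereo (z, a + b \<bullet> z)) = \<eta>" if "z \<in> {z1, z2, z3, z4}" for z
                unfolding S_def[symmetric] by (rule v) (use that in auto)
            qed
          qed
        qed
        then show ?thesis
          using affine_blaschke_petkantschin_beta[OF m m2] by (simp add: w_def)
      qed
      have "(\<integral>\<^sup>+x1. \<integral>\<^sup>+x2. \<integral>\<^sup>+x3. \<integral>\<^sup>+x4. \<Phi> (x0, x1, x2, x3, x4)
          \<partial>sphere_law \<partial>sphere_law \<partial>sphere_law \<partial>sphere_law) =
          C * (\<integral>\<^sup>+h. \<phi> (h / sqrt (1 + h\<^sup>2)) * ennreal (1 / sqrt (1 + h\<^sup>2) ^ 17) \<partial>lborel)"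
        using c1 unfolding flat by (simp add: G_def C_def mult.assoc)
      then show ?thesis
        by (simp add: nn_integral_tan_substitution)
    qed
    have "(\<integral>\<^sup>+x0. \<integral>\<^sup>+x1. \<integral>\<^sup>+x2. \<integral>\<^sup>+x3. \<integral>\<^sup>+x4. \<Phi> (x0, x1, x2, x3, x4)
        \<partial>sphere_law \<partial>sphere_law \<partial>sphere_law \<partial>sphere_law \<partial>sphere_law) = (\<integral>\<^sup>+x0. ?R \<partial>(sphere_law :: (real ^ 5) measure))"
      using AE_sphere_law_norm by (intro nn_integral_cong_AE, eventually_elim) (rule inner)
    then show ?thesis
      using S.emeasure_space_1 by simp
  qed
  \<comment> \<open>The iterated integral of 1 is 1, so \<open>C\<close> is the reciprocal of the
    cosine integral.\<close>
  have "1 = C * ennreal (4096 / 6435)"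
    using main[of "\<lambda>_. 1" "\<lambda>_. 1"] S.emeasure_space_1 by (simp add: nn_integral_cos_power_15)
  then have "ennreal (6435 / 4096) * 1 = ennreal (6435 / 4096) * (C * ennreal (4096 / 6435))"
    by simp
  also have "\<dots> = C * (ennreal (6435 / 4096) * ennreal (4096 / 6435))"
    by (simp only: mult_ac)
  also have "\<dots> = C"
    by (subst ennreal_mult[symmetric]) auto
  finally have C: "C = ennreal (6435 / 4096)" by simp
  have "(\<integral>\<^sup>+x. \<psi> (sin x) * ennreal (6435 / 4096 * cos x ^ 15) * indicator {-(pi/2)<..<pi/2} x \<partial>lborel) =
      (\<integral>\<^sup>+x. C * (\<psi> (sin x) * ennreal (cos x ^ 15) * indicator {-(pi/2)<..<pi/2} x) \<partial>lborel)"
  proof (rule nn_integral_cong)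
    fix x :: real
    have "ennreal (6435 / 4096 * cos x ^ 15) = C * ennreal (cos x ^ 15)"
      unfolding C by (rule ennreal_mult') simp
    then show "\<psi> (sin x) * ennreal (6435 / 4096 * cos x ^ 15) * indicator {-(pi/2)<..<pi/2} x =
        C * (\<psi> (sin x) * ennreal (cos x ^ 15) * indicator {-(pi/2)<..<pi/2} x)"
      by (simp only: mult_ac)
  qed
  also have "\<dots> = C * (\<integral>\<^sup>+x. \<psi> (sin x) * ennreal (cos x ^ 15) * indicator {-(pi/2)<..<pi/2} x \<partial>lborel)"
    by (rule nn_integral_cmult) measurable
  finally show ?thesis
    using main[OF \<Psi> \<psi> eq] by simp
qed

section \<open>Faces of a Voronoi cell\<close>

text \<open>A face of the cone is encoded by the set \<open>J\<close> of inequalities tight at its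
  relatively interior points. The subspace cut out by \<open>J\<close> is then the linear span of
  the face, so \<open>s\<close> is the dimension of the face.\<close>

definition face_index_sets :: "'i set \<Rightarrow> ('i \<Rightarrow> 'a::euclidean_space) \<Rightarrow> nat \<Rightarrow> 'i set set"
  where "face_index_sets I a s = {J. J \<subseteq> I \<and> (\<exists>z. (\<forall>j\<in>J. a j \<bullet> z = 0) \<and> (\<forall>j\<in>I - J. a j \<bullet> z < 0)) \<and>
    dim {z. \<forall>j\<in>J. a j \<bullet> z = 0} = s}"

definition cone_face :: "'i set \<Rightarrow> ('i \<Rightarrow> 'a::euclidean_space) \<Rightarrow> 'i set \<Rightarrow> 'a set"
  where "cone_face I a J = {z. (\<forall>j\<in>I. a j \<bullet> z \<le> 0) \<and> (\<forall>j\<in>J. a j \<bullet> z = 0)}"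

lemma convex_cone_face: "convex (cone_face I a J)"
proof -
  have "cone_face I a J = (\<Inter>j\<in>I. {z. a j \<bullet> z \<le> 0}) \<inter> (\<Inter>j\<in>J. {z. a j \<bullet> z = 0})"
    by (auto simp: cone_face_def)
  then show ?thesis
    by (simp add: convex_INT convex_Int convex_halfspace_le convex_hyperplane)
qed

lemma cone_face_face_of:
  assumes J: "J \<subseteq> I"
  shows "cone_face I a J face_of cone_face I a {}"
  unfolding face_of_def
proof (intro conjI ballI impI)
  fix p q x assume p: "p \<in> cone_face I a {}" and q: "q \<in> cone_face I a {}" and x: "x \<in> cone_face I a J"
    and seg: "x \<in> open_segment p q"
  obtain t where t: "0 < t" "t < 1" "x = (1 - t) *\<^sub>R p + t *\<^sub>R q"
    using seg by (auto simp: in_segment)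
  have *: "a j \<bullet> p = 0 \<and> a j \<bullet> q = 0" if j: "j \<in> J" for j
  proof -
    have le: "a j \<bullet> p \<le> 0" "a j \<bullet> q \<le> 0"
      using p q j J by (auto simp: cone_face_def)
    have "(1 - t) * (a j \<bullet> p) + t * (a j \<bullet> q) = 0"
      using x j by (simp add: cone_face_def t(3) inner_add_right)
    moreover have "(1 - t) * (a j \<bullet> p) \<le> 0" "t * (a j \<bullet> q) \<le> 0"
      using le t by (auto simp: mult_le_0_iff)
    ultimately have "(1 - t) * (a j \<bullet> p) = 0" "t * (a j \<bullet> q) = 0"
      by linarith+
    then show ?thesis using t by simp
  qed
  show "p \<in> cone_face I a J" "q \<in> cone_face I a J"
    using p q * by (auto simp: cone_face_def)
next
  show "cone_face I a J \<subseteq> cone_face I a {}"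
    by (auto simp: cone_face_def)
qed (rule convex_cone_face)

lemma open_strict_halfspaces:
  assumes "finite K"
  shows "open {z. \<forall>j\<in>K. a j \<bullet> z < (0::real)}"
proof -
  have "{z. \<forall>j\<in>K. a j \<bullet> z < 0} = (\<Inter>j\<in>K. {z. a j \<bullet> z < 0})" by auto
  then show ?thesis using assms by (auto intro!: open_INT open_halfspace_lt)
qed

text \<open>The face lies between the subspace of its equations and the nonempty relatively open
  part of that subspace on which the other inequalities are strict.\<close>

lemma aff_dim_cone_face:
  assumes I: "finite I" "J \<subseteq> I" and z: "\<And>j. j \<in> J \<Longrightarrow> a j \<bullet> z = 0" "\<And>j. j \<in> I - J \<Longrightarrow> a j \<bullet> z < 0"
  shows "aff_dim (cone_face I a J) = int (dim {z. \<forall>j\<in>J. a j \<bullet> z = 0})"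
proof -
  let ?V = "{z. \<forall>j\<in>J. a j \<bullet> z = 0}" and ?O = "{z. \<forall>j\<in>I - J. a j \<bullet> z < 0}"
  have sub: "subspace ?V"
    by (auto simp: subspace_def inner_add_right)
  have "z \<in> ?V \<inter> ?O" using z by simp
  then have "?V \<inter> ?O \<noteq> {}" by blast
  then have "aff_dim (?V \<inter> ?O) = aff_dim ?V"
    using I by (intro aff_dim_convex_Int_open open_strict_halfspaces subspace_imp_convex sub) auto
  moreover have "?V \<inter> ?O \<subseteq> cone_face I a J"
  proof
    fix w assume w: "w \<in> ?V \<inter> ?O"
    have "a j \<bullet> w \<le> 0" if "j \<in> I" for j
      using w that by (cases "j \<in> J") (auto intro: less_imp_le)
    then show "w \<in> cone_face I a J" using w by (simp add: cone_face_def)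
  qed
  moreover have "cone_face I a J \<subseteq> ?V"
    by (auto simp: cone_face_def)
  ultimately have "aff_dim (cone_face I a J) = aff_dim ?V"
    using aff_dim_subset[of "?V \<inter> ?O" "cone_face I a J"] aff_dim_subset[of "cone_face I a J" ?V] by simp
  then show ?thesis
    by (simp add: aff_dim_subspace[OF sub])
qed

text \<open>Take \<open>z\<close> in the relative interior and let \<open>J\<close> be the
  inequalities tight there. Segments from points of \<open>G\<close> to \<open>z\<close> can be
  prolonged beyond \<open>z\<close> within \<open>G\<close>, which forces equality in
  \<open>J\<close> on all of \<open>G\<close>. Conversely, a point of \<open>cone_face I a J\<close>
  and a point slightly beyond \<open>z\<close> have \<open>z\<close> between them, so the face
  property puts the former into \<open>G\<close>.\<close>

lemma face_of_cone_imp_cone_face: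
  assumes I: "finite I" and G: "G face_of cone_face I a {}" "G \<noteq> {}"
  obtains J z where "J \<subseteq> I" "\<And>j. j \<in> J \<Longrightarrow> a j \<bullet> z = 0" "\<And>j. j \<in> I - J \<Longrightarrow> a j \<bullet> z < 0" "G = cone_face I a J"
proof -
  have conv: "convex G" and sub: "G \<subseteq> cone_face I a {}"
    using G(1) by (auto simp: face_of_def)
  obtain z where z: "z \<in> rel_interior G"
    using G(2) rel_interior_eq_empty[OF conv] by auto
  then have zG: "z \<in> G" using rel_interior_subset by blast
  define J where "J = {j \<in> I. a j \<bullet> z = 0}"
  have strict: "a j \<bullet> z < 0" if "j \<in> I - J" for j
    using that zG sub by (force simp: J_def cone_face_def)
  have 1: "G \<subseteq> cone_face I a J"
  proof
    fix g assume g: "g \<in> G"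
    obtain e where e: "e > 1" "(1 - e) *\<^sub>R g + e *\<^sub>R z \<in> G"
      using convex_rel_interior_if2[OF conv z] hull_inc[OF g] by blast
    have "a j \<bullet> g = 0" if j: "j \<in> J" for j
    proof -
      have "a j \<bullet> g \<le> 0" "(1 - e) * (a j \<bullet> g) + e * (a j \<bullet> z) \<le> 0"
        using subsetD[OF sub g] subsetD[OF sub e(2)] j by (auto simp: cone_face_def J_def inner_add_right)
      then show ?thesis
        using j e(1) by (auto simp: J_def mult_le_0_iff)
    qed
    then show "g \<in> cone_face I a J"
      using g sub by (auto simp: cone_face_def)
  qed
  have 2: "cone_face I a J \<subseteq> G"
  proof
    fix f assume f: "f \<in> cone_face I a J"
    show "f \<in> G"
    proof (cases "f = z")
      case False
      define p where "p = (\<lambda>e. z + e *\<^sub>R (z - f))"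
      have "continuous (at 0) p" unfolding p_def by (intro continuous_intros)
      moreover have "open {z. \<forall>j\<in>I - J. a j \<bullet> z < 0}"
        using I by (intro open_strict_halfspaces) auto
      moreover have "p 0 \<in> {z. \<forall>j\<in>I - J. a j \<bullet> z < 0}"
        using strict by (simp add: p_def)
      ultimately have "\<forall>\<^sub>F e in at 0. p e \<in> {z. \<forall>j\<in>I - J. a j \<bullet> z < 0}"
        by (simp add: continuous_at tendsto_def del: mem_Collect_eq)
      then have "\<forall>\<^sub>F e in at_right 0. p e \<in> {z. \<forall>j\<in>I - J. a j \<bullet> z < 0}"
        by (simp add: eventually_at_split)
      then obtain d where d: "d > 0" "\<And>e. 0 < e \<Longrightarrow> e < d \<Longrightarrow> p e \<in> {z. \<forall>j\<in>I - J. a j \<bullet> z < 0}"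
        unfolding eventually_at_right_field by blast
      define e where "e = d / 2"
      have e: "e > 0" "p e \<in> {z. \<forall>j\<in>I - J. a j \<bullet> z < 0}"
        using d(1) d(2)[of e] by (auto simp: e_def)
      have "p e \<in> cone_face I a {}"
        using e(2) f by (auto simp: cone_face_def p_def J_def inner_add_right inner_diff_right
            intro: less_imp_le)
      moreover have "f \<in> cone_face I a {}"
        using f by (auto simp: cone_face_def)
      moreover have "z \<in> open_segment f (p e)"
      proof -
        have "z = (1 - 1 / (1 + e)) *\<^sub>R f + (1 / (1 + e)) *\<^sub>R p e"
        proof -
          have "(1 + e) *\<^sub>R z = e *\<^sub>R f + p e"
            by (simp add: p_def algebra_simps)
          then have "z = (1 / (1 + e)) *\<^sub>R (e *\<^sub>R f + p e)"
            using e(1) by (simp flip: \<open>(1 + e) *\<^sub>R z = e *\<^sub>R f + p e\<close>)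
          moreover have "1 - 1 / (1 + e) = e / (1 + e)"
            using e(1) by (simp add: field_simps)
          ultimately show ?thesis
            by (simp add: scaleR_add_right)
        qed
        moreover have "f \<noteq> p e"
        proof
          assume "f = p e"
          then have "(1 + e) *\<^sub>R (f - z) = 0" by (simp add: p_def algebra_simps)
          then show False using e(1) False by simp
        qed
        ultimately show ?thesis
          using e(1) unfolding in_segment by (intro conjI exI[of _ "1 / (1 + e)"]) auto
      qed
      ultimately show ?thesis
        using face_ofD[OF G(1), of z f "p e"] zG by simp
    qed (simp add: zG)
  qed
  show thesis
    by (rule that[of J z]) (use 1 2 strict in \<open>auto simp: J_def\<close>)
qed

lemma cone_face_scale: "z \<in> cone_face I a J \<Longrightarrow> c \<ge> 0 \<Longrightarrow> c *\<^sub>R z \<in> cone_face I a J"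
  by (auto simp: cone_face_def mult_le_0_iff)

text \<open>The origin lies in every such cone and any other point can be rescaled to norm one, so
  the traces on the sphere determine the cones.\<close>

lemma cone_face_sphere_eq_iff:
  "cone_face I a J \<inter> unit_sphere = cone_face I a K \<inter> unit_sphere \<longleftrightarrow> cone_face I a J = cone_face I a K"
proof -
  have "z \<in> cone_face I a J \<longleftrightarrow> z = 0 \<or> z /\<^sub>R norm z \<in> cone_face I a J \<inter> unit_sphere" for z J
  proof (cases "z = 0")
    case False
    then have "z = norm z *\<^sub>R (z /\<^sub>R norm z)" by simp
    then show ?thesis
      using False cone_face_scale[of z I a J "inverse (norm z)"] cone_face_scale[of "z /\<^sub>R norm z" I a J "norm z"]
      by (auto simp del: scaleR_scaleR)
  qed (auto simp: cone_face_def)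
  then show ?thesis by blast
qed

text \<open>Each witness also lies in the other face, hence satisfies the equations of the other
  index set, but it is strict outside its own.\<close>

lemma cone_face_inject:
  assumes J: "J \<subseteq> I" "\<And>j. j \<in> J \<Longrightarrow> a j \<bullet> z = 0" "\<And>j. j \<in> I - J \<Longrightarrow> a j \<bullet> z < 0"
    and K: "K \<subseteq> I" "\<And>j. j \<in> K \<Longrightarrow> a j \<bullet> w = 0" "\<And>j. j \<in> I - K \<Longrightarrow> a j \<bullet> w < 0"
    and eq: "cone_face I a J = cone_face I a K"
  shows "J = K"
proof -
  have le: "a j \<bullet> z \<le> 0" "a j \<bullet> w \<le> 0" if "j \<in> I" for j
    using J(2,3)[of j] K(2,3)[of j] that by (cases "j \<in> J"; cases "j \<in> K"; simp)+
  have "z \<in> cone_face I a K" "w \<in> cone_face I a J"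
    unfolding eq[symmetric] using J(2) le(1) by (simp add: cone_face_def)
      (unfold eq, use K(2) le(2) in \<open>simp add: cone_face_def\<close>)
  then have "a j \<bullet> z = 0" if "j \<in> K" for j
    using that by (simp add: cone_face_def)
  moreover have "a j \<bullet> w = 0" if "j \<in> J" for j
    using that \<open>w \<in> cone_face I a J\<close> by (simp add: cone_face_def)
  ultimately have "j \<in> J \<longleftrightarrow> j \<in> K" if "j \<in> I" for j
    using J(3)[of j] K(3)[of j] that by (cases "j \<in> J"; cases "j \<in> K"; simp)
  then show ?thesis
    using J(1) K(1) by blast
qed

text \<open>Tight index sets parametrise the faces bijectively. The shift to \<open>Suc k\<close> is
  the one from spherical to conical dimension.\<close>

lemma face_number_polyhedral_cone:
  fixes a :: "'i \<Rightarrow> 'a::euclidean_space"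
  assumes I: "finite I"
  shows "face_number k ((\<Inter>j\<in>I. {z. a j \<bullet> z \<le> 0}) \<inter> unit_sphere) = card (face_index_sets I a (Suc k))"
proof -
  let ?C = "cone_face I a {}"
  have C: "(\<Inter>j\<in>I. {z. a j \<bullet> z \<le> 0}) = ?C"
    by (auto simp: cone_face_def)
  have poly: "polyhedral_cone ?C"
    unfolding polyhedral_cone_def
    \<comment> \<open>Zero normals impose nothing and are dropped, since a polyhedral cone is
      defined by nonzero ones.\<close>
    by (rule exI[of _ "a ` I - {0}"]) (use I in \<open>auto simp: cone_face_def\<close>)
  have "spherical_faces k (?C \<inter> unit_sphere) = (\<lambda>J. cone_face I a J \<inter> unit_sphere) ` face_index_sets I a (Suc k)"
  proof (intro equalityI subsetI)
    fix S assume "S \<in> spherical_faces k (?C \<inter> unit_sphere)"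
    then obtain G D where G: "S = G \<inter> unit_sphere" "polyhedral_cone D" "?C \<inter> unit_sphere = D \<inter> unit_sphere"
      "G face_of D" "aff_dim G = int k + 1"
      by (auto simp: spherical_faces_def)
    have "D = ?C" using polyhedral_cone_unique[OF poly G(2,3)] by simp
    moreover have "G \<noteq> {}" using G(5) by auto
    ultimately obtain J z where J: "J \<subseteq> I" "\<And>j. j \<in> J \<Longrightarrow> a j \<bullet> z = 0" "\<And>j. j \<in> I - J \<Longrightarrow> a j \<bullet> z < 0" "G = cone_face I a J"
      using face_of_cone_imp_cone_face[OF I, of G a] G(4) by metis
    have "dim {z. \<forall>j\<in>J. a j \<bullet> z = 0} = Suc k"
      using aff_dim_cone_face[OF I J(1), of a z] J(2-4) G(5) by simp
    then have "J \<in> face_index_sets I a (Suc k)"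
      using J(1-3) by (auto simp: face_index_sets_def)
    then show "S \<in> (\<lambda>J. cone_face I a J \<inter> unit_sphere) ` face_index_sets I a (Suc k)"
      using G(1) J(4) by blast
  next
    fix S assume "S \<in> (\<lambda>J. cone_face I a J \<inter> unit_sphere) ` face_index_sets I a (Suc k)"
    then obtain J where J1: "S = cone_face I a J \<inter> unit_sphere" "J \<in> face_index_sets I a (Suc k)"
      by blast
    then obtain z where J: "S = cone_face I a J \<inter> unit_sphere" "J \<subseteq> I" "\<And>j. j \<in> J \<Longrightarrow> a j \<bullet> z = 0"
      "\<And>j. j \<in> I - J \<Longrightarrow> a j \<bullet> z < 0" "dim {z. \<forall>j\<in>J. a j \<bullet> z = 0} = Suc k"
      unfolding face_index_sets_def by blast
    have "aff_dim (cone_face I a J) = int k + 1"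
      using aff_dim_cone_face[OF I J(2), of a z] J(3-5) by simp
    then show "S \<in> spherical_faces k (?C \<inter> unit_sphere)"
      using J(1) poly cone_face_face_of[OF J(2), of a] by (auto simp: spherical_faces_def)
  qed
  moreover have "inj_on (\<lambda>J. cone_face I a J \<inter> unit_sphere) (face_index_sets I a (Suc k))"
    unfolding inj_on_def cone_face_sphere_eq_iff
  proof (intro ballI impI)
    fix J K assume JK: "J \<in> face_index_sets I a (Suc k)" "K \<in> face_index_sets I a (Suc k)"
      and eq: "cone_face I a J = cone_face I a K"
    obtain z where J: "J \<subseteq> I" "\<forall>j\<in>J. a j \<bullet> z = 0" "\<forall>j\<in>I - J. a j \<bullet> z < 0"
      using JK(1) unfolding face_index_sets_def by blast
    obtain w where K: "K \<subseteq> I" "\<forall>j\<in>K. a j \<bullet> w = 0" "\<forall>j\<in>I - K. a j \<bullet> w < 0"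
      using JK(2) unfolding face_index_sets_def by blast
    show "J = K"
      by (rule cone_face_inject[OF J(1) _ _ K(1) _ _ eq, of z w]) (use J K in blast)+
  qed
  ultimately show ?thesis
    unfolding face_number_def C by (simp add: card_image)
qed

text \<open>The orthogonal complement of the direction space of the affine hull of the points in
  \<open>J\<close>. For points on the sphere, its unit vectors are those equidistant from all of
  them. Taking all pairs avoids the choice of a base point.\<close>

definition tie_space :: "('i \<Rightarrow> 'a::euclidean_space) \<Rightarrow> 'i set \<Rightarrow> 'a set"
  where "tie_space x J = {z. \<forall>i\<in>J. \<forall>j\<in>J. (x j - x i) \<bullet> z = 0}"

text \<open>For nonempty \<open>J\<close>: some linear functional attains its maximum over the points exactly on \<open>J\<close>, i.e. \<open>J\<close>
  is the vertex set of a face of their convex hull, whose normal cones are the cones over the Voronoi cells.\<close>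

definition hull_face :: "'i set \<Rightarrow> ('i \<Rightarrow> 'a::euclidean_space) \<Rightarrow> 'i set \<Rightarrow> bool"
  where "hull_face I x J \<longleftrightarrow> J \<subseteq> I \<and> (\<exists>z. \<forall>i\<in>J. (\<forall>j\<in>J. (x j - x i) \<bullet> z = 0) \<and> (\<forall>j\<in>I - J. (x j - x i) \<bullet> z < 0))"

lemma subspace_tie_space: "subspace (tie_space x J)"
  by (auto simp: subspace_def tie_space_def inner_add_right)

lemma tie_space_eq:
  assumes i: "i \<in> J"
  shows "tie_space x J = {z. \<forall>j\<in>J. (x j - x i) \<bullet> z = 0}"
proof -
  have eq: "(x k - x l) \<bullet> z = (x k - x i) \<bullet> z - (x l - x i) \<bullet> z" for k l z
    by (simp add: inner_diff_left)
  have "z \<in> tie_space x J" if z: "\<forall>j\<in>J. (x j - x i) \<bullet> z = 0" for z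
    unfolding tie_space_def
  proof (intro CollectI ballI)
    fix k l assume "k \<in> J" "l \<in> J"
    then show "(x l - x k) \<bullet> z = 0"
      using z unfolding eq[of l k] by simp
  qed
  moreover have "\<forall>j\<in>J. (x j - x i) \<bullet> z = 0" if "z \<in> tie_space x J" for z
    using that i unfolding tie_space_def by blast
  ultimately show ?thesis by blast
qed

lemma hull_face_iff:
  assumes i: "i \<in> J"
  shows "hull_face I x J \<longleftrightarrow> J \<subseteq> I \<and> (\<exists>z. (\<forall>j\<in>J. (x j - x i) \<bullet> z = 0) \<and> (\<forall>j\<in>I - J. (x j - x i) \<bullet> z < 0))"
proof -
  have eq: "(x k - x l) \<bullet> z = (x k - x i) \<bullet> z - (x l - x i) \<bullet> z" for k l z
    by (simp add: inner_diff_left)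
  have "\<forall>k\<in>J. (\<forall>j\<in>J. (x j - x k) \<bullet> z = 0) \<and> (\<forall>j\<in>I - J. (x j - x k) \<bullet> z < 0)"
    if z: "\<forall>j\<in>J. (x j - x i) \<bullet> z = 0" "\<forall>j\<in>I - J. (x j - x i) \<bullet> z < 0" for z
  proof (intro ballI conjI)
    fix k j assume k: "k \<in> J"
    show "(x j - x k) \<bullet> z = 0" if "j \<in> J"
      using z(1) k that unfolding eq[of j k] by simp
    show "(x j - x k) \<bullet> z < 0" if "j \<in> I - J"
      using z(1) bspec[OF z(2) that] k unfolding eq[of j k] by simp
  qed
  then show ?thesis
    unfolding hull_face_def using i by blast
qed

text \<open>As \<open>arccos\<close> decreases, comparing the distances to \<open>x i\<close> and
  \<open>x j\<close> amounts to the linear inequality \<open>(x j - x i) . z \<le> 0\<close>. The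
  one for \<open>j = i\<close> is always tight, so \<open>i\<close> belongs to every index
  set.\<close>

lemma face_number_voronoi_cell:
  fixes x :: "nat \<Rightarrow> 'a::euclidean_space"
  assumes x: "\<And>j. j \<in> {1..m} \<Longrightarrow> x j \<in> unit_sphere" and i: "i \<in> {1..m}"
  shows "face_number k (voronoi_cell m x i) =
    card {J. i \<in> J \<and> hull_face {1..m} x J \<and> dim (tie_space x J) = Suc k}"
proof -
  let ?I = "{1..m}" and ?a = "\<lambda>j. x j - x i"
  have "\<bar>x j \<bullet> z\<bar> \<le> 1" if "j \<in> ?I" "norm z = 1" for j z
    using Cauchy_Schwarz_ineq2[of "x j" z] x[OF that(1)] that(2) by simp
  then have "geodesic_dist (x i) z \<le> geodesic_dist (x j) z \<longleftrightarrow> (x j - x i) \<bullet> z \<le> 0"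
    if "j \<in> ?I" "norm z = 1" for j z
    using that i by (simp add: geodesic_dist_def arccos_le_mono inner_diff_left)
  then have "voronoi_cell m x i = (\<Inter>j\<in>?I. {z. ?a j \<bullet> z \<le> 0}) \<inter> unit_sphere"
    unfolding voronoi_cell_def by auto
  then have "face_number k (voronoi_cell m x i) = card (face_index_sets ?I ?a (Suc k))"
    by (simp add: face_number_polyhedral_cone)
  also have "face_index_sets ?I ?a (Suc k) = {J. i \<in> J \<and> hull_face ?I x J \<and> dim (tie_space x J) = Suc k}"
  proof (intro set_eqI iffI)
    fix J assume "J \<in> face_index_sets ?I ?a (Suc k)"
    then obtain z where J: "J \<subseteq> ?I" "\<forall>j\<in>J. ?a j \<bullet> z = 0" "\<forall>j\<in>?I - J. ?a j \<bullet> z < 0"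
      and dim: "dim {z. \<forall>j\<in>J. ?a j \<bullet> z = 0} = Suc k"
      unfolding face_index_sets_def by blast
    have iJ: "i \<in> J"
    proof (rule ccontr)
      assume "i \<notin> J"
      then have "?a i \<bullet> z < 0" using J(3) i by blast
      then show False by simp
    qed
    have "hull_face ?I x J"
      unfolding hull_face_iff[OF iJ] by (intro conjI exI[of _ z] J)
    then show "J \<in> {J. i \<in> J \<and> hull_face ?I x J \<and> dim (tie_space x J) = Suc k}"
      unfolding mem_Collect_eq tie_space_eq[OF iJ] using dim by (intro conjI iJ)
  next
    fix J assume "J \<in> {J. i \<in> J \<and> hull_face ?I x J \<and> dim (tie_space x J) = Suc k}"
    then have J: "i \<in> J" "hull_face ?I x J" "dim (tie_space x J) = Suc k"
      by blast+
    obtain z where z: "J \<subseteq> ?I" "\<forall>j\<in>J. ?a j \<bullet> z = 0" "\<forall>j\<in>?I - J. ?a j \<bullet> z < 0"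
      using J(2) unfolding hull_face_iff[OF J(1)] by (elim conjE exE)
    show "J \<in> face_index_sets ?I ?a (Suc k)"
      unfolding face_index_sets_def mem_Collect_eq
      by (intro conjI exI[of _ z] z J(3)[unfolded tie_space_eq[OF J(1)]])
  qed
  finally show ?thesis .
qed

text \<open>The image is the cell of the moved points, and hull faces and tie spaces are described
  by inner products, which \<open>f\<close> preserves.\<close>

lemma face_number_orthogonal_image_voronoi_cell:
  fixes f :: "'a::euclidean_space \<Rightarrow> 'a" and x :: "nat \<Rightarrow> 'a"
  assumes f: "orthogonal_transformation f"
    and x: "\<And>j. j \<in> {1..m} \<Longrightarrow> x j \<in> unit_sphere" and i: "i \<in> {1..m}"
  shows "face_number k (f ` voronoi_cell m x i) =
    card {J. i \<in> J \<and> hull_face {1..m} x J \<and> dim (tie_space x J) = Suc k}"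
proof -
  have lin: "linear f" and inner: "\<And>v w. f v \<bullet> f w = v \<bullet> w"
    using f by (auto simp: orthogonal_transformation_def)
  have nrm: "norm (f v) = norm v" for v
    by (rule orthogonal_transformation_norm[OF f])
  have inner_f: "(f (x j) - f (x i)) \<bullet> f z = (x j - x i) \<bullet> z" for i j z
    by (simp add: inner_diff_left inner)
  have inj: "inj f" by (rule orthogonal_transformation_inj[OF f])
  have surj: "\<exists>w. z = f w" for z
    using linear_inj_imp_surj[OF lin inj] unfolding surj_def by blast
  have "f ` voronoi_cell m x i = voronoi_cell m (f \<circ> x) i"
  proof (intro set_eqI iffI)
    fix z assume "z \<in> voronoi_cell m (f \<circ> x) i"
    moreover obtain w where "z = f w" using surj by blast
    ultimately show "z \<in> f ` voronoi_cell m x i"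
      by (auto simp: voronoi_cell_def geodesic_dist_def inner nrm)
  qed (auto simp: voronoi_cell_def geodesic_dist_def inner nrm)
  moreover have "hull_face {1..m} (f \<circ> x) J = hull_face {1..m} x J" for J
  proof -
    have "(\<exists>z. P z) \<longleftrightarrow> (\<exists>w. P (f w))" for P
    proof
      assume "\<exists>z. P z"
      then obtain z where "P z" ..
      moreover obtain w where "z = f w" using surj by blast
      ultimately show "\<exists>w. P (f w)" by blast
    qed blast
    from this[of "\<lambda>z. \<forall>i\<in>J. (\<forall>j\<in>J. (f (x j) - f (x i)) \<bullet> z = 0) \<and>
        (\<forall>j\<in>{1..m} - J. (f (x j) - f (x i)) \<bullet> z < 0)"]
    show ?thesis unfolding hull_face_def comp_apply inner_f by simp
  qed
  moreover have "dim (tie_space (f \<circ> x) J) = dim (tie_space x J)" for J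
  proof -
    have "tie_space (f \<circ> x) J = f ` tie_space x J"
    proof (intro set_eqI iffI)
      fix z assume "z \<in> tie_space (f \<circ> x) J"
      moreover obtain w where "z = f w" using surj by blast
      ultimately show "z \<in> f ` tie_space x J" by (auto simp: tie_space_def inner_f)
    qed (auto simp: tie_space_def inner_f)
    then show ?thesis
      using dim_image_eq[OF lin inj_on_subset[OF inj]] by simp
  qed
  moreover have "face_number k (voronoi_cell m (f \<circ> x) i) =
      card {J. i \<in> J \<and> hull_face {1..m} (f \<circ> x) J \<and> dim (tie_space (f \<circ> x) J) = Suc k}"
    by (rule face_number_voronoi_cell) (use x i nrm in auto)
  ultimately show ?thesis by simp
qed

section \<open>The h-vector of a simple polytope\<close>

locale simple_polyhedron =
  fixes I :: "'i set" and y :: "'i \<Rightarrow> 'a::euclidean_space"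
  assumes fin: "finite I"
    and bdd: "bounded {u. \<forall>i\<in>I. y i \<bullet> u \<le> 1}"
    and simple: "\<And>u. \<forall>i\<in>I. y i \<bullet> u \<le> 1 \<Longrightarrow>
      inj_on y {i \<in> I. y i \<bullet> u = 1} \<and> independent (y ` {i \<in> I. y i \<bullet> u = 1})"
begin

definition D where "D = {u. \<forall>i\<in>I. y i \<bullet> u \<le> 1}"
definition tight where "tight u = {i \<in> I. y i \<bullet> u = 1}"
text \<open>A face is identified with its set of tight constraints; by simplicity a face with
  \<open>s\<close> of them has codimension \<open>s\<close>, so that \<open>s = DIM('a)\<close>
  gives the vertices.\<close>

definition faces where "faces s = {G. (\<exists>u\<in>D. tight u = G) \<and> card G = s}"

lemma tight_subset: "tight u \<subseteq> I" and finite_tight: "finite (tight u)"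
  using fin by (auto simp: tight_def)

lemma tight_indep: "u \<in> D \<Longrightarrow> inj_on y (tight u) \<and> independent (y ` tight u)"
  unfolding tight_def D_def by (rule simple) simp

lemma finite_faces: "finite (faces s)"
proof -
  have "faces s \<subseteq> Pow I" using tight_subset by (auto simp: faces_def)
  then show ?thesis using fin finite_subset by blast
qed

lemma closed_D: "closed D"
proof -
  have "D = (\<Inter>i\<in>I. {u. y i \<bullet> u \<le> 1})" by (auto simp: D_def)
  then show ?thesis by (simp add: closed_INT closed_halfspace_le)
qed

text \<open>Independence provides a linear functional with the prescribed values; \<open>w\<close>
  represents it as an inner product.\<close>

lemma exists_prescribed_inner:
  assumes "inj_on y T" "independent (y ` T)"
  obtains w where "\<And>i. i \<in> T \<Longrightarrow> y i \<bullet> w = c i"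
proof -
  obtain f where f: "linear f" "\<And>b. b \<in> y ` T \<Longrightarrow> f b = c (inv_into T y b)"
    using linear_independent_extend[OF assms(2), of "\<lambda>b. c (inv_into T y b)"] by blast
  define w where "w = adjoint f 1"
  have "y i \<bullet> w = c i" if "i \<in> T" for i
  proof -
    have "y i \<bullet> w = f (y i) \<bullet> 1"
      unfolding w_def by (simp add: adjoint_works[OF f(1)] inner_commute)
    then show ?thesis using f(2)[of "y i"] that assms(1) by simp
  qed
  then show thesis by (rule that)
qed

text \<open>Slack constraints stay slack for small steps; a tight one changes by
  \<open>e * (y i . w)\<close>, so it is kept or released according to whether this product
  vanishes.\<close>

lemma perturb_in_D:
  assumes u: "u \<in> D" and w: "\<And>i. i \<in> tight u \<Longrightarrow> y i \<bullet> w \<le> 0"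
  shows "\<forall>\<^sub>F e in at_right 0. u + e *\<^sub>R w \<in> D \<and> tight (u + e *\<^sub>R w) = {i \<in> tight u. y i \<bullet> w = 0}"
proof -
  have "\<forall>\<^sub>F e in at_right 0. \<forall>i\<in>I - tight u. y i \<bullet> (u + e *\<^sub>R w) < 1"
  proof (rule eventually_ball_finite)
    show "\<forall>i\<in>I - tight u. \<forall>\<^sub>F e in at_right 0. y i \<bullet> (u + e *\<^sub>R w) < 1"
    proof
      fix i assume i: "i \<in> I - tight u"
      have "y i \<bullet> u < 1"
        using i u by (force simp: tight_def D_def)
      moreover have "((\<lambda>e. y i \<bullet> (u + e *\<^sub>R w)) \<longlongrightarrow> y i \<bullet> (u + 0 *\<^sub>R w)) (at_right 0)"
        by (intro tendsto_intros)
      ultimately show "\<forall>\<^sub>F e in at_right 0. y i \<bullet> (u + e *\<^sub>R w) < 1"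
        by (intro order_tendstoD(2)) auto
    qed
  qed (use fin in auto)
  moreover have "\<forall>\<^sub>F e in at_right (0::real). e > 0"
    by (rule eventually_at_right_less)
  ultimately show ?thesis
  proof eventually_elim
    fix e :: real assume e: "\<forall>i\<in>I - tight u. y i \<bullet> (u + e *\<^sub>R w) < 1" "e > 0"
    have t: "y i \<bullet> (u + e *\<^sub>R w) = 1 + e * (y i \<bullet> w)" if "i \<in> tight u" for i
      using that by (simp add: tight_def inner_add_right)
    have "y i \<bullet> (u + e *\<^sub>R w) \<le> 1" if "i \<in> I" for i
    proof (cases "i \<in> tight u")
      case True
      then show ?thesis unfolding t[OF True] using w[OF True] e(2) by (simp add: mult_le_0_iff)
    next
      case False
      then show ?thesis using e(1) that by (simp add: less_imp_le)
    qed
    then have "u + e *\<^sub>R w \<in> D" by (simp add: D_def)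
    moreover have "i \<in> tight (u + e *\<^sub>R w) \<longleftrightarrow> i \<in> tight u \<and> y i \<bullet> w = 0" for i
    proof (cases "i \<in> tight u")
      case True
      then have "i \<in> I" using tight_subset by blast
      then show ?thesis using True t[OF True] e(2) unfolding tight_def[of "u + e *\<^sub>R w"] by simp
    next
      case False
      then show ?thesis using e(1) unfolding tight_def[of "u + e *\<^sub>R w"] by (auto dest: bspec)
    qed
    ultimately show "u + e *\<^sub>R w \<in> D \<and> tight (u + e *\<^sub>R w) = {i \<in> tight u. y i \<bullet> w = 0}"
      by blast
  qed
qed

text \<open>By simplicity there is a direction along which the constraints in \<open>G\<close> are
  stationary and all other tight ones decrease.\<close>

lemma face_subset:
  assumes u: "u \<in> D" and G: "G \<subseteq> tight u"
  shows "\<exists>v\<in>D. tight v = G"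
proof -
  obtain w where w: "\<And>i. i \<in> tight u \<Longrightarrow> y i \<bullet> w = (if i \<in> G then 0 else -1)"
    using exists_prescribed_inner[of "tight u" "\<lambda>i. if i \<in> G then 0 else -1"] tight_indep[OF u] by blast
  have "\<forall>\<^sub>F e in at_right 0. u + e *\<^sub>R w \<in> D \<and> tight (u + e *\<^sub>R w) = {i \<in> tight u. y i \<bullet> w = 0}"
    by (rule perturb_in_D[OF u]) (simp add: w)
  then obtain e where e: "u + e *\<^sub>R w \<in> D" "tight (u + e *\<^sub>R w) = {i \<in> tight u. y i \<bullet> w = 0}"
    using eventually_happens' trivial_limit_at_right_real by blast
  have "{i \<in> tight u. y i \<bullet> w = 0} = G"
    using G w by (auto split: if_splits)
  then show ?thesis using e by blast
qed

text \<open>Makes all coefficients of \<open>q\<close> at every vertex nonzero, i.e.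
  \<open>q\<close> is constant along no edge.\<close>

definition generic where "generic q \<longleftrightarrow> (\<forall>J. J \<subseteq> I \<and> card J < DIM('a) \<longrightarrow> q \<notin> span (y ` J))"

lemma generic_exists: "\<exists>q. generic q"
proof -
  let ?S = "\<Union>J\<in>{J. J \<subseteq> I \<and> card J < DIM('a)}. span (y ` J)"
  have "negligible ?S"
  proof (rule negligible_Union)
    show "finite ((\<lambda>J. span (y ` J)) ` {J. J \<subseteq> I \<and> card J < DIM('a)})"
      using fin by (intro finite_imageI) (auto intro: finite_subset[OF _ finite_Pow_iff[THEN iffD2]])
    fix T assume "T \<in> (\<lambda>J. span (y ` J)) ` {J. J \<subseteq> I \<and> card J < DIM('a)}"
    then obtain J where J: "T = span (y ` J)" "J \<subseteq> I" "card J < DIM('a)" by blast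
    have "dim T \<le> card (y ` J)"
      unfolding J(1) dim_span using fin J(2) by (intro dim_le_card') (auto intro: finite_subset)
    also have "\<dots> \<le> card J" using fin J(2) by (intro card_image_le) (auto intro: finite_subset)
    finally show "negligible T" using J(3) by (intro negligible_lowdim) simp
  qed
  then have "?S \<noteq> UNIV" using non_negligible_UNIV by metis
  then obtain q where "q \<notin> ?S" by blast
  then show ?thesis by (auto simp: generic_def)
qed

lemma generic_uminus: "generic q \<Longrightarrow> generic (- q)"
  unfolding generic_def by (metis span_neg add.inverse_inverse)

text \<open>The coefficients of \<open>q\<close> in the basis of tight constraints at a vertex are the negatives of the slopes of
  \<open>u \<mapsto> q \<bullet> u\<close> along the edges leaving that vertex.\<close>

definition coef where "coef q T = (SOME c. q = (\<Sum>i\<in>T. c i *\<^sub>R y i))"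

text \<open>Releasing a constraint of this set leads along an edge on which \<open>q\<close>
  increases. So the vertex is lowest on the face with constraints \<open>G\<close> iff
  \<open>T - G\<close> lies in this set.\<close>

definition down where "down q T = {i \<in> T. coef q T i < 0}"

lemma card_tight_le: "u \<in> D \<Longrightarrow> card (tight u) \<le> DIM('a)"
  using tight_indep[of u] independent_card_le[of "y ` tight u"] by (simp add: card_image)

lemma coef_sum:
  assumes u: "u \<in> D" and c: "card (tight u) = DIM('a)"
  shows "q = (\<Sum>i\<in>tight u. coef q (tight u) i *\<^sub>R y i)"
proof -
  have ind: "inj_on y (tight u)" "independent (y ` tight u)"
    using tight_indep[OF u] by auto
  have "span (y ` tight u) = UNIV"
    using ind c card_image[OF ind(1)] by (metis card_eq_dim dim_UNIV span_UNIV subset_UNIV top.extremum_uniqueI dim_eq_full dim_eq_card_independent)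
  then have "q \<in> span (y ` tight u)" by simp
  then obtain r where r: "q = (\<Sum>v\<in>y ` tight u. r v *\<^sub>R v)"
    using finite_tight by (auto simp: span_finite)
  then have "q = (\<Sum>i\<in>tight u. r (y i) *\<^sub>R y i)"
    by (simp add: sum.reindex[OF ind(1)])
  then show ?thesis
    unfolding coef_def
    by (rule someI[where P = "\<lambda>c. q = (\<Sum>i\<in>tight u. c i *\<^sub>R y i)" and x = "\<lambda>i. r (y i)"])
qed

lemma coef_nonzero:
  assumes q: "generic q" and u: "u \<in> D" and c: "card (tight u) = DIM('a)" and i: "i \<in> tight u"
  shows "coef q (tight u) i \<noteq> 0"
proof
  assume z: "coef q (tight u) i = 0"
  have "q = (\<Sum>j\<in>tight u - {i}. coef q (tight u) j *\<^sub>R y j)"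
    using coef_sum[OF u c, of q] sum.remove[OF finite_tight i, of "\<lambda>j. coef q (tight u) j *\<^sub>R y j"] z by simp
  also have "\<dots> \<in> span (y ` (tight u - {i}))"
    by (intro span_sum span_scale span_base) auto
  finally have "q \<in> span (y ` (tight u - {i}))" .
  moreover have "card (tight u - {i}) < DIM('a)"
    using card_Diff1_less[OF finite_tight i] c by simp
  ultimately show False
    using q tight_subset[of u] unfolding generic_def by blast
qed

text \<open>Existence: minimise \<open>q\<close> over the closed face and take an extreme point of
  the set of minimisers. Uniqueness: on this face, the excess of \<open>q\<close> over its value at
  such a vertex is a sum of nonnegative terms, one for each constraint tight at the vertex.\<close>

lemma unique_minimal_vertex:
  assumes q: "generic q" and G: "v \<in> D" "tight v = G"
  shows "\<exists>!T. T \<in> faces DIM('a) \<and> T - down q T \<subseteq> G \<and> G \<subseteq> T"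
proof (rule ex_ex1I)
  define K where "K = {u \<in> D. G \<subseteq> tight u}"
  have vK: "v \<in> K" using G by (simp add: K_def)
  have GI: "G \<subseteq> I" using G(2) tight_subset by blast
  have K_eq: "K = D \<inter> (\<Inter>i\<in>G. {u. y i \<bullet> u = 1})"
    using GI by (auto simp: K_def tight_def)
  have "compact K"
    unfolding K_eq using bdd closed_D
    by (simp add: compact_eq_bounded_closed bounded_Int D_def[symmetric] closed_Int closed_INT closed_hyperplane)
  moreover have "continuous_on K (\<lambda>u. q \<bullet> u)" by (intro continuous_intros)
  ultimately obtain m where m: "m \<in> K" "\<And>u. u \<in> K \<Longrightarrow> q \<bullet> m \<le> q \<bullet> u"
    using continuous_attains_inf[of K "\<lambda>u. q \<bullet> u"] vK by blast
  define M where "M = K \<inter> {u. q \<bullet> u = q \<bullet> m}"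
  have "convex D"
  proof -
    have "D = (\<Inter>i\<in>I. {u. y i \<bullet> u \<le> 1})" by (auto simp: D_def)
    then show ?thesis by (simp add: convex_INT convex_halfspace_le)
  qed
  then have "convex M"
    unfolding M_def K_eq by (intro convex_Int convex_INT convex_hyperplane ballI)
  moreover have "compact M"
    unfolding M_def using \<open>compact K\<close> closed_hyperplane by (rule compact_Int_closed)
  moreover have "M \<noteq> {}" using m(1) by (auto simp: M_def)
  ultimately obtain u where u: "u extreme_point_of M"
    using extreme_point_exists_convex by blast
  then have uM: "u \<in> M" by (simp add: extreme_point_of_def)
  then have uK: "u \<in> K" and uD: "u \<in> D" and Gu: "G \<subseteq> tight u" and qu: "q \<bullet> u = q \<bullet> m"
    by (auto simp: M_def K_def)
  have min: "q \<bullet> u \<le> q \<bullet> (u + e *\<^sub>R w)" if "u + e *\<^sub>R w \<in> K" for e w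
    using m(2)[OF that] qu by simp
  \<comment> \<open>Otherwise some \<open>w\<close> keeps all tight constraints; small moves both
    ways stay in the face, minimality forces \<open>q . w = 0\<close>, and \<open>u\<close> is the
    midpoint of two minimisers.\<close>
  have card: "card (tight u) = DIM('a)"
  proof (rule ccontr)
    assume "card (tight u) \<noteq> DIM('a)"
    then have "card (y ` tight u) < DIM('a)"
      using card_tight_le[OF uD] card_image_le[OF finite_tight, of y u] by linarith
    then have "dim (y ` tight u) < DIM('a)"
      using dim_le_card'[of "y ` tight u"] finite_tight by (simp add: le_less_trans)
    then obtain w where w: "w \<noteq> 0" "\<And>z. z \<in> span (y ` tight u) \<Longrightarrow> orthogonal w z"
      by (rule orthogonal_to_subspace_exists) (rule that)
    then have w0: "y i \<bullet> w = 0" if "i \<in> tight u" for i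
      using w(2)[of "y i"] that by (simp add: span_base orthogonal_def inner_commute)
    have "\<forall>\<^sub>F e in at_right 0. u + e *\<^sub>R w \<in> D \<and> tight (u + e *\<^sub>R w) = {i \<in> tight u. y i \<bullet> w = 0}"
      by (rule perturb_in_D[OF uD]) (simp add: w0)
    moreover have "\<forall>\<^sub>F e in at_right 0. u + e *\<^sub>R (- w) \<in> D \<and> tight (u + e *\<^sub>R (- w)) = {i \<in> tight u. y i \<bullet> (- w) = 0}"
      by (rule perturb_in_D[OF uD]) (simp add: w0)
    moreover have "\<forall>\<^sub>F e in at_right (0::real). e > 0"
      by (rule eventually_at_right_less)
    ultimately have "\<forall>\<^sub>F e in at_right 0. u + e *\<^sub>R w \<in> K \<and> u + e *\<^sub>R (- w) \<in> K \<and> e > 0"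
    proof eventually_elim
      case (elim e)
      then show ?case using Gu w0 by (auto simp: K_def)
    qed
    then obtain e where e: "u + e *\<^sub>R w \<in> K" "u + e *\<^sub>R (- w) \<in> K" "e > 0"
      using eventually_happens' trivial_limit_at_right_real by blast
    have "q \<bullet> w = 0"
      using min[OF e(1)] min[OF e(2)] e(3) by (simp add: inner_add_right inner_diff_right mult_le_0_iff zero_le_mult_iff)
    then have "u + e *\<^sub>R w \<in> M" "u + e *\<^sub>R (- w) \<in> M"
      using e qu by (auto simp: M_def inner_add_right inner_diff_right)
    moreover have "u \<in> open_segment (u + e *\<^sub>R w) (u + e *\<^sub>R (- w))"
      unfolding in_segment using e(3) w(1)
      by (intro conjI exI[of _ "1/2"]) (auto simp: algebra_simps scaleR_add_left[symmetric])
    ultimately show False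
      using u by (auto simp: extreme_point_of_def)
  qed
  \<comment> \<open>Along the edge that releases \<open>i\<close>, \<open>q\<close> changes at the
    rate of minus the coefficient, which minimality makes nonnegative.\<close>
  have "coef q (tight u) i < 0" if i: "i \<in> tight u" "i \<notin> G" for i
  proof -
    obtain w where w: "\<And>j. j \<in> tight u \<Longrightarrow> y j \<bullet> w = (if j = i then -1 else 0)"
      using exists_prescribed_inner[of "tight u" "\<lambda>j. if j = i then -1 else 0"] tight_indep[OF uD] by blast
    have "\<forall>\<^sub>F e in at_right 0. u + e *\<^sub>R w \<in> D \<and> tight (u + e *\<^sub>R w) = {i \<in> tight u. y i \<bullet> w = 0}"
      by (rule perturb_in_D[OF uD]) (simp add: w)
    moreover have "\<forall>\<^sub>F e in at_right (0::real). e > 0"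
      by (rule eventually_at_right_less)
    ultimately have "\<forall>\<^sub>F e in at_right 0. u + e *\<^sub>R w \<in> K \<and> e > 0"
    proof eventually_elim
      case (elim e)
      have "j \<in> {i \<in> tight u. y i \<bullet> w = 0}" if "j \<in> G" for j
        using that Gu i(2) w[of j] by auto
      then show ?case using elim by (auto simp: K_def)
    qed
    then obtain e where e: "u + e *\<^sub>R w \<in> K" "e > 0"
      using eventually_happens' trivial_limit_at_right_real by blast
    have "0 \<le> q \<bullet> w"
      using min[OF e(1)] e(2) by (simp add: inner_add_right zero_le_mult_iff)
    also have "q \<bullet> w = (\<Sum>j\<in>tight u. coef q (tight u) j * (y j \<bullet> w))"
      by (subst coef_sum[OF uD card, of q]) (simp add: inner_sum_left)
    also have "\<dots> = (\<Sum>j\<in>tight u. if j = i then - coef q (tight u) j else 0)"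
      by (intro sum.cong) (auto simp: w)
    also have "\<dots> = - coef q (tight u) i"
      using i(1) finite_tight by simp
    finally show ?thesis
      using coef_nonzero[OF q uD card i(1)] by simp
  qed
  then show "\<exists>T. T \<in> faces DIM('a) \<and> T - down q T \<subseteq> G \<and> G \<subseteq> T"
    using Gu uD card by (intro exI[of _ "tight u"]) (auto simp: faces_def down_def)
next
  have le: "q \<bullet> u \<le> q \<bullet> u' \<and> (q \<bullet> u = q \<bullet> u' \<longrightarrow> tight u \<subseteq> tight u')"
    if u: "u \<in> D" "card (tight u) = DIM('a)" "tight u - down q (tight u) \<subseteq> G"
      and u': "u' \<in> D" "G \<subseteq> tight u'" for u u'
  proof -
    let ?c = "coef q (tight u)"
    have "q \<bullet> u' - q \<bullet> u = q \<bullet> (u' - u)" by (simp add: inner_diff_right)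
    also have "\<dots> = (\<Sum>i\<in>tight u. ?c i * (y i \<bullet> (u' - u)))"
      by (subst coef_sum[OF u(1,2), of q]) (simp add: inner_sum_left)
    also have "\<dots> = (\<Sum>i\<in>tight u. ?c i * (y i \<bullet> u' - 1))"
      by (rule sum.cong) (simp_all add: tight_def inner_diff_right)
    finally have eq: "q \<bullet> u' - q \<bullet> u = (\<Sum>i\<in>tight u. ?c i * (y i \<bullet> u' - 1))" .
    \<comment> \<open>On \<open>G\<close> the second factor vanishes; elsewhere both factors are
      nonpositive.\<close>
    have nonneg: "0 \<le> ?c i * (y i \<bullet> u' - 1)" if i: "i \<in> tight u" for i
    proof (cases "i \<in> G")
      case True
      then have "y i \<bullet> u' = 1" using u'(2) by (auto simp: tight_def)
      then show ?thesis by simp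
    next
      case False
      then have "?c i < 0" using u(3) i by (auto simp: down_def)
      moreover have "y i \<bullet> u' \<le> 1" using u'(1) i tight_subset by (auto simp: D_def)
      ultimately show ?thesis by (simp add: zero_le_mult_iff)
    qed
    have "tight u \<subseteq> tight u'" if "q \<bullet> u = q \<bullet> u'"
    proof
      fix i assume i: "i \<in> tight u"
      have "(\<Sum>i\<in>tight u. ?c i * (y i \<bullet> u' - 1)) = 0" using eq that by simp
      then have "\<forall>i\<in>tight u. ?c i * (y i \<bullet> u' - 1) = 0"
        by (subst (asm) sum_nonneg_eq_0_iff) (auto intro: nonneg finite_tight)
      then have "?c i * (y i \<bullet> u' - 1) = 0" using i by blast
      then have "y i \<bullet> u' = 1" using coef_nonzero[OF q u(1,2) i] by simp
      then show "i \<in> tight u'" using i tight_subset by (auto simp: tight_def)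
    qed
    moreover have "0 \<le> q \<bullet> u' - q \<bullet> u"
      unfolding eq by (intro sum_nonneg nonneg)
    ultimately show ?thesis by simp
  qed
  fix T T'
  assume T: "T \<in> faces DIM('a) \<and> T - down q T \<subseteq> G \<and> G \<subseteq> T"
    and T': "T' \<in> faces DIM('a) \<and> T' - down q T' \<subseteq> G \<and> G \<subseteq> T'"
  obtain u where u: "u \<in> D" "tight u = T" "card T = DIM('a)" using T by (auto simp: faces_def)
  obtain u' where u': "u' \<in> D" "tight u' = T'" "card T' = DIM('a)" using T' by (auto simp: faces_def)
  show "T = T'"
    using le[of u u'] le[of u' u] u u' T T' by force
qed

text \<open>Each face is counted at its lowest vertex; there the faces with \<open>s\<close>
  constraints arise by releasing any \<open>DIM('a) - s\<close> constraints of
  \<open>down q T\<close>.\<close>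

lemma card_faces_eq_sum:
  assumes q: "generic q" and s: "s \<le> DIM('a)"
  shows "card (faces s) = (\<Sum>T\<in>faces DIM('a). card (down q T) choose (DIM('a) - s))"
proof -
  let ?d = "DIM('a)"
  have fT: "finite T" and cT: "card T = ?d" if "T \<in> faces ?d" for T
    using that finite_tight by (auto simp: faces_def)
  have sub: "down q T \<subseteq> T" for T by (auto simp: down_def)
  let ?A = "\<lambda>T. {G. T - down q T \<subseteq> G \<and> G \<subseteq> T \<and> card G = s}"
  have "faces s = (\<Union>T\<in>faces ?d. ?A T)"
  proof (intro equalityI subsetI)
    fix G assume "G \<in> faces s"
    then obtain v where "v \<in> D" "tight v = G" "card G = s" by (auto simp: faces_def)
    then show "G \<in> (\<Union>T\<in>faces ?d. ?A T)"
      using unique_minimal_vertex[OF q, of v G] by auto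
  next
    fix G assume "G \<in> (\<Union>T\<in>faces ?d. ?A T)"
    then obtain T where T: "T \<in> faces ?d" "G \<subseteq> T" "card G = s" by blast
    then obtain u where "u \<in> D" "tight u = T" by (auto simp: faces_def)
    then show "G \<in> faces s"
      using face_subset[of u G] T by (auto simp: faces_def)
  qed
  moreover have "?A T \<inter> ?A T' = {}" if TT: "T \<in> faces ?d" "T' \<in> faces ?d" "T \<noteq> T'" for T T'
  proof (rule ccontr)
    assume "?A T \<inter> ?A T' \<noteq> {}"
    then obtain G where G: "T - down q T \<subseteq> G" "G \<subseteq> T" "T' - down q T' \<subseteq> G" "G \<subseteq> T'" by blast
    obtain u where u: "u \<in> D" "tight u = T" using TT(1) by (auto simp: faces_def)
    obtain v where v: "v \<in> D" "tight v = G" using face_subset[of u G] u G by auto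
    show False
      using unique_minimal_vertex[OF q v] TT G by blast
  qed
  moreover have "finite (?A T)" if "T \<in> faces ?d" for T
    using fT[OF that] by (intro finite_subset[of "?A T" "Pow T"]) auto
  ultimately have "card (faces s) = (\<Sum>T\<in>faces ?d. card (?A T))"
    using finite_faces by (simp add: card_UN_disjoint)
  also have "\<dots> = (\<Sum>T\<in>faces ?d. card (down q T) choose (?d - s))"
  proof (rule sum.cong[OF refl])
    fix T assume T: "T \<in> faces ?d"
    have fin_down: "finite (down q T)" using finite_subset[OF sub fT[OF T]] .
    have "bij_betw (\<lambda>G. T - G) (?A T) {H. H \<subseteq> down q T \<and> card H = ?d - s}"
    proof (rule bij_betw_byWitness[where f' = "\<lambda>H. T - H"])
      show "\<forall>G\<in>?A T. T - (T - G) = G" by auto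
      show "\<forall>H\<in>{H. H \<subseteq> down q T \<and> card H = ?d - s}. T - (T - H) = H" using sub[of T] by auto
      show "(\<lambda>G. T - G) ` ?A T \<subseteq> {H. H \<subseteq> down q T \<and> card H = ?d - s}"
        using fT[OF T] cT[OF T] by (auto simp: card_Diff_subset finite_subset)
      show "(\<lambda>H. T - H) ` {H. H \<subseteq> down q T \<and> card H = ?d - s} \<subseteq> ?A T"
      proof clarify
        fix H assume H: "H \<subseteq> down q T" "card H = ?d - s"
        have "card (T - H) = s"
          using H s cT[OF T] sub[of T] finite_subset[OF H(1) fin_down]
          by (subst card_Diff_subset) auto
        then show "T - down q T \<subseteq> T - H \<and> T - H \<subseteq> T \<and> card (T - H) = s" using H by auto
      qed
    qed
    then have "card (?A T) = card {H. H \<subseteq> down q T \<and> card H = ?d - s}"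
      by (rule bij_betw_same_card)
    then show "card (?A T) = card (down q T) choose (?d - s)"
      by (simp add: n_subsets[OF fin_down])
  qed
  finally show ?thesis .
qed

text \<open>At a vertex the chosen coefficient is the product with the dual vector \<open>w\<close>
  of \<open>y i\<close>, hence linear in the functional.\<close>

lemma coef_uminus:
  assumes u: "u \<in> D" "card (tight u) = DIM('a)" and i: "i \<in> tight u"
  shows "coef (- q) (tight u) i = - coef q (tight u) i"
proof -
  obtain w where w: "\<And>j. j \<in> tight u \<Longrightarrow> y j \<bullet> w = (if j = i then 1 else 0)"
    using exists_prescribed_inner[of "tight u" "\<lambda>j. if j = i then 1 else 0"] tight_indep[OF u(1)] by blast
  have "coef r (tight u) i = r \<bullet> w" for r
  proof -
    have "r \<bullet> w = (\<Sum>j\<in>tight u. coef r (tight u) j * (y j \<bullet> w))"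
      by (subst coef_sum[OF u, of r]) (simp add: inner_sum_left)
    also have "\<dots> = (\<Sum>j\<in>tight u. if j = i then coef r (tight u) j else 0)"
      by (intro sum.cong) (auto simp: w)
    finally show ?thesis using i finite_tight by simp
  qed
  then show ?thesis by simp
qed

lemma down_uminus:
  assumes q: "generic q" and T: "T \<in> faces DIM('a)"
  shows "card (down (- q) T) = DIM('a) - card (down q T)"
proof -
  obtain u where u: "u \<in> D" "tight u = T" "card T = DIM('a)" using T by (auto simp: faces_def)
  have "down (- q) T = T - down q T"
    using coef_uminus[of u _ q] coef_nonzero[OF q, of u] u by (force simp: down_def)
  then show ?thesis
    using u finite_tight[of u] by (simp add: card_Diff_subset down_def)
qed

text \<open>The Dehn--Sommerville relations: both expressions count each face at its lowest vertex, once for a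
  generic direction and once for the opposite one.\<close>

lemma h_vector_exists:
  obtains h :: "nat \<Rightarrow> nat" where
    "\<And>s. s \<le> DIM('a) \<Longrightarrow> card (faces s) = (\<Sum>i\<le>DIM('a). h i * (i choose (DIM('a) - s)))"
    "\<And>s. s \<le> DIM('a) \<Longrightarrow> card (faces s) = (\<Sum>i\<le>DIM('a). h i * ((DIM('a) - i) choose (DIM('a) - s)))"
proof -
  let ?d = "DIM('a)"
  obtain q where q: "generic q" using generic_exists by blast
  \<comment> \<open>The number of vertices with exactly \<open>i\<close> ascending edges.\<close>
  define h where "h i = card {T \<in> faces ?d. card (down q T) = i}" for i
  have le: "card (down q T) \<le> ?d" if T: "T \<in> faces ?d" for T
  proof -
    obtain u where "tight u = T" "card T = ?d" using T by (auto simp: faces_def)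
    then show ?thesis using card_mono[of T "down q T"] finite_tight[of u] by (auto simp: down_def)
  qed
  have group: "(\<Sum>T\<in>faces ?d. f (card (down q T))) = (\<Sum>i\<le>?d. h i * f i)" for f :: "nat \<Rightarrow> nat"
  proof -
    have "(\<Sum>T\<in>faces ?d. f (card (down q T))) =
        (\<Sum>i\<le>?d. \<Sum>T\<in>{T \<in> faces ?d. card (down q T) = i}. f (card (down q T)))"
      using le finite_faces by (intro sum.group[symmetric]) auto
    also have "\<dots> = (\<Sum>i\<le>?d. h i * f i)"
      by (intro sum.cong) (auto simp: h_def)
    finally show ?thesis .
  qed
  show thesis
  proof
    fix s assume s: "s \<le> ?d"
    show "card (faces s) = (\<Sum>i\<le>?d. h i * (i choose (?d - s)))"
      unfolding card_faces_eq_sum[OF q s] by (rule group)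
    have "card (faces s) = (\<Sum>T\<in>faces ?d. (?d - card (down q T)) choose (?d - s))"
      unfolding card_faces_eq_sum[OF generic_uminus[OF q] s]
      by (intro sum.cong) (simp_all add: down_uminus[OF q])
    also have "\<dots> = (\<Sum>i\<le>?d. h i * ((?d - i) choose (?d - s)))"
      by (rule group)
    finally show "card (faces s) = (\<Sum>i\<le>?d. h i * ((?d - i) choose (?d - s)))" .
  qed
qed

end

section \<open>Dehn--Sommerville relations for simplicial hulls\<close>

text \<open>Any at most \<open>DIM('a) + 1\<close> of the points are affinely independent, expressed
  through the complementary dimension of their tie space.\<close>

definition general_position :: "'i set \<Rightarrow> ('i \<Rightarrow> 'a::euclidean_space) \<Rightarrow> bool"
  where "general_position I x \<longleftrightarrow>
    (\<forall>J. J \<subseteq> I \<longrightarrow> J \<noteq> {} \<longrightarrow> card J \<le> Suc (DIM('a)) \<longrightarrow> dim (tie_space x J) = Suc (DIM('a)) - card J)"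

lemma hull_face_subset: "hull_face I x J \<Longrightarrow> J \<subseteq> I"
  unfolding hull_face_def by (elim conjE)

lemma tie_space_antimono: "J \<subseteq> K \<Longrightarrow> tie_space x K \<subseteq> tie_space x J"
  unfolding tie_space_def by blast

lemma general_position_tie_space_zero:
  fixes x :: "'i \<Rightarrow> 'a::euclidean_space"
  assumes gp: "general_position I x" and J: "J \<subseteq> I" "finite J" "Suc (DIM('a)) \<le> card J"
  shows "tie_space x J = {0}"
proof -
  obtain K where K: "K \<subseteq> J" "card K = Suc (DIM('a))"
    using obtain_subset_with_card_n[OF J(3)] by blast
  then have "K \<noteq> {}" by auto
  then have "dim (tie_space x K) = 0"
    using gp K J(1) unfolding general_position_def by (metis order_refl diff_self_eq_0 subset_trans)
  then have "tie_space x K \<subseteq> {0}" by simp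
  moreover have "0 \<in> tie_space x J" by (rule subspace_0[OF subspace_tie_space])
  ultimately show ?thesis using tie_space_antimono[OF K(1), of x] by blast
qed

locale point_configuration =
  fixes I :: "'i set" and x :: "'i \<Rightarrow> 'a::euclidean_space"
  assumes fin: "finite I" and card_I: "Suc (DIM('a)) \<le> card I" and gp: "general_position I x"
begin

text \<open>With the centroid moved to the origin the vectors \<open>y i\<close> sum to zero, which
  is what bounds the polar body.\<close>

definition centre where "centre = (\<Sum>i\<in>I. x i) /\<^sub>R real (card I)"
definition y where "y i = x i - centre"

lemma card_pos: "card I > 0" using card_I by simp

lemma diff_y: "(x j - x i) \<bullet> u = y j \<bullet> u - y i \<bullet> u"
  by (simp add: y_def inner_diff_left)

lemma sum_y: "(\<Sum>i\<in>I. y i \<bullet> u) = 0"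
  using card_pos by (simp add: y_def centre_def inner_diff_left sum_subtractf inner_sum_left)

lemma tie_space_I: "tie_space x I = {0}"
  by (rule general_position_tie_space_zero[OF gp order_refl fin card_I])

text \<open>A vector orthogonal to all \<open>y i\<close> ties all points, and in general position
  only 0 does.\<close>

lemma span_y: "span (y ` I) = UNIV"
proof (rule ccontr)
  assume "span (y ` I) \<noteq> UNIV"
  then have "dim (y ` I) < DIM('a)"
    by (metis dim_eq_full dim_subset_UNIV le_neq_implies_less)
  then obtain w where w: "w \<noteq> 0" "\<And>z. z \<in> span (y ` I) \<Longrightarrow> orthogonal w z"
    by (rule orthogonal_to_subspace_exists) (rule that)
  have "y i \<bullet> w = 0" if "i \<in> I" for i
    using w(2)[of "y i"] that by (simp add: span_base orthogonal_def inner_commute)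
  then have "w \<in> tie_space x I"
    unfolding tie_space_def by (simp add: diff_y)
  then show False using w(1) tie_space_I by simp
qed

text \<open>Since the products with the \<open>y i\<close> sum to zero, their upper bounds also
  yield lower bounds; as the \<open>y i\<close> span the space, every coordinate of \<open>u\<close>
  is bounded.\<close>

lemma bounded_polar: "bounded {u. \<forall>i\<in>I. y i \<bullet> u \<le> 1}"
proof -
  let ?m = "real (card I)"
  have abs_le: "\<bar>y i \<bullet> u\<bar> \<le> ?m" if u: "\<forall>i\<in>I. y i \<bullet> u \<le> 1" and i: "i \<in> I" for u i
  proof -
    have "0 = y i \<bullet> u + (\<Sum>j\<in>I - {i}. y j \<bullet> u)"
      using sum_y[of u] sum.remove[OF fin i, of "\<lambda>j. y j \<bullet> u"] by simp
    moreover have "(\<Sum>j\<in>I - {i}. y j \<bullet> u) \<le> (\<Sum>j\<in>I - {i}. 1)"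
      by (intro sum_mono) (use u in auto)
    moreover have "(\<Sum>j\<in>I - {i}. 1::real) = ?m - 1"
      using i fin card_pos by (simp add: card_Diff_singleton of_nat_diff)
    moreover have "y i \<bullet> u \<le> 1" using u i by blast
    moreover have "1 \<le> ?m" using card_pos by simp
    ultimately show ?thesis by linarith
  qed
  have "\<exists>B. \<forall>u. (\<forall>i\<in>I. y i \<bullet> u \<le> 1) \<longrightarrow> \<bar>u \<bullet> b\<bar> \<le> B" for b
  proof -
    have "b \<in> span (y ` I)" using span_y by simp
    then obtain r where r: "b = (\<Sum>v\<in>y ` I. r v *\<^sub>R v)"
      using fin by (auto simp: span_finite)
    have "\<bar>u \<bullet> b\<bar> \<le> (\<Sum>v\<in>y ` I. \<bar>r v\<bar> * ?m)" if u: "\<forall>i\<in>I. y i \<bullet> u \<le> 1" for u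
    proof -
      have "\<bar>u \<bullet> b\<bar> = \<bar>\<Sum>v\<in>y ` I. r v * (v \<bullet> u)\<bar>"
        unfolding r by (simp add: inner_sum_right inner_commute)
      also have "\<dots> \<le> (\<Sum>v\<in>y ` I. \<bar>r v * (v \<bullet> u)\<bar>)" by (rule sum_abs)
      also have "\<dots> \<le> (\<Sum>v\<in>y ` I. \<bar>r v\<bar> * ?m)"
      proof (rule sum_mono)
        fix v assume "v \<in> y ` I"
        then have "\<bar>v \<bullet> u\<bar> \<le> ?m" using abs_le[OF u] by auto
        then show "\<bar>r v * (v \<bullet> u)\<bar> \<le> \<bar>r v\<bar> * ?m"
          by (simp add: abs_mult mult_left_mono)
      qed
      finally show ?thesis .
    qed
    then show ?thesis by blast
  qed
  then obtain B where B: "\<And>b u. \<forall>i\<in>I. y i \<bullet> u \<le> 1 \<Longrightarrow> \<bar>u \<bullet> b\<bar> \<le> B b"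
    by metis
  show ?thesis
    unfolding bounded_iff
  proof (intro exI[of _ "\<Sum>b\<in>Basis. B b"] ballI)
    fix u assume "u \<in> {u. \<forall>i\<in>I. y i \<bullet> u \<le> 1}"
    then have u: "\<forall>i\<in>I. y i \<bullet> u \<le> 1" by simp
    have "norm u \<le> (\<Sum>b\<in>Basis. \<bar>u \<bullet> b\<bar>)" by (rule norm_le_l1)
    also have "\<dots> \<le> (\<Sum>b\<in>Basis. B b)" by (intro sum_mono B[OF u])
    finally show "norm u \<le> (\<Sum>b\<in>Basis. B b)" .
  qed
qed

text \<open>\<open>u\<close> ties the tight points but is not orthogonal to them, so the orthogonal
  complement \<open>W\<close> of their span is strictly smaller than the tie space. General position
  then makes the span at least \<open>card T\<close>-dimensional.\<close>

lemma tight_independent: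
  fixes u :: 'a
  defines "T \<equiv> {i \<in> I. y i \<bullet> u = 1}"
  shows "inj_on y T \<and> independent (y ` T)"
proof (cases "T = {}")
  case True
  then show ?thesis by (simp add: independent_empty)
next
  case False
  have T: "T \<subseteq> I" "finite T" using fin by (auto simp: T_def)
  have one: "y i \<bullet> u = 1" if "i \<in> T" for i using that by (simp add: T_def)
  have u: "u \<in> tie_space x T"
    unfolding tie_space_def by (simp add: diff_y one)
  have "u \<noteq> 0" using False one by force
  then have "\<not> Suc (DIM('a)) \<le> card T"
    using general_position_tie_space_zero[OF gp T] u by auto
  then have dimT: "dim (tie_space x T) = Suc (DIM('a)) - card T" and le: "card T \<le> DIM('a)"
    using gp T(1) False unfolding general_position_def by auto
  define W where "W = {w \<in> UNIV. \<forall>v\<in>span (y ` T). orthogonal v w}"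
  have sW: "subspace W"
    unfolding W_def by (auto simp: subspace_def orthogonal_clauses orthogonal_def inner_add_right)
  have W0: "y i \<bullet> w = 0" if "w \<in> W" "i \<in> T" for i w
    using that span_base[of "y i" "y ` T"] unfolding W_def orthogonal_def by blast
  have "W \<subseteq> tie_space x T"
    unfolding tie_space_def by (auto simp: diff_y W0)
  moreover have "u \<notin> W"
    using False one W0[of u] by fastforce
  ultimately have "W \<subset> tie_space x T" using u by blast
  moreover have "span W = W" "span (tie_space x T) = tie_space x T"
    using sW subspace_tie_space[of x T] by simp_all
  ultimately have "span W \<subset> span (tie_space x T)" by metis
  then have "dim W < dim (tie_space x T)"
    by (rule dim_psubset)
  moreover have "dim W + dim (span (y ` T)) = DIM('a)"
    using dim_subspace_orthogonal_to_vectors[of "span (y ` T)" "UNIV :: 'a set"] unfolding W_def by simp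
  ultimately have cd: "card T \<le> dim (span (y ` T))"
    using dimT le by linarith
  have "dim (span (y ` T)) \<le> card (y ` T)"
    unfolding dim_span using T(2) by (intro dim_le_card') auto
  then have c: "card (y ` T) = card T"
    using cd card_image_le[OF T(2), of y] by linarith
  then have "inj_on y T" using T(2) by (simp add: eq_card_imp_inj_on)
  moreover have "independent (y ` T)"
    using card_le_dim_spanning[of "y ` T" "span (y ` T)"] T(2) cd c by (simp add: span_superset)
  ultimately show ?thesis by blast
qed

sublocale polar: simple_polyhedron I y
  by unfold_locales (rule fin bounded_polar tight_independent)+

text \<open>Polarity: if a functional is maximal exactly on \<open>G\<close>, with value
  \<open>t\<close> there, then \<open>t > 0\<close>, since the values at all \<open>y j\<close> sum
  to zero and \<open>G\<close> is not all of \<open>I\<close>. Dividing by \<open>t\<close> gives a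
  point of the polar body with tight set \<open>G\<close>.\<close>

lemma faces_eq_hull_faces:
  assumes s: "1 \<le> s" "s \<le> DIM('a)"
  shows "polar.faces s = {G. hull_face I x G \<and> card G = s}"
proof (intro set_eqI iffI)
  fix G assume "G \<in> polar.faces s"
  then obtain u where u: "u \<in> polar.D" "polar.tight u = G" "card G = s"
    by (auto simp: polar.faces_def)
  have "G \<noteq> {}" using u(3) s by auto
  then obtain i where i: "i \<in> G" by blast
  have G1: "y j \<bullet> u = 1" if "j \<in> G" for j
    using that u(2) by (auto simp: polar.tight_def)
  have G2: "y j \<bullet> u < 1" if "j \<in> I - G" for j
    using that u(1,2) by (force simp: polar.tight_def polar.D_def)
  have "hull_face I x G"
    unfolding hull_face_iff[OF i]
  proof (intro conjI exI[of _ u] ballI)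
    show "G \<subseteq> I" using polar.tight_subset u(2) by blast
  qed (simp_all add: diff_y G1 G2 i)
  then show "G \<in> {G. hull_face I x G \<and> card G = s}" using u(3) by simp
next
  fix G assume "G \<in> {G. hull_face I x G \<and> card G = s}"
  then have G: "hull_face I x G" "card G = s" by auto
  then have "G \<noteq> {}" using s by auto
  then obtain i where i: "i \<in> G" by blast
  obtain z where z: "G \<subseteq> I" "\<forall>j\<in>G. (x j - x i) \<bullet> z = 0" "\<forall>j\<in>I - G. (x j - x i) \<bullet> z < 0"
    using G(1) unfolding hull_face_iff[OF i] by (elim conjE exE)
  define t where "t = y i \<bullet> z"
  have yG: "y j \<bullet> z = t" if "j \<in> G" for j
    using z(2) that by (simp add: diff_y t_def)
  have yI: "y j \<bullet> z < t" if "j \<in> I - G" for j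
    using z(3) that by (simp add: diff_y t_def)
  have "G \<noteq> I" using G(2) s card_I by auto
  then obtain k where k: "k \<in> I - G" using z(1) by blast
  have "(\<Sum>j\<in>I. y j \<bullet> z) < (\<Sum>j\<in>I. t)"
  proof (rule sum_strict_mono_ex1[OF fin])
    show "\<forall>j\<in>I. y j \<bullet> z \<le> t"
    proof
      fix j assume "j \<in> I"
      then show "y j \<bullet> z \<le> t" using yG[of j] yI[of j] by (cases "j \<in> G") auto
    qed
    show "\<exists>j\<in>I. y j \<bullet> z < t" using k yI by blast
  qed
  then have t: "t > 0" using card_pos by (simp add: sum_y zero_less_mult_iff)
  define u where "u = z /\<^sub>R t"
  have yu: "y j \<bullet> u = (y j \<bullet> z) / t" for j
    by (simp add: u_def divide_inverse mult.commute)
  have "y j \<bullet> u \<le> 1 \<and> (y j \<bullet> u = 1 \<longleftrightarrow> j \<in> G)" if "j \<in> I" for j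
    using that yG[of j] yI[of j] t by (cases "j \<in> G") (auto simp: yu)
  then have "u \<in> polar.D" "polar.tight u = G"
    using z(1) by (auto simp: polar.D_def polar.tight_def)
  then show "G \<in> polar.faces s" using G(2) by (auto simp: polar.faces_def)
qed

lemma card_faces_0: "card (polar.faces 0) = 1"
proof -
  have "polar.faces 0 = {{}}"
  proof (intro set_eqI iffI)
    fix G assume "G \<in> polar.faces 0"
    then obtain u where "polar.tight u = G" "card G = 0" by (auto simp: polar.faces_def)
    then show "G \<in> {{}}" using polar.finite_tight by auto
  next
    fix G :: "'i set" assume "G \<in> {{}}"
    then have "G = {}" by simp
    moreover have "0 \<in> polar.D" "polar.tight 0 = {}" by (simp_all add: polar.D_def polar.tight_def)
    ultimately show "G \<in> polar.faces 0" by (auto simp: polar.faces_def)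
  qed
  then show ?thesis by simp
qed

definition face_count where "face_count s = card {G. hull_face I x G \<and> card G = s}"

lemma finite_hull_faces: "finite {G. hull_face I x G \<and> P G}"
proof (rule finite_subset)
  show "{G. hull_face I x G \<and> P G} \<subseteq> Pow I" using hull_face_subset by blast
qed (use fin in simp)

text \<open>The dimension is \<open>Suc (DIM('a)) - card J\<close>, truncated at 0; in the truncated
  case both sides fail.\<close>

lemma hull_face_dim_iff:
  assumes J: "hull_face I x J" "i \<in> J" and k: "k < DIM('a)"
  shows "dim (tie_space x J) = Suc k \<longleftrightarrow> card J = DIM('a) - k"
proof -
  have JI: "J \<subseteq> I" "finite J" "J \<noteq> {}"
    using hull_face_subset[OF J(1)] J(2) finite_subset[OF hull_face_subset[OF J(1)] fin] by auto
  show ?thesis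
  proof (cases "Suc (DIM('a)) \<le> card J")
    case True
    then show ?thesis using general_position_tie_space_zero[OF gp JI(1,2)] k by simp
  next
    case False
    then have "dim (tie_space x J) = Suc (DIM('a)) - card J"
      using gp JI unfolding general_position_def by simp
    then show ?thesis using False k by auto
  qed
qed

text \<open>The dimension condition fixes the number of vertices as \<open>DIM('a) - k\<close>; the
  rest is double counting of incidences between points and hull faces.\<close>

lemma sum_card_hull_faces:
  assumes k: "k < DIM('a)"
  shows "(\<Sum>i\<in>I. card {J. i \<in> J \<and> hull_face I x J \<and> dim (tie_space x J) = Suc k}) =
    (DIM('a) - k) * face_count (DIM('a) - k)"
proof -
  let ?F = "{J. hull_face I x J \<and> card J = DIM('a) - k}"
  have "(\<Sum>i\<in>I. card {J. i \<in> J \<and> hull_face I x J \<and> dim (tie_space x J) = Suc k}) =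
      (\<Sum>i\<in>I. card {J \<in> ?F. i \<in> J})"
    by (intro sum.cong refl arg_cong[where f = card]) (use hull_face_dim_iff k in blast)
  also have "\<dots> = (\<Sum>i\<in>I. \<Sum>J\<in>?F. if i \<in> J then 1 else 0)"
    by (intro sum.cong refl) (simp add: finite_hull_faces sum.If_cases Int_def)
  also have "\<dots> = (\<Sum>J\<in>?F. \<Sum>i\<in>I. if i \<in> J then 1 else 0)"
    by (rule sum.swap)
  also have "\<dots> = (\<Sum>J\<in>?F. DIM('a) - k)"
  proof (intro sum.cong refl)
    fix J assume "J \<in> ?F"
    then have "J \<subseteq> I" "card J = DIM('a) - k" using hull_face_subset by auto
    moreover from this have "I \<inter> {i. i \<in> J} = J" by auto
    ultimately show "(\<Sum>i\<in>I. if i \<in> J then 1 else 0) = DIM('a) - k"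
      using fin by (simp add: sum.If_cases)
  qed
  finally show ?thesis by (simp add: face_count_def mult.commute)
qed

text \<open>On the sphere \<open>x i\<close> is itself a functional that singles out the point
  \<open>i\<close>, because \<open>2 * ((x j - x i) . x i) = - norm (x j - x i) ^ 2\<close>.\<close>

lemma face_count_1:
  assumes unit: "\<And>i. i \<in> I \<Longrightarrow> norm (x i) = 1"
  shows "face_count 1 = card I"
proof -
  have "hull_face I x {i}" if i: "i \<in> I" for i
    unfolding hull_face_iff[OF singletonI]
  proof (intro conjI exI[of _ "x i"] ballI)
    fix j assume j: "j \<in> I - {i}"
    have "x j \<noteq> x i"
    proof
      assume "x j = x i"
      \<comment> \<open>The tie space of two equal points is one dimension too large for general
        position.\<close>
      then have "tie_space x {i, j} = UNIV" unfolding tie_space_def by auto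
      moreover have "dim (tie_space x {i, j}) = Suc (DIM('a)) - card {i, j}"
        using gp i j unfolding general_position_def by (auto simp: DIM_positive Suc_le_eq)
      moreover have "card {i, j} = 2" using j by (auto simp: card_insert_if)
      ultimately show False using DIM_positive[where 'a='a] by simp
    qed
    then have "0 < (norm (x j - x i))\<^sup>2" by simp
    also have "(norm (x j - x i))\<^sup>2 = - 2 * ((x j - x i) \<bullet> x i)"
      using unit[of j] unit[of i] i j
      by (simp add: power2_norm_eq_inner norm_eq_1 inner_diff_left inner_diff_right inner_commute)
    finally show "(x j - x i) \<bullet> x i < 0" by simp
  qed (use i in auto)
  then have "{G. hull_face I x G \<and> card G = 1} = (\<lambda>i. {i}) ` I"
    using hull_face_subset by (fastforce simp: card_1_singleton_iff)
  then show ?thesis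
    by (simp add: face_count_def card_image)
qed

end

text \<open>The two expansions give \<open>h 0 = h 5 = 1\<close>, \<open>h 1 = h 4\<close> and
  \<open>h 2 = h 3\<close>, so all counts are affine in \<open>h 1\<close> and \<open>h 2\<close>.
  The first relation reflects that each ridge lies in exactly two facets.\<close>

lemma dehn_sommerville_dim5:
  fixes x :: "'i \<Rightarrow> real ^ 5"
  assumes "point_configuration I x" and unit: "\<And>i. i \<in> I \<Longrightarrow> norm (x i) = 1"
  shows "2 * point_configuration.face_count I x 4 = 5 * point_configuration.face_count I x 5"
    and "3 * point_configuration.face_count I x 3 =
      2 * point_configuration.face_count I x 2 + 5 * point_configuration.face_count I x 5"
    and "2 * point_configuration.face_count I x 2 + 12 = 6 * card I + point_configuration.face_count I x 5"
proof -
  interpret point_configuration I x by fact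
  obtain h :: "nat \<Rightarrow> nat" where
    h: "\<And>s. s \<le> 5 \<Longrightarrow> card (polar.faces s) = (\<Sum>i\<le>5. h i * (i choose (5 - s)))"
       "\<And>s. s \<le> 5 \<Longrightarrow> card (polar.faces s) = (\<Sum>i\<le>5. h i * ((5 - i) choose (5 - s)))"
    using polar.h_vector_exists by (auto simp: DIM_cart)
  have F: "card (polar.faces s) = face_count s" if "1 \<le> s" "s \<le> 5" for s
    using faces_eq_hull_faces[of s] that by (simp add: face_count_def)
  have S: "(\<Sum>i\<le>5. f i) = f 0 + f 1 + f 2 + f 3 + f 4 + f (5::nat)" for f :: "nat \<Rightarrow> nat"
    by (simp add: eval_nat_numeral)
  have b: "5 choose 2 = (10::nat)" "5 choose 3 = (10::nat)" "5 choose 4 = (5::nat)" "4 choose 2 = (6::nat)"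
    "4 choose 3 = (4::nat)" "3 choose 2 = (3::nat)" "2 choose 3 = (0::nat)" "3 choose 4 = (0::nat)"
    "2 choose 4 = (0::nat)" "2 choose 5 = (0::nat)" "3 choose 5 = (0::nat)" "4 choose 5 = (0::nat)"
    "Suc 0 choose 2 = (0::nat)" "Suc 0 choose 3 = (0::nat)" "Suc 0 choose 4 = (0::nat)" "Suc 0 choose 5 = (0::nat)"
    "0 choose 2 = (0::nat)" "0 choose 3 = (0::nat)" "0 choose 4 = (0::nat)" "0 choose 5 = (0::nat)"
    by (simp_all add: eval_nat_numeral)
  have "h 5 = 1" using h(1)[of 0] by (simp add: S b card_faces_0)
  moreover have "h 0 = 1" using h(2)[of 0] by (simp add: S b card_faces_0)
  moreover have "face_count 1 = h 4 + 5 * h 5" using h(1)[of 1] by (simp add: S b F)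
  moreover have "face_count 1 = 5 * h 0 + h 1" using h(2)[of 1] by (simp add: S b F)
  moreover have "face_count 2 = h 3 + 4 * h 4 + 10 * h 5" using h(1)[of 2] by (simp add: S b F)
  moreover have "face_count 2 = 10 * h 0 + 4 * h 1 + h 2" using h(2)[of 2] by (simp add: S b F)
  moreover have "face_count 3 = h 2 + 3 * h 3 + 6 * h 4 + 10 * h 5" using h(1)[of 3] by (simp add: S b F)
  moreover have "face_count 3 = 10 * h 0 + 6 * h 1 + 3 * h 2 + h 3" using h(2)[of 3] by (simp add: S b F)
  moreover have "face_count 4 = h 1 + 2 * h 2 + 3 * h 3 + 4 * h 4 + 5 * h 5" using h(1)[of 4] by (simp add: S b F)
  moreover have "face_count 5 = h 0 + h 1 + h 2 + h 3 + h 4 + h 5" using h(1)[of 5] by (simp add: S b F)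
  ultimately have e: "h 5 = 1" "h 0 = 1" "face_count 1 = h 4 + 5 * h 5" "face_count 1 = 5 * h 0 + h 1"
    "face_count 2 = h 3 + 4 * h 4 + 10 * h 5" "face_count 2 = 10 * h 0 + 4 * h 1 + h 2"
    "face_count 3 = h 2 + 3 * h 3 + 6 * h 4 + 10 * h 5" "face_count 3 = 10 * h 0 + 6 * h 1 + 3 * h 2 + h 3"
    "face_count 4 = h 1 + 2 * h 2 + 3 * h 3 + 4 * h 4 + 5 * h 5" "face_count 5 = h 0 + h 1 + h 2 + h 3 + h 4 + h 5"
    by blast+
  show "2 * face_count 4 = 5 * face_count 5" "3 * face_count 3 = 2 * face_count 2 + 5 * face_count 5"
    using e by linarith+
  show "2 * face_count 2 + 12 = 6 * card I + face_count 5"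
    using e face_count_1[OF unit] by linarith
qed

section \<open>Measurability and general position\<close>

text \<open>Makes an uncountable existential countable: on a compact set a continuous function
  vanishes somewhere iff it takes arbitrarily small absolute values on a countable dense
  subset.\<close>

lemma sets_Collect_ex_compact:
  fixes f :: "'x \<Rightarrow> 'b::euclidean_space \<Rightarrow> real"
  assumes K: "compact K" and meas: "\<And>z. z \<in> K \<Longrightarrow> (\<lambda>x. f x z) \<in> borel_measurable M"
    and cont: "\<And>x. x \<in> space M \<Longrightarrow> continuous_on K (f x)"
  shows "{x \<in> space M. \<exists>z\<in>K. f x z = 0} \<in> sets M"
proof -
  obtain Q where Q: "countable Q" "Q \<subseteq> K" "K \<subseteq> closure Q"
    using separable by blast
  have "(\<exists>z\<in>K. f x z = 0) \<longleftrightarrow> (\<forall>n::nat. \<exists>q\<in>Q. \<bar>f x q\<bar> < 1 / Suc n)" if x: "x \<in> space M" for x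
  proof
    assume "\<exists>z\<in>K. f x z = 0"
    then obtain z where z: "z \<in> K" "f x z = 0" by blast
    show "\<forall>n::nat. \<exists>q\<in>Q. \<bar>f x q\<bar> < 1 / Suc n"
    proof
      fix n :: nat
      have "0 < 1 / real (Suc n)" by simp
      then obtain d where d: "d > 0" "\<And>z'. z' \<in> K \<Longrightarrow> dist z' z < d \<Longrightarrow> dist (f x z') (f x z) < 1 / Suc n"
        using cont[OF x] z(1) unfolding continuous_on_iff by meson
      obtain q where q: "q \<in> Q" "dist q z < d"
        using Q(3) z(1) d(1) unfolding closure_approachable subset_iff by blast
      have "\<bar>f x q\<bar> < 1 / Suc n"
        using d(2)[of q] q Q(2) z(2) by (auto simp: dist_real_def)
      then show "\<exists>q\<in>Q. \<bar>f x q\<bar> < 1 / Suc n" using q(1) by blast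
    qed
  next
    assume a: "\<forall>n::nat. \<exists>q\<in>Q. \<bar>f x q\<bar> < 1 / Suc n"
    then have "K \<noteq> {}" using Q(2) by blast
    moreover have "continuous_on K (\<lambda>z. \<bar>f x z\<bar>)"
      using cont[OF x] by (intro continuous_intros)
    ultimately obtain z where z: "z \<in> K" "\<And>w. w \<in> K \<Longrightarrow> \<bar>f x z\<bar> \<le> \<bar>f x w\<bar>"
      using continuous_attains_inf[OF K] by blast
    have lt: "\<bar>f x z\<bar> < 1 / Suc n" for n
    proof -
      obtain q where "q \<in> Q" "\<bar>f x q\<bar> < 1 / Suc n" using a by blast
      then show ?thesis using z(2)[of q] Q(2) by (auto intro: le_less_trans)
    qed
    have "\<not> 0 < \<bar>f x z\<bar>"
    proof
      assume "0 < \<bar>f x z\<bar>"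
      then obtain n where "1 / Suc n < \<bar>f x z\<bar>"
        using nat_approx_posE by blast
      then show False using lt[of n] by simp
    qed
    then show "\<exists>z\<in>K. f x z = 0" using z(1) by auto
  qed
  then have "{x \<in> space M. \<exists>z\<in>K. f x z = 0} =
      (\<Inter>n::nat. \<Union>q\<in>Q. {x \<in> space M. \<bar>f x q\<bar> < 1 / Suc n})"
    by auto
  also have "\<dots> \<in> sets M"
  proof -
    have "{x \<in> space M. \<bar>f x q\<bar> < 1 / Suc n} \<in> sets M" if "q \<in> Q" for n q
    proof -
      have [measurable]: "(\<lambda>x. f x q) \<in> borel_measurable M" using meas that Q(2) by blast
      show ?thesis by measurable
    qed
    then have "(\<Union>q\<in>Q. {x \<in> space M. \<bar>f x q\<bar> < 1 / Suc n}) \<in> sets M" for n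
      by (intro sets.countable_UN'[OF Q(1)]) auto
    then show ?thesis by (intro sets.countable_INT) auto
  qed
  finally show ?thesis .
qed

text \<open>Neither the range of the supporting vector nor its strict inequalities are compact
  conditions. Rescaling puts the vector into the unit ball, and strictness is replaced by a margin
  \<open>1 / Suc N\<close>, with a countable union over \<open>N\<close>.\<close>

lemma sets_Collect_hull_face:
  fixes x :: "'w \<Rightarrow> 'i \<Rightarrow> 'a::euclidean_space"
  assumes I: "finite I" "J \<subseteq> I" "i \<in> J"
    and meas: "\<And>j. j \<in> I \<Longrightarrow> (\<lambda>\<omega>. x \<omega> j) \<in> borel_measurable M"
  shows "{\<omega> \<in> space M. hull_face I (x \<omega>) J} \<in> sets M"
proof -
  \<comment> \<open>A sum of nonnegative terms, so that one equation
    \<open>f N \<omega> z = 0\<close> expresses all conditions at once.\<close>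
  define f where "f N \<omega> z = (\<Sum>j\<in>J. \<bar>(x \<omega> j - x \<omega> i) \<bullet> z\<bar>) + (\<Sum>j\<in>I - J. max 0 ((x \<omega> j - x \<omega> i) \<bullet> z + 1 / Suc N))"
    for N :: nat and \<omega> z
  have fin: "finite J" "finite (I - J)" using I finite_subset by auto
  have f0: "f N \<omega> z = 0 \<longleftrightarrow> (\<forall>j\<in>J. (x \<omega> j - x \<omega> i) \<bullet> z = 0) \<and> (\<forall>j\<in>I - J. (x \<omega> j - x \<omega> i) \<bullet> z \<le> - (1 / Suc N))" for N \<omega> z
  proof -
    have "f N \<omega> z = 0 \<longleftrightarrow> (\<Sum>j\<in>J. \<bar>(x \<omega> j - x \<omega> i) \<bullet> z\<bar>) = 0 \<and>
        (\<Sum>j\<in>I - J. max 0 ((x \<omega> j - x \<omega> i) \<bullet> z + 1 / Suc N)) = 0"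
      unfolding f_def by (intro add_nonneg_eq_0_iff sum_nonneg) auto
    also have "(\<Sum>j\<in>J. \<bar>(x \<omega> j - x \<omega> i) \<bullet> z\<bar>) = 0 \<longleftrightarrow> (\<forall>j\<in>J. (x \<omega> j - x \<omega> i) \<bullet> z = 0)"
      using fin by (subst sum_nonneg_eq_0_iff) simp_all
    also have "(\<Sum>j\<in>I - J. max 0 ((x \<omega> j - x \<omega> i) \<bullet> z + 1 / Suc N)) = 0 \<longleftrightarrow>
        (\<forall>j\<in>I - J. (x \<omega> j - x \<omega> i) \<bullet> z \<le> - (1 / Suc N))"
    proof (subst sum_nonneg_eq_0_iff)
      show "(\<forall>j\<in>I - J. max 0 ((x \<omega> j - x \<omega> i) \<bullet> z + 1 / Suc N) = 0) \<longleftrightarrow>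
          (\<forall>j\<in>I - J. (x \<omega> j - x \<omega> i) \<bullet> z \<le> - (1 / Suc N))"
        by (intro ball_cong refl) (auto simp: max_def)
    qed (use fin in auto)
    finally show ?thesis .
  qed
  have "hull_face I (x \<omega>) J \<longleftrightarrow> (\<exists>N. \<exists>z\<in>cball 0 1. f N \<omega> z = 0)" for \<omega>
  proof
    assume "hull_face I (x \<omega>) J"
    then obtain z where z: "\<forall>j\<in>J. (x \<omega> j - x \<omega> i) \<bullet> z = 0" "\<forall>j\<in>I - J. (x \<omega> j - x \<omega> i) \<bullet> z < 0"
      unfolding hull_face_iff[OF I(3)] by blast
    define c where "c = 1 / (1 + norm z)"
    have c: "c > 0" by (simp add: c_def add_pos_nonneg)
    have nrm: "c *\<^sub>R z \<in> cball 0 1"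
      using c by (simp add: c_def divide_le_eq_1)
    have "\<forall>\<^sub>F N in sequentially. \<forall>j\<in>I - J. (x \<omega> j - x \<omega> i) \<bullet> (c *\<^sub>R z) \<le> - (1 / Suc N)"
    proof (rule eventually_ball_finite[OF fin(2)], rule ballI)
      fix j assume "j \<in> I - J"
      then have "0 < - ((x \<omega> j - x \<omega> i) \<bullet> (c *\<^sub>R z))"
        using z(2) c by (simp add: mult_less_0_iff)
      moreover have "(\<lambda>N. 1 / real (Suc N)) \<longlonglongrightarrow> 0"
        by (rule LIMSEQ_Suc[OF lim_1_over_n])
      ultimately have "\<forall>\<^sub>F N in sequentially. 1 / real (Suc N) < - ((x \<omega> j - x \<omega> i) \<bullet> (c *\<^sub>R z))"
        by (rule order_tendstoD(2)[rotated])
      then show "\<forall>\<^sub>F N in sequentially. (x \<omega> j - x \<omega> i) \<bullet> (c *\<^sub>R z) \<le> - (1 / Suc N)"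
        by eventually_elim linarith
    qed
    then obtain N where "\<forall>j\<in>I - J. (x \<omega> j - x \<omega> i) \<bullet> (c *\<^sub>R z) \<le> - (1 / Suc N)"
      using eventually_happens'[OF sequentially_bot] by blast
    moreover have "\<forall>j\<in>J. (x \<omega> j - x \<omega> i) \<bullet> (c *\<^sub>R z) = 0"
      using z(1) by simp
    ultimately show "\<exists>N. \<exists>z\<in>cball 0 1. f N \<omega> z = 0"
      using nrm f0 by blast
  next
    assume "\<exists>N. \<exists>z\<in>cball 0 1. f N \<omega> z = 0"
    then obtain N z where z: "\<forall>j\<in>J. (x \<omega> j - x \<omega> i) \<bullet> z = 0" "\<forall>j\<in>I - J. (x \<omega> j - x \<omega> i) \<bullet> z \<le> - (1 / Suc N)"
      using f0 by blast
    have "- (1 / real (Suc N)) < 0" by simp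
    then have "\<forall>j\<in>I - J. (x \<omega> j - x \<omega> i) \<bullet> z < 0"
      using z(2) by (meson le_less_trans)
    then show "hull_face I (x \<omega>) J"
      unfolding hull_face_iff[OF I(3)] using z(1) I(2) by blast
  qed
  then have "{\<omega> \<in> space M. hull_face I (x \<omega>) J} = (\<Union>N. {\<omega> \<in> space M. \<exists>z\<in>cball 0 1. f N \<omega> z = 0})"
    by auto
  also have "\<dots> \<in> sets M"
  proof (intro sets.countable_UN'' sets_Collect_ex_compact)
    fix N z
    have [measurable]: "(\<lambda>\<omega>. x \<omega> i) \<in> borel_measurable M" using meas I by blast
    have "(\<lambda>\<omega>. (x \<omega> j - x \<omega> i) \<bullet> z) \<in> borel_measurable M" if "j \<in> I" for j
    proof -
      have [measurable]: "(\<lambda>\<omega>. x \<omega> j) \<in> borel_measurable M" using meas that by blast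
      show ?thesis by measurable
    qed
    then show "(\<lambda>\<omega>. f N \<omega> z) \<in> borel_measurable M"
      unfolding f_def using I(2)
      by (intro borel_measurable_add borel_measurable_sum borel_measurable_abs borel_measurable_max borel_measurable_const) auto
    show "continuous_on (cball 0 1) (f N \<omega>)" for \<omega>
      unfolding f_def by (intro continuous_intros)
  qed auto
  finally show ?thesis .
qed

text \<open>A lower bound on the dimension becomes the existence of an orthonormal frame in the
  subspace, sought in a compact set. Frames of every length are stored as square matrices whose rows
  outside \<open>T\<close> are zero.\<close>

lemma le_dim_subspace_iff:
  fixes S :: "(real ^ 'n) set" and T :: "'n set"
  assumes S: "subspace S"
  shows "card T \<le> dim S \<longleftrightarrow>
    (\<exists>B :: real ^ 'n ^ 'n. (\<forall>t\<in>T. \<forall>u\<in>T. B $ t \<bullet> B $ u = (if t = u then 1 else 0)) \<and> (\<forall>t\<in>-T. B $ t = 0) \<and> (\<forall>t\<in>T. B $ t \<in> S))"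
    (is "_ \<longleftrightarrow> ?R")
proof
  assume le: "card T \<le> dim S"
  obtain B where B: "B \<subseteq> S" "pairwise orthogonal B" "\<And>v. v \<in> B \<Longrightarrow> norm v = 1" "card B = dim S"
    using orthonormal_basis_subspace[OF S] by metis
  obtain C where C: "C \<subseteq> B" "card C = card T" "finite C"
    using obtain_subset_with_card_n[of "card T" B] le B(4) by auto
  obtain g where g: "bij_betw g T C"
    using finite_same_card_bij[of T C] C by auto
  have gC: "g t \<in> C" if "t \<in> T" for t using g that by (auto simp: bij_betw_def)
  define b :: "real ^ 'n ^ 'n" where "b = (\<chi> t. if t \<in> T then g t else 0)"
  have "g t \<bullet> g u = (if t = u then 1 else 0)" if "t \<in> T" "u \<in> T" for t u
  proof (cases "t = u")
    case True
    then show ?thesis using B(3)[of "g t"] gC[OF that(1)] C(1) by (auto simp: norm_eq_1)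
  next
    case False
    then have "g t \<noteq> g u" using g that by (auto simp: bij_betw_def inj_on_def)
    then have "orthogonal (g t) (g u)"
      using pairwiseD[OF B(2)] gC that C(1) by blast
    then show ?thesis using False by (simp add: orthogonal_def)
  qed
  moreover have "g t \<in> S" if "t \<in> T" for t using gC[OF that] C(1) B(1) by blast
  ultimately show ?R
    by (intro exI[of _ b]) (auto simp: b_def)
next
  assume ?R
  then obtain b :: "real ^ 'n ^ 'n" where b: "\<And>t u. t \<in> T \<Longrightarrow> u \<in> T \<Longrightarrow> b $ t \<bullet> b $ u = (if t = u then 1 else 0)"
    "\<And>t. t \<in> T \<Longrightarrow> b $ t \<in> S" by blast
  have inj: "inj_on (($) b) T"
  proof (rule inj_onI, rule ccontr)
    fix t u assume "t \<in> T" "u \<in> T" "b $ t = b $ u" "t \<noteq> u"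
    then show False using b(1)[of t u] b(1)[of t t] by simp
  qed
  have "independent (($) b ` T)"
  proof (rule pairwise_orthogonal_independent)
    show "pairwise orthogonal (($) b ` T)"
      unfolding pairwise_def orthogonal_def using b(1) by auto
    show "0 \<notin> ($) b ` T"
    proof
      assume "0 \<in> ($) b ` T"
      then obtain t where "t \<in> T" "b $ t = 0" by auto
      then show False using b(1)[of t t] by simp
    qed
  qed
  moreover have "($) b ` T \<subseteq> S" using b(2) by auto
  ultimately have "card (($) b ` T) \<le> dim S"
    by (metis independent_card_le_dim)
  then show "card T \<le> dim S" by (simp add: card_image[OF inj])
qed

lemma compact_orthonormal_rows:
  "compact {B :: real ^ 'n ^ 'n. (\<forall>t\<in>T. \<forall>u\<in>T. B $ t \<bullet> B $ u = (if t = u then 1 else 0)) \<and> (\<forall>t\<in>-T. B $ t = 0)}"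
    (is "compact ?K")
proof -
  have "?K = (\<Inter>t\<in>T. \<Inter>u\<in>T. {B. B $ t \<bullet> B $ u = (if t = u then 1 else 0)}) \<inter> (\<Inter>t\<in>-T. {B. B $ t = 0})"
    by auto
  also have "closed \<dots>"
    by (intro closed_Int closed_INT ballI closed_Collect_eq continuous_intros)
  finally have "closed ?K" .
  moreover have "bounded ?K"
    unfolding bounded_iff
  proof (intro exI ballI)
    fix B assume B: "B \<in> ?K"
    have "norm (B $ t) \<le> 1" for t
    proof (cases "t \<in> T")
      case True
      then have "B $ t \<bullet> B $ t = 1" using B by simp
      then have "norm (B $ t) = 1" by (simp add: norm_eq_1)
      then show ?thesis by simp
    qed (use B in simp)
    then have "(\<Sum>t\<in>UNIV. norm (B $ t)) \<le> (\<Sum>t\<in>(UNIV :: 'n set). 1)"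
      by (intro sum_mono)
    moreover have "norm B \<le> (\<Sum>t\<in>UNIV. norm (B $ t))"
      unfolding norm_vec_def by (rule L2_set_le_sum) simp
    ultimately show "norm B \<le> (\<Sum>t\<in>(UNIV :: 'n set). 1)" by (rule order_trans[rotated])
  qed
  ultimately show ?thesis by (simp add: compact_eq_bounded_closed)
qed

text \<open>Level sets of the dimension are differences of superlevel sets, and each of these asks
  for a zero of a continuous function on the compact set of frames.\<close>

lemma sets_Collect_dim_tie_space:
  fixes x :: "'w \<Rightarrow> 'i \<Rightarrow> real ^ 'n"
  assumes J: "finite J" "i \<in> J"
    and meas: "\<And>j. j \<in> J \<Longrightarrow> (\<lambda>\<omega>. x \<omega> j) \<in> borel_measurable M"
  shows "{\<omega> \<in> space M. dim (tie_space (x \<omega>) J) = s} \<in> sets M"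
proof -
  have ge: "{\<omega> \<in> space M. s \<le> dim (tie_space (x \<omega>) J)} \<in> sets M" for s
  proof (cases "s \<le> CARD('n)")
    case False
    then have "\<not> s \<le> dim (tie_space (x \<omega>) J)" for \<omega>
      using dim_subset_UNIV[of "tie_space (x \<omega>) J"] by (simp add: DIM_cart)
    then show ?thesis by simp
  next
    case True
    obtain T :: "'n set" where T: "card T = s"
      using obtain_subset_with_card_n[of s "UNIV :: 'n set"] True by auto
    let ?K = "{B :: real ^ 'n ^ 'n. (\<forall>t\<in>T. \<forall>u\<in>T. B $ t \<bullet> B $ u = (if t = u then 1 else 0)) \<and> (\<forall>t\<in>-T. B $ t = 0)}"
    define f where "f \<omega> B = (\<Sum>t\<in>T. \<Sum>j\<in>J. \<bar>(x \<omega> j - x \<omega> i) \<bullet> B $ t\<bar>)" for \<omega> and B :: "real ^ 'n ^ 'n"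
    have f0: "f \<omega> B = 0 \<longleftrightarrow> (\<forall>t\<in>T. B $ t \<in> tie_space (x \<omega>) J)" for \<omega> B
    proof -
      have "f \<omega> B = 0 \<longleftrightarrow> (\<forall>t\<in>T. (\<Sum>j\<in>J. \<bar>(x \<omega> j - x \<omega> i) \<bullet> B $ t\<bar>) = 0)"
        unfolding f_def by (subst sum_nonneg_eq_0_iff) (auto intro: sum_nonneg)
      also have "\<dots> \<longleftrightarrow> (\<forall>t\<in>T. \<forall>j\<in>J. (x \<omega> j - x \<omega> i) \<bullet> B $ t = 0)"
        using J(1) by (intro ball_cong refl, subst sum_nonneg_eq_0_iff) simp_all
      finally show ?thesis unfolding tie_space_eq[OF J(2)] by blast
    qed
    have "s \<le> dim (tie_space (x \<omega>) J) \<longleftrightarrow> (\<exists>B\<in>?K. f \<omega> B = 0)" for \<omega>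
      unfolding f0 T[symmetric] le_dim_subspace_iff[OF subspace_tie_space, of T] by blast
    then have "{\<omega> \<in> space M. s \<le> dim (tie_space (x \<omega>) J)} = {\<omega> \<in> space M. \<exists>B\<in>?K. f \<omega> B = 0}"
      by blast
    also have "\<dots> \<in> sets M"
    proof (rule sets_Collect_ex_compact[OF compact_orthonormal_rows])
      fix B :: "real ^ 'n ^ 'n"
      have [measurable]: "(\<lambda>\<omega>. x \<omega> i) \<in> borel_measurable M" using meas J by blast
      have "(\<lambda>\<omega>. (x \<omega> j - x \<omega> i) \<bullet> z) \<in> borel_measurable M" if "j \<in> J" for j z
      proof -
        have [measurable]: "(\<lambda>\<omega>. x \<omega> j) \<in> borel_measurable M" using meas that by blast
        show ?thesis by measurable
      qed
      then show "(\<lambda>\<omega>. f \<omega> B) \<in> borel_measurable M"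
        unfolding f_def by (intro borel_measurable_sum borel_measurable_abs) auto
      show "continuous_on ?K (f \<omega>)" for \<omega>
        unfolding f_def by (intro continuous_intros)
    qed
    finally show ?thesis .
  qed
  have "{\<omega> \<in> space M. dim (tie_space (x \<omega>) J) = s} =
      {\<omega> \<in> space M. s \<le> dim (tie_space (x \<omega>) J)} - {\<omega> \<in> space M. Suc s \<le> dim (tie_space (x \<omega>) J)}"
    by auto
  then show ?thesis using ge by auto
qed

section \<open>General position of independent points\<close>

lemma dim_tie_space_ge:
  fixes x :: "'i \<Rightarrow> 'a::euclidean_space"
  assumes J: "finite J" "J \<noteq> {}"
  shows "Suc (DIM('a)) - card J \<le> dim (tie_space x J)"
proof -
  obtain i where i: "i \<in> J" using J by blast
  let ?A = "(\<lambda>j. x j - x i) ` (J - {i})"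
  have "tie_space x J = {z \<in> UNIV. \<forall>v\<in>span ?A. orthogonal v z}"
  proof (intro set_eqI iffI)
    fix z assume z: "z \<in> tie_space x J"
    have "orthogonal z v" if "v \<in> span ?A" for v
    proof (rule orthogonal_to_span[OF that])
      fix w assume "w \<in> ?A"
      then show "orthogonal z w"
        using z unfolding tie_space_eq[OF i] by (auto simp: orthogonal_def inner_commute)
    qed
    then show "z \<in> {z \<in> UNIV. \<forall>v\<in>span ?A. orthogonal v z}" by (simp add: orthogonal_commute)
  next
    fix z assume z: "z \<in> {z \<in> UNIV. \<forall>v\<in>span ?A. orthogonal v z}"
    have "(x j - x i) \<bullet> z = 0" if "j \<in> J" for j
    proof (cases "j = i")
      case False
      then have "x j - x i \<in> span ?A" using that by (intro span_base) blast
      then show ?thesis using z unfolding orthogonal_def by blast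
    qed simp
    then show "z \<in> tie_space x J" unfolding tie_space_eq[OF i] by blast
  qed
  then have "dim (tie_space x J) + dim (span ?A) = DIM('a)"
    using dim_subspace_orthogonal_to_vectors[of "span ?A" "UNIV :: 'a set"] by simp
  moreover have "dim (span ?A) \<le> card J - 1"
  proof -
    have "dim ?A \<le> card ?A" using J by (intro dim_le_card') auto
    also have "\<dots> \<le> card (J - {i})" using J by (intro card_image_le) auto
    finally show ?thesis using i J by simp
  qed
  moreover have "card J \<ge> 1" using J by (simp add: Suc_leI card_gt_0_iff)
  ultimately show ?thesis by linarith
qed

text \<open>Each further index lowers the dimension by at least one until it is zero;
  \<open>dim_tie_space_ge\<close> excludes a larger drop.\<close>

lemma general_position_if_ties_decrease:
  fixes x :: "'i \<Rightarrow> 'a::euclidean_space"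
  assumes I: "finite I"
    and dec: "\<And>j J. J \<noteq> {} \<Longrightarrow> insert j J \<subseteq> I \<Longrightarrow> j \<notin> J \<Longrightarrow> tie_space x J \<noteq> {0} \<Longrightarrow>
      tie_space x (insert j J) \<noteq> tie_space x J"
  shows "general_position I x"
proof -
  have "dim (tie_space x J) \<le> Suc (DIM('a)) - card J" if "finite J" "J \<noteq> {}" "J \<subseteq> I" for J
    using that
  proof (induction J rule: finite_ne_induct)
    case (singleton i)
    then show ?case using dim_subset_UNIV[of "tie_space x {i}"] by simp
  next
    case (insert j J)
    have IH: "dim (tie_space x J) \<le> Suc (DIM('a)) - card J" using insert by simp
    have sub: "tie_space x (insert j J) \<subseteq> tie_space x J" by (rule tie_space_antimono) blast
    show ?case
    proof (cases "tie_space x J = {0}")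
      case True
      then have "dim (tie_space x J) = 0" by simp
      then show ?thesis using dim_subset[OF sub] by linarith
    next
      case False
      then have "tie_space x (insert j J) \<subset> tie_space x J"
        using dec[of J j] insert sub by blast
      moreover have "span (tie_space x K) = tie_space x K" for K
        using subspace_tie_space[of x K] by simp
      ultimately have "dim (tie_space x (insert j J)) < dim (tie_space x J)"
        by (intro dim_psubset) metis
      then show ?thesis using IH insert by simp
    qed
  qed
  then show ?thesis
    unfolding general_position_def
    using dim_tie_space_ge[of _ x] finite_subset[OF _ I] by (meson antisym)
qed

text \<open>Given the other points, the tie space of \<open>J\<close> is fixed. If it contains some
  nonzero \<open>z\<close>, then \<open>z\<close> survives the new point only if that point lies on
  one particular hyperplane, a null set.\<close>

lemma AE_general_position:
  fixes I :: "'i set"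
  assumes I: "finite I"
  shows "AE x in PiM I (\<lambda>_. sphere_law :: (real ^ 5) measure). general_position I x"
proof -
  interpret S: prob_space "sphere_law :: (real ^ 5) measure" by (rule prob_space_sphere_law)
  interpret P: product_sigma_finite "\<lambda>_::'i. sphere_law :: (real ^ 5) measure"
    by (simp add: product_sigma_finite_def S.sigma_finite_measure_axioms)
  let ?M = "PiM I (\<lambda>_. sphere_law :: (real ^ 5) measure)"
  have dec: "AE x in ?M. tie_space x J \<noteq> {0} \<longrightarrow> tie_space x (insert j J) \<noteq> tie_space x J"
    if J: "J \<noteq> {}" "insert j J \<subseteq> I" "j \<notin> J" for j J
  proof -
    obtain i where i: "i \<in> J" using J by blast
    have finJ: "finite J" "finite (insert j J)" using J(2) I finite_subset by auto
    define B where "B = {x \<in> space ?M. tie_space x J \<noteq> {0} \<and> tie_space x (insert j J) = tie_space x J}"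
    \<comment> \<open>Nested subspaces agree iff their dimensions do; this form shows that the
      exceptional set is measurable.\<close>
    have B_eq: "B = (\<Union>s\<in>{1..5}. {x \<in> space ?M. dim (tie_space x J) = s} \<inter> {x \<in> space ?M. dim (tie_space x (insert j J)) = s})"
    proof (intro set_eqI iffI)
      fix x assume "x \<in> B"
      then have x: "x \<in> space ?M" "tie_space x J \<noteq> {0}" "tie_space x (insert j J) = tie_space x J"
        by (auto simp: B_def)
      have "dim (tie_space x J) \<noteq> 0"
        using x(2) subspace_0[OF subspace_tie_space[of x J]] by auto
      moreover have "dim (tie_space x J) \<le> 5"
        using dim_subset_UNIV[of "tie_space x J"] by (simp add: DIM_cart)
      ultimately have "dim (tie_space x J) \<in> {1..5}" unfolding atLeastAtMost_iff by linarith
      then show "x \<in> (\<Union>s\<in>{1..5}. {x \<in> space ?M. dim (tie_space x J) = s} \<inter> {x \<in> space ?M. dim (tie_space x (insert j J)) = s})"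
        by (rule UN_I) (intro IntI CollectI conjI x(1) refl arg_cong[where f = dim] x(3))
    next
      fix x assume "x \<in> (\<Union>s\<in>{1..5}. {x \<in> space ?M. dim (tie_space x J) = s} \<inter> {x \<in> space ?M. dim (tie_space x (insert j J)) = s})"
      then obtain s where s: "s \<in> {1..5}" "x \<in> space ?M" "dim (tie_space x J) = s" "dim (tie_space x (insert j J)) = s"
        by blast
      then have x: "x \<in> space ?M" "dim (tie_space x J) \<ge> 1" "dim (tie_space x (insert j J)) = dim (tie_space x J)"
        by simp_all
      have "tie_space x (insert j J) = tie_space x J"
        by (rule subspace_dim_equal[OF subspace_tie_space subspace_tie_space tie_space_antimono[OF subset_insertI]])
           (simp only: x(3) order_refl)
      moreover have "tie_space x J \<noteq> {0}"
      proof
        assume "tie_space x J = {0}"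
        then have "dim (tie_space x J) = 0" by simp
        then show False using x(2) by linarith
      qed
      ultimately show "x \<in> B" using x(1) by (simp add: B_def)
    qed
    have comp: "(\<lambda>x. x k) \<in> borel_measurable ?M" if "k \<in> I" for k
      using measurable_component_singleton[OF that, of "\<lambda>_. sphere_law :: (real ^ 5) measure"]
      unfolding measurable_cong_sets[OF refl sets_sphere_law] .
    have B_sets: "B \<in> sets ?M"
      unfolding B_eq
    proof (intro sets.finite_UN sets.Int)
      fix s
      show "{x \<in> space ?M. dim (tie_space x J) = s} \<in> sets ?M"
        by (rule sets_Collect_dim_tie_space[OF finJ(1) i]) (use J(2) comp in blast)
      show "{x \<in> space ?M. dim (tie_space x (insert j J)) = s} \<in> sets ?M"
        by (rule sets_Collect_dim_tie_space[OF finJ(2) insertI1]) (use J(2) comp in blast)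
    qed simp
    define I' where "I' = I - {j}"
    have I': "finite I'" "j \<notin> I'" "insert j I' = I" using I J(2) by (auto simp: I'_def)
    have upd: "tie_space (y(j := v)) J = tie_space y J" for y and v :: "real ^ 5"
    proof -
      define y' where "y' = y(j := v)"
      have "y' k = y k" if "k \<in> J" for k using that J(3) by (auto simp: y'_def)
      then show ?thesis
        unfolding y'_def[symmetric] tie_space_def by (intro Collect_cong ball_cong refl) simp
    qed
    have zero: "(\<integral>\<^sup>+v. indicator B (y(j := v)) \<partial>sphere_law) = 0" for y
    proof (cases "tie_space y J = {0}")
      case True
      have "tie_space (y(j := v)) J = {0}" for v
        using True unfolding upd .
      then have "y(j := v) \<notin> B" for v
        unfolding B_def by blast
      then have "indicator B (y(j := v)) = (0::ennreal)" for v
        by simp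
      then show ?thesis by simp
    next
      case False
      then obtain z where z: "z \<in> tie_space y J" "z \<noteq> 0"
        using subspace_0[OF subspace_tie_space[of y J]] by blast
      have "AE v in sphere_law. z \<bullet> v \<noteq> z \<bullet> y i"
        by (rule AE_sphere_law_hyperplane[OF z(2)])
      then have "AE v in sphere_law. indicator B (y(j := v)) = (0::ennreal)"
      proof eventually_elim
        fix v assume v: "z \<bullet> v \<noteq> z \<bullet> y i"
        have zJ: "z \<in> tie_space (y(j := v)) J"
          unfolding upd by (rule z(1))
        have "z \<notin> tie_space (y(j := v)) (insert j J)"
        proof
          assume "z \<in> tie_space (y(j := v)) (insert j J)"
          then have "((y(j := v)) j - (y(j := v)) i) \<bullet> z = 0"
            unfolding tie_space_eq[OF insertI2[OF i]] by blast
          moreover have "i \<noteq> j" using i J(3) by blast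
          ultimately have "v \<bullet> z - y i \<bullet> z = 0" unfolding inner_diff_left by simp
          then show False using v unfolding inner_commute[of z v] inner_commute[of z "y i"] by simp
        qed
        then have "y(j := v) \<notin> B" unfolding B_def using zJ by blast
        then show "indicator B (y(j := v)) = (0::ennreal)" by simp
      qed
      then have "(\<integral>\<^sup>+v. indicator B (y(j := v)) \<partial>sphere_law) = (\<integral>\<^sup>+v. 0 \<partial>(sphere_law :: (real ^ 5) measure))"
        by (rule nn_integral_cong_AE)
      then show ?thesis by simp
    qed
    have "emeasure ?M B = (\<integral>\<^sup>+x. indicator B x \<partial>?M)" using B_sets by simp
    also have "\<dots> = (\<integral>\<^sup>+y. \<integral>\<^sup>+v. indicator B (y(j := v)) \<partial>sphere_law \<partial>PiM I' (\<lambda>_. sphere_law :: (real ^ 5) measure))"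
      unfolding I'(3)[symmetric]
      by (rule P.product_nn_integral_insert[OF I'(1,2)]) (use B_sets I'(3) in simp)
    also have "\<dots> = 0" by (simp add: zero)
    finally have "B \<in> null_sets ?M" using B_sets by (intro null_setsI)
    from AE_not_in[OF this] AE_space show ?thesis
      unfolding B_def by eventually_elim blast
  qed
  have "AE x in ?M. \<forall>p\<in>{(j, J). J \<noteq> {} \<and> insert j J \<subseteq> I \<and> j \<notin> J}. tie_space x (snd p) \<noteq> {0} \<longrightarrow>
      tie_space x (insert (fst p) (snd p)) \<noteq> tie_space x (snd p)"
  proof (intro AE_finite_allI)
    have "{(j, J). J \<noteq> {} \<and> insert j J \<subseteq> I \<and> j \<notin> J} \<subseteq> I \<times> Pow I" by auto
    then show "finite {(j, J). J \<noteq> {} \<and> insert j J \<subseteq> I \<and> j \<notin> J}"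
      by (rule finite_subset) (use I in simp)
  next
    fix p assume "p \<in> {(j, J). J \<noteq> {} \<and> insert j J \<subseteq> I \<and> j \<notin> J}"
    then obtain j J where p: "p = (j, J)" and J: "J \<noteq> {}" "insert j J \<subseteq> I" "j \<notin> J" by blast
    show "AE x in ?M. tie_space x (snd p) \<noteq> {0} \<longrightarrow> tie_space x (insert (fst p) (snd p)) \<noteq> tie_space x (snd p)"
      unfolding p fst_conv snd_conv by (rule dec[OF J])
  qed
  then show ?thesis
  proof eventually_elim
    fix x assume a: "\<forall>p\<in>{(j, J). J \<noteq> {} \<and> insert j J \<subseteq> I \<and> j \<notin> J}. tie_space x (snd p) \<noteq> {0} \<longrightarrow>
      tie_space x (insert (fst p) (snd p)) \<noteq> tie_space x (snd p)"
    show "general_position I x"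
    proof (rule general_position_if_ties_decrease[OF I])
      fix j J assume "J \<noteq> {}" "insert j J \<subseteq> I" "j \<notin> J" "tie_space x J \<noteq> {0}"
      then show "tie_space x (insert j J) \<noteq> tie_space x J"
        using bspec[OF a, of "(j, J)"] by simp
    qed
  qed
qed

section \<open>The probability of a facet\<close>

lemma product_sigma_finite_sphere_law: "product_sigma_finite (\<lambda>_::'i. sphere_law :: 'a::euclidean_space measure)"
proof -
  interpret S: prob_space "sphere_law :: 'a measure" by (rule prob_space_sphere_law)
  show ?thesis by (simp add: product_sigma_finite_def S.sigma_finite_measure_axioms)
qed

lemma sigma_finite_PiM_sphere_law:
  assumes "finite I"
  shows "sigma_finite_measure (PiM I (\<lambda>_. sphere_law :: 'a::euclidean_space measure))"
proof -
  interpret product_sigma_finite "\<lambda>_. sphere_law :: 'a measure" by (rule product_sigma_finite_sphere_law)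
  interpret finite_product_sigma_finite "\<lambda>_. sphere_law :: 'a measure" I by standard fact
  show ?thesis by (rule sigma_finite_measure_axioms)
qed

lemma borel_measurable_PiM_sphere_law:
  "k \<in> I \<Longrightarrow> (\<lambda>x. x k) \<in> borel_measurable (PiM I (\<lambda>_. sphere_law :: 'a::euclidean_space measure))"
  using measurable_component_singleton[of k I "\<lambda>_. sphere_law :: 'a measure"]
  unfolding measurable_cong_sets[OF refl sets_sphere_law] .

text \<open>A functional supporting the hull along \<open>G\<close> is constant on \<open>G\<close>,
  hence a multiple of \<open>u\<close>; the sign of the factor decides on which side all other
  points lie.\<close>

lemma hull_face_facet_iff:
  fixes x :: "'i \<Rightarrow> 'a::euclidean_space"
  assumes G: "i \<in> G" "G \<subseteq> I" "G \<noteq> I"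
    and H: "\<And>j. j \<in> G \<Longrightarrow> u \<bullet> x j = H"
    and uniq: "\<And>v \<eta>. (\<And>j. j \<in> G \<Longrightarrow> v \<bullet> x j = \<eta>) \<Longrightarrow> \<exists>r. v = r *\<^sub>R u"
  shows "hull_face I x G \<longleftrightarrow> (\<forall>j\<in>I - G. u \<bullet> x j < H) \<or> (\<forall>j\<in>I - G. H < u \<bullet> x j)"
proof -
  have diff: "(x j - x i) \<bullet> (r *\<^sub>R u) = r * (u \<bullet> x j - H)" for j r
    using H[OF G(1)] by (simp add: inner_diff_left inner_diff_right inner_commute right_diff_distrib)
  show ?thesis
    unfolding hull_face_iff[OF G(1)]
  proof
    assume "G \<subseteq> I \<and> (\<exists>z. (\<forall>j\<in>G. (x j - x i) \<bullet> z = 0) \<and> (\<forall>j\<in>I - G. (x j - x i) \<bullet> z < 0))"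
    then obtain z where z: "\<forall>j\<in>G. (x j - x i) \<bullet> z = 0" "\<forall>j\<in>I - G. (x j - x i) \<bullet> z < 0" by blast
    have "z \<bullet> x j = z \<bullet> x i" if "j \<in> G" for j
      using bspec[OF z(1) that] by (simp add: inner_diff_left inner_diff_right inner_commute)
    then obtain r where r: "z = r *\<^sub>R u" using uniq[of z "z \<bullet> x i"] by blast
    obtain k where k: "k \<in> I - G" using G(2,3) by blast
    have lt: "r * (u \<bullet> x j - H) < 0" if "j \<in> I - G" for j
      using z(2) that unfolding r diff by blast
    show "(\<forall>j\<in>I - G. u \<bullet> x j < H) \<or> (\<forall>j\<in>I - G. H < u \<bullet> x j)"
    proof (cases "r > 0")
      case True
      then show ?thesis using lt by (simp add: mult_less_0_iff)
    next
      case False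
      then show ?thesis using lt by (fastforce simp: mult_less_0_iff)
    qed
  next
    assume "(\<forall>j\<in>I - G. u \<bullet> x j < H) \<or> (\<forall>j\<in>I - G. H < u \<bullet> x j)"
    then obtain r :: real where r: "\<And>j. j \<in> I - G \<Longrightarrow> r * (u \<bullet> x j - H) < 0"
    proof
      assume "\<forall>j\<in>I - G. u \<bullet> x j < H"
      then show thesis by (intro that[of 1]) simp
    next
      assume "\<forall>j\<in>I - G. H < u \<bullet> x j"
      then show thesis by (intro that[of "-1"]) simp
    qed
    have tie: "\<forall>j\<in>G. (x j - x i) \<bullet> (r *\<^sub>R u) = 0" unfolding diff using H by simp
    have below: "\<forall>j\<in>I - G. (x j - x i) \<bullet> (r *\<^sub>R u) < 0" unfolding diff using r by blast
    show "G \<subseteq> I \<and> (\<exists>z. (\<forall>j\<in>G. (x j - x i) \<bullet> z = 0) \<and> (\<forall>j\<in>I - G. (x j - x i) \<bullet> z < 0))"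
      by (rule conjI, rule G(2), rule exI[of _ "r *\<^sub>R u"], rule conjI, rule tie, rule below)
  qed
qed

text \<open>The two events are disjoint because \<open>K\<close> is nonempty, and each is a product
  of open caps.\<close>

lemma emeasure_one_sided:
  fixes u :: "real ^ 5" and K :: "'i set"
  assumes K: "finite K" "K \<noteq> {}" and u: "norm u = 1" and H: "\<bar>H\<bar> < 1"
  shows "emeasure (PiM K (\<lambda>_. sphere_law))
      {y \<in> space (PiM K (\<lambda>_. sphere_law)). (\<forall>j\<in>K. u \<bullet> y j < H) \<or> (\<forall>j\<in>K. H < u \<bullet> y j)} =
    ennreal (cap_cdf H) ^ card K + ennreal (cap_cdf (- H)) ^ card K"
proof -
  interpret product_sigma_finite "\<lambda>_::'i. sphere_law :: (real ^ 5) measure" by (rule product_sigma_finite_sphere_law)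
  let ?P = "PiM K (\<lambda>_. sphere_law :: (real ^ 5) measure)"
  let ?A = "Pi\<^sub>E K (\<lambda>_. {v. u \<bullet> v < H})" and ?B = "Pi\<^sub>E K (\<lambda>_. {v. - u \<bullet> v < - H})"
  have eq: "{y \<in> space ?P. (\<forall>j\<in>K. u \<bullet> y j < H) \<or> (\<forall>j\<in>K. H < u \<bullet> y j)} = ?A \<union> ?B"
  proof -
    have A: "y \<in> ?A \<longleftrightarrow> y \<in> space ?P \<and> (\<forall>j\<in>K. u \<bullet> y j < H)" for y
      unfolding space_PiM PiE_iff by (simp add: conj_commute)
    have B: "y \<in> ?B \<longleftrightarrow> y \<in> space ?P \<and> (\<forall>j\<in>K. H < u \<bullet> y j)" for y
      unfolding space_PiM PiE_iff by (simp add: conj_commute)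
    show ?thesis
      unfolding set_eq_iff Un_iff A B mem_Collect_eq by blast
  qed
  have disj: "?A \<inter> ?B = {}"
  proof (rule ccontr)
    assume "?A \<inter> ?B \<noteq> {}"
    then obtain y where y: "y \<in> ?A" "y \<in> ?B" by blast
    obtain k where "k \<in> K" using K(2) by blast
    then have "u \<bullet> y k < H" "- u \<bullet> y k < - H" using y unfolding PiE_iff by blast+
    then show False by simp
  qed
  have sets: "?A \<in> sets ?P" "?B \<in> sets ?P"
    using K(1) by (auto intro!: sets_PiM_I_finite)
  have "emeasure ?P (?A \<union> ?B) = emeasure ?P ?A + emeasure ?P ?B"
    by (rule plus_emeasure[OF sets disj, symmetric])
  also have "emeasure ?P ?A = ennreal (cap_cdf H) ^ card K"
    using H by (subst emeasure_PiM[OF K(1)]) (auto simp: emeasure_sphere_law_open_cap[OF u])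
  also have "emeasure ?P ?B = ennreal (cap_cdf (- H)) ^ card K"
    using H u by (subst emeasure_PiM[OF K(1)]) (auto simp: emeasure_sphere_law_open_cap[of "- u" "- H", simplified])
  finally show ?thesis unfolding eq .
qed

lemma measurable_fun_upd_PiM:
  assumes "f \<in> measurable N (PiM K (\<lambda>_. M))" "h \<in> measurable N M"
  shows "(\<lambda>x. (f x)(i := h x)) \<in> measurable N (PiM (insert i K) (\<lambda>_. M))"
  by (rule measurable_fun_upd[of _ K i]) (use assms in auto)

text \<open>The points outside \<open>G\<close> are integrated out first. What is left depends on
  the five points of \<open>G\<close> only through the offset of their hyperplane, and takes the
  same value for both unit normals.\<close>

lemma emeasure_facet:
  fixes I :: "'i set"
  assumes I: "finite I" "G \<subseteq> I" "G \<noteq> I" and G: "card G = 5"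
  defines "k \<equiv> card (I - G)"
  shows "emeasure (PiM I (\<lambda>_. sphere_law)) {x \<in> space (PiM I (\<lambda>_. sphere_law)). hull_face I (x :: 'i \<Rightarrow> real ^ 5) G} =
    (\<integral>\<^sup>+x. (ennreal (cap_cdf (sin x)) ^ k + ennreal (cap_cdf (- sin x)) ^ k) * ennreal (6435 / 4096 * cos x ^ 15) *
      indicator {-(pi/2)<..<pi/2} x \<partial>lborel)"
proof -
  let ?S = "sphere_law :: (real ^ 5) measure"
  interpret P: product_sigma_finite "\<lambda>_::'i. ?S" by (rule product_sigma_finite_sphere_law)
  obtain g0 g1 g2 g3 g4 where g: "G = {g0, g1, g2, g3, g4}" "distinct [g0, g1, g2, g3, g4]"
  proof -
    have "finite G" using I finite_subset by blast
    then obtain gs where gs: "set gs = G" "distinct gs" using finite_distinct_list by blast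
    then have "length gs = 5" using G distinct_card by fastforce
    then obtain a b c d e where "gs = [a, b, c, d, e]"
      by (auto simp: eval_nat_numeral length_Suc_conv)
    then show thesis using gs by (intro that[of a b c d e]) auto
  qed
  define K where "K = I - G"
  have K: "finite K" "K \<noteq> {}" using I by (auto simp: K_def)
  have gK: "g0 \<notin> K" "g1 \<notin> K" "g2 \<notin> K" "g3 \<notin> K" "g4 \<notin> K" by (auto simp: K_def g)
  have I_eq: "I = insert g0 (insert g1 (insert g2 (insert g3 (insert g4 K))))"
    using I(2) by (auto simp: K_def g)
  define E where "E = {x \<in> space (PiM I (\<lambda>_. ?S)). hull_face I x G}"
  have E: "E \<in> sets (PiM I (\<lambda>_. ?S))"
    unfolding E_def using I g(1)
    by (intro sets_Collect_hull_face[of I G g0] borel_measurable_PiM_sphere_law) auto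
  define upd where "upd x0 x1 x2 x3 x4 y = (y(g4 := x4, g3 := x3, g2 := x2, g1 := x1, g0 := x0) :: 'i \<Rightarrow> real ^ 5)"
    for x0 x1 x2 x3 x4 :: "real ^ 5" and y
  \<comment> \<open>The conditional probability of the facet given its five vertices.\<close>
  define \<Psi> where "\<Psi> = (\<lambda>(x0, x1, x2, x3, x4). \<integral>\<^sup>+y. indicator E (upd x0 x1 x2 x3 x4 y) \<partial>PiM K (\<lambda>_. ?S))"
  have upd_meas: "(\<lambda>w. upd (f0 w) (f1 w) (f2 w) (f3 w) (f4 w) (f w)) \<in> measurable W (PiM I (\<lambda>_. ?S))"
    if "f0 \<in> borel_measurable W" "f1 \<in> borel_measurable W" "f2 \<in> borel_measurable W" "f3 \<in> borel_measurable W"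
      "f4 \<in> borel_measurable W" "f \<in> measurable W (PiM K (\<lambda>_. ?S))"
    for f0 f1 f2 f3 f4 f and W :: "'w measure"
    unfolding upd_def I_eq using that
    by (intro measurable_fun_upd_PiM) (simp_all add: measurable_cong_sets[OF refl sets_sphere_law])
  have \<Psi>_meas: "\<Psi> \<in> borel_measurable borel"
  proof -
    interpret SK: sigma_finite_measure "PiM K (\<lambda>_. ?S)" by (rule sigma_finite_PiM_sphere_law[OF K(1)])
    have "(\<lambda>w. indicator E (upd (fst (fst w)) (fst (snd (fst w))) (fst (snd (snd (fst w)))) (fst (snd (snd (snd (fst w)))))
        (snd (snd (snd (snd (fst w))))) (snd w)) :: ennreal) \<in>
        borel_measurable ((borel :: ((real ^ 5) \<times> (real ^ 5) \<times> (real ^ 5) \<times> (real ^ 5) \<times> (real ^ 5)) measure) \<Otimes>\<^sub>M PiM K (\<lambda>_. ?S))"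
    proof (rule measurable_compose[OF upd_meas borel_measurable_indicator[OF E]])
      have [measurable]: "fst \<in> borel_measurable ((borel :: ((real ^ 5) \<times> (real ^ 5) \<times> (real ^ 5) \<times> (real ^ 5) \<times> (real ^ 5)) measure) \<Otimes>\<^sub>M PiM K (\<lambda>_. ?S))"
        by (rule measurable_fst)
      note m = borel_measurable_fst_snd
      show "(\<lambda>w. fst (fst w)) \<in> borel_measurable ((borel :: ((real ^ 5) \<times> (real ^ 5) \<times> (real ^ 5) \<times> (real ^ 5) \<times> (real ^ 5)) measure) \<Otimes>\<^sub>M PiM K (\<lambda>_. ?S))"
        "(\<lambda>w. fst (snd (fst w))) \<in> borel_measurable ((borel :: ((real ^ 5) \<times> (real ^ 5) \<times> (real ^ 5) \<times> (real ^ 5) \<times> (real ^ 5)) measure) \<Otimes>\<^sub>M PiM K (\<lambda>_. ?S))"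
        "(\<lambda>w. fst (snd (snd (fst w)))) \<in> borel_measurable ((borel :: ((real ^ 5) \<times> (real ^ 5) \<times> (real ^ 5) \<times> (real ^ 5) \<times> (real ^ 5)) measure) \<Otimes>\<^sub>M PiM K (\<lambda>_. ?S))"
        "(\<lambda>w. fst (snd (snd (snd (fst w))))) \<in> borel_measurable ((borel :: ((real ^ 5) \<times> (real ^ 5) \<times> (real ^ 5) \<times> (real ^ 5) \<times> (real ^ 5)) measure) \<Otimes>\<^sub>M PiM K (\<lambda>_. ?S))"
        "(\<lambda>w. snd (snd (snd (snd (fst w))))) \<in> borel_measurable ((borel :: ((real ^ 5) \<times> (real ^ 5) \<times> (real ^ 5) \<times> (real ^ 5) \<times> (real ^ 5)) measure) \<Otimes>\<^sub>M PiM K (\<lambda>_. ?S))"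
        by (intro m measurable_fst)+
    qed (rule measurable_snd)
    from SK.borel_measurable_nn_integral_fst[OF this] show ?thesis
      by (simp add: \<Psi>_def case_prod_beta)
  qed
  have ne: "g0 \<notin> insert g1 (insert g2 (insert g3 (insert g4 K)))" "g1 \<notin> insert g2 (insert g3 (insert g4 K))"
    "g2 \<notin> insert g3 (insert g4 K)" "g3 \<notin> insert g4 K"
    using gK g(2) by auto
  note fu = measurable_fun_upd_PiM
  have ind: "indicator E \<in> borel_measurable (PiM (insert g0 (insert g1 (insert g2 (insert g3 (insert g4 K))))) (\<lambda>_. ?S))"
    using E unfolding I_eq[symmetric] by (rule borel_measurable_indicator)
  have c: "(\<lambda>_. v) \<in> measurable W ?S" for v :: "real ^ 5" and W :: "('i \<Rightarrow> real ^ 5) measure"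
    by (rule measurable_const) simp
  have "emeasure (PiM I (\<lambda>_. ?S)) E = (\<integral>\<^sup>+x. indicator E x \<partial>PiM I (\<lambda>_. ?S))"
    using E by simp
  also have "\<dots> = (\<integral>\<^sup>+x0. \<integral>\<^sup>+x1. \<integral>\<^sup>+x2. \<integral>\<^sup>+x3. \<integral>\<^sup>+x4. \<Psi> (x0, x1, x2, x3, x4) \<partial>?S \<partial>?S \<partial>?S \<partial>?S \<partial>?S)"
  proof -
    have s0: "(\<integral>\<^sup>+x. indicator E x \<partial>PiM I (\<lambda>_. ?S)) =
        (\<integral>\<^sup>+x0. \<integral>\<^sup>+x. indicator E (x(g0 := x0)) \<partial>PiM (insert g1 (insert g2 (insert g3 (insert g4 K)))) (\<lambda>_. ?S) \<partial>?S)"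
      unfolding I_eq by (rule P.product_nn_integral_insert_rev[OF _ ne(1) ind]) (use K in simp)
    have s1: "(\<integral>\<^sup>+x. indicator E (x(g0 := x0)) \<partial>PiM (insert g1 (insert g2 (insert g3 (insert g4 K)))) (\<lambda>_. ?S)) =
        (\<integral>\<^sup>+x1. \<integral>\<^sup>+x. indicator E (x(g1 := x1, g0 := x0)) \<partial>PiM (insert g2 (insert g3 (insert g4 K))) (\<lambda>_. ?S) \<partial>?S)" for x0
      by (rule P.product_nn_integral_insert_rev[OF _ ne(2)])
         (use K in simp, rule measurable_compose[OF fu ind], rule measurable_ident_sets[OF refl], rule c)
    have s2: "(\<integral>\<^sup>+x. indicator E (x(g1 := x1, g0 := x0)) \<partial>PiM (insert g2 (insert g3 (insert g4 K))) (\<lambda>_. ?S)) =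
        (\<integral>\<^sup>+x2. \<integral>\<^sup>+x. indicator E (x(g2 := x2, g1 := x1, g0 := x0)) \<partial>PiM (insert g3 (insert g4 K)) (\<lambda>_. ?S) \<partial>?S)" for x0 x1
      by (rule P.product_nn_integral_insert_rev[OF _ ne(3)])
         (use K in simp, rule measurable_compose[OF fu[OF fu] ind], rule measurable_ident_sets[OF refl], (rule c)+)
    have s3: "(\<integral>\<^sup>+x. indicator E (x(g2 := x2, g1 := x1, g0 := x0)) \<partial>PiM (insert g3 (insert g4 K)) (\<lambda>_. ?S)) =
        (\<integral>\<^sup>+x3. \<integral>\<^sup>+x. indicator E (x(g3 := x3, g2 := x2, g1 := x1, g0 := x0)) \<partial>PiM (insert g4 K) (\<lambda>_. ?S) \<partial>?S)" for x0 x1 x2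
      by (rule P.product_nn_integral_insert_rev[OF _ ne(4)])
         (use K in simp, rule measurable_compose[OF fu[OF fu[OF fu]] ind], rule measurable_ident_sets[OF refl], (rule c)+)
    have s4: "(\<integral>\<^sup>+x. indicator E (x(g3 := x3, g2 := x2, g1 := x1, g0 := x0)) \<partial>PiM (insert g4 K) (\<lambda>_. ?S)) =
        (\<integral>\<^sup>+x4. \<integral>\<^sup>+x. indicator E (x(g4 := x4, g3 := x3, g2 := x2, g1 := x1, g0 := x0)) \<partial>PiM K (\<lambda>_. ?S) \<partial>?S)" for x0 x1 x2 x3
      by (rule P.product_nn_integral_insert_rev[OF _ gK(5)])
         (use K in simp, rule measurable_compose[OF fu[OF fu[OF fu[OF fu]]] ind], rule measurable_ident_sets[OF refl], (rule c)+)
    show ?thesis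
      unfolding s0 s1 s2 s3 s4 \<Psi>_def upd_def by simp
  qed
  also have "\<dots> = (\<integral>\<^sup>+x. (ennreal (cap_cdf (sin x)) ^ k + ennreal (cap_cdf (- sin x)) ^ k) * ennreal (6435 / 4096 * cos x ^ 15) *
      indicator {-(pi/2)<..<pi/2} x \<partial>lborel)"
  proof (rule nn_integral_hyperplane_distance[OF \<Psi>_meas])
    show "(\<lambda>h. ennreal (cap_cdf h) ^ k + ennreal (cap_cdf (- h)) ^ k) \<in> borel_measurable borel"
      unfolding cap_cdf_def by measurable
    fix x0 x1 x2 x3 x4 u :: "real ^ 5" and H :: real
    assume u: "norm u = 1" and H: "\<bar>H\<bar> < 1" and on: "\<And>x. x \<in> {x0, x1, x2, x3, x4} \<Longrightarrow> u \<bullet> x = H"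
      and uniq: "\<And>v \<eta>. (\<And>x. x \<in> {x0, x1, x2, x3, x4} \<Longrightarrow> v \<bullet> x = \<eta>) \<Longrightarrow> \<exists>r. v = r *\<^sub>R u"
    have upd_g: "upd x0 x1 x2 x3 x4 y g0 = x0" "upd x0 x1 x2 x3 x4 y g1 = x1" "upd x0 x1 x2 x3 x4 y g2 = x2"
      "upd x0 x1 x2 x3 x4 y g3 = x3" "upd x0 x1 x2 x3 x4 y g4 = x4" for y
      using g(2) by (auto simp: upd_def)
    have upd_K: "upd x0 x1 x2 x3 x4 y j = y j" if "j \<in> K" for y j
      using that gK by (auto simp: upd_def)
    have hull: "hull_face I (upd x0 x1 x2 x3 x4 y) G \<longleftrightarrow> (\<forall>j\<in>K. u \<bullet> y j < H) \<or> (\<forall>j\<in>K. H < u \<bullet> y j)" for y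
    proof -
      have "hull_face I (upd x0 x1 x2 x3 x4 y) G \<longleftrightarrow>
          (\<forall>j\<in>I - G. u \<bullet> upd x0 x1 x2 x3 x4 y j < H) \<or> (\<forall>j\<in>I - G. H < u \<bullet> upd x0 x1 x2 x3 x4 y j)"
      proof (rule hull_face_facet_iff[OF _ I(2,3)])
        show "g0 \<in> G" by (simp add: g)
        show "u \<bullet> upd x0 x1 x2 x3 x4 y j = H" if "j \<in> G" for j
          using that on by (auto simp: g upd_g)
        show "\<exists>r. v = r *\<^sub>R u" if v: "\<And>j. j \<in> G \<Longrightarrow> v \<bullet> upd x0 x1 x2 x3 x4 y j = \<eta>" for v \<eta>
        proof (rule uniq[of v \<eta>])
          fix x assume x: "x \<in> {x0, x1, x2, x3, x4}"
          have "v \<bullet> x0 = \<eta>" "v \<bullet> x1 = \<eta>" "v \<bullet> x2 = \<eta>" "v \<bullet> x3 = \<eta>" "v \<bullet> x4 = \<eta>"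
            using v[of g0] v[of g1] v[of g2] v[of g3] v[of g4] by (simp_all add: g upd_g)
          then show "v \<bullet> x = \<eta>" using x by auto
        qed
      qed
      also have "\<dots> \<longleftrightarrow> (\<forall>j\<in>K. u \<bullet> y j < H) \<or> (\<forall>j\<in>K. H < u \<bullet> y j)"
        unfolding K_def[symmetric] by (simp add: upd_K)
      finally show ?thesis .
    qed
    have space: "upd x0 x1 x2 x3 x4 y \<in> space (PiM I (\<lambda>_. ?S))" if "y \<in> space (PiM K (\<lambda>_. ?S))" for y
      using that unfolding space_PiM upd_def I_eq by (auto simp: PiE_iff extensional_def)
    let ?A = "{y \<in> space (PiM K (\<lambda>_. ?S)). (\<forall>j\<in>K. u \<bullet> y j < H) \<or> (\<forall>j\<in>K. H < u \<bullet> y j)}"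
    have A: "?A \<in> sets (PiM K (\<lambda>_. ?S))"
    proof -
      have [measurable]: "(\<lambda>y. y j) \<in> borel_measurable (PiM K (\<lambda>_. ?S))" if "j \<in> K" for j
        by (rule borel_measurable_PiM_sphere_law[OF that])
      have "?A = (\<Inter>j\<in>K. {y \<in> space (PiM K (\<lambda>_. ?S)). u \<bullet> y j < H}) \<union> (\<Inter>j\<in>K. {y \<in> space (PiM K (\<lambda>_. ?S)). H < u \<bullet> y j})"
        using K(2) by auto
      also have "\<dots> \<in> sets (PiM K (\<lambda>_. ?S))"
        using K by (intro sets.Un sets.finite_INT) measurable
      finally show ?thesis .
    qed
    have "\<Psi> (x0, x1, x2, x3, x4) = (\<integral>\<^sup>+y. indicator ?A y \<partial>PiM K (\<lambda>_. ?S))"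
      unfolding \<Psi>_def prod.case
      by (rule nn_integral_cong) (simp add: E_def space hull indicator_def)
    also have "\<dots> = emeasure (PiM K (\<lambda>_. ?S)) ?A" using A by simp
    finally show "\<Psi> (x0, x1, x2, x3, x4) = ennreal (cap_cdf H) ^ k + ennreal (cap_cdf (- H)) ^ k"
      using emeasure_one_sided[OF K u H] by (simp add: k_def K_def)
  qed
  finally show ?thesis unfolding E_def .
qed

text \<open>By the triple-angle formula \<open>sin (3 * x) = 3 * sin x - 4 * sin x ^ 3\<close>, the
  sum \<open>8 + 9 * sin x + sin (3 * x)\<close> is
  \<open>8 + 12 * sin x - 4 * sin x ^ 3\<close>.\<close>

lemma cap_cdf_sin: "cap_cdf (sin x) = 3 / 48 * (8 + 9 * sin x + sin (3 * x))"
proof -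
  have c: "cos x * cos x = 1 - sin x * sin x"
    using sin_cos_squared_add[of x] unfolding power2_eq_square by linarith
  have "sin (3 * x) = sin (2 * x + x)"
    by (rule arg_cong[where f = sin]) linarith
  also have "\<dots> = 2 * sin x * (cos x * cos x) + (cos x * cos x - sin x * sin x) * sin x"
    unfolding sin_add sin_double cos_double power2_eq_square by (simp only: mult.assoc)
  also have "\<dots> = 3 * sin x - 4 * sin x ^ 3"
    unfolding c by (simp add: power3_eq_cube algebra_simps)
  finally show ?thesis by (simp add: cap_cdf_def field_simps)
qed

text \<open>Reflecting \<open>x\<close> to \<open>- x\<close> exchanges the two caps and preserves
  the cosine, so both contribute the same and 6435/4096 doubles to 6435/2048.\<close>

lemma facet_probability_integral:
  "(\<integral>\<^sup>+x. (ennreal (cap_cdf (sin x)) ^ k + ennreal (cap_cdf (- sin x)) ^ k) * ennreal (6435 / 4096 * cos x ^ 15) *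
      indicator {-(pi/2)<..<pi/2} x \<partial>lborel) =
    ennreal (6435 / 2048 * (3 / 48) ^ k *
      integral {- (pi/2)..pi/2} (\<lambda>x. cos x ^ 15 * (8 + 9 * sin x + sin (3 * x)) ^ k))"
proof -
  let ?I = "{- (pi/2)..pi/2}"
  define f where "f x = cos x ^ 15 * cap_cdf (sin x) ^ k" for x
  have cont: "continuous_on S f" for S
    unfolding f_def cap_cdf_def by (intro continuous_intros) auto
  have int: "(f has_integral integral ?I f) ?I"
    using cont integrable_continuous_interval by blast
  have "((\<lambda>x. f (- x)) has_integral integral ?I f) {- (pi/2)..- (- (pi/2))}"
    using has_integral_reflect_real[of f "integral ?I f" "pi/2" "- (pi/2)"] int by simp
  then have int': "((\<lambda>x. f (- x)) has_integral integral ?I f) ?I" by simp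
  define g where "g x = 6435 / 4096 * (f x + f (- x))" for x
  have intg: "(g has_integral 6435 / 4096 * (integral ?I f + integral ?I f)) ?I"
    unfolding g_def by (intro has_integral_mult_right has_integral_add int int')
  have nonneg: "0 \<le> f x" "0 \<le> f (- x)" if "x \<in> ?I" for x
    using that cos_ge_zero[of x] cap_cdf_nonneg[of "sin x"] cap_cdf_nonneg[of "- sin x"] sin_le_one[of x] sin_ge_minus_one[of x]
    by (auto simp: f_def simp del: sin_le_one sin_ge_minus_one)
  have "(\<integral>\<^sup>+x. (ennreal (cap_cdf (sin x)) ^ k + ennreal (cap_cdf (- sin x)) ^ k) * ennreal (6435 / 4096 * cos x ^ 15) *
      indicator {-(pi/2)<..<pi/2} x \<partial>lborel) = (\<integral>\<^sup>+x. ennreal (g x) * indicator ?I x \<partial>lborel)"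
    using AE_lborel_singleton[of "-(pi/2)"] AE_lborel_singleton[of "pi/2"]
  proof (intro nn_integral_cong_AE, eventually_elim)
    fix x :: real assume ne: "x \<noteq> -(pi/2)" "x \<noteq> pi/2"
    show "(ennreal (cap_cdf (sin x)) ^ k + ennreal (cap_cdf (- sin x)) ^ k) * ennreal (6435 / 4096 * cos x ^ 15) *
      indicator {-(pi/2)<..<pi/2} x = ennreal (g x) * indicator ?I x"
    proof (cases "x \<in> ?I")
      case True
      then have "0 \<le> cap_cdf (sin x)" "0 \<le> cap_cdf (- sin x)" "0 \<le> cos x ^ 15"
        using cap_cdf_nonneg[of "sin x"] cap_cdf_nonneg[of "- sin x"] sin_le_one[of x] sin_ge_minus_one[of x] cos_ge_zero[of x]
        by (auto simp del: sin_le_one sin_ge_minus_one)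
      then have "(ennreal (cap_cdf (sin x)) ^ k + ennreal (cap_cdf (- sin x)) ^ k) * ennreal (6435 / 4096 * cos x ^ 15) =
          ennreal ((cap_cdf (sin x) ^ k + cap_cdf (- sin x) ^ k) * (6435 / 4096 * cos x ^ 15))"
        by (simp add: ennreal_power ennreal_plus[symmetric] ennreal_mult[symmetric] del: ennreal_plus)
      also have "(cap_cdf (sin x) ^ k + cap_cdf (- sin x) ^ k) * (6435 / 4096 * cos x ^ 15) = g x"
        by (simp add: g_def f_def algebra_simps)
      finally show ?thesis using True ne by (simp add: indicator_def)
    qed (auto simp: indicator_def)
  qed
  also have "\<dots> = ennreal (6435 / 4096 * (integral ?I f + integral ?I f))"
    by (rule nn_integral_has_integral_lebesgue'[OF _ intg]) (use nonneg in \<open>simp add: g_def\<close>)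
  also have "integral ?I f = (3 / 48) ^ k * integral ?I (\<lambda>x. cos x ^ 15 * (8 + 9 * sin x + sin (3 * x)) ^ k)"
  proof -
    have "f = (\<lambda>x. (3 / 48) ^ k * (cos x ^ 15 * (8 + 9 * sin x + sin (3 * x)) ^ k))"
      unfolding f_def cap_cdf_sin by (simp only: power_mult_distrib mult_ac)
    then show ?thesis by simp
  qed
  finally show ?thesis by (simp add: algebra_simps)
qed

section \<open>Expected face numbers of the typical cell\<close>

lemma hull_face_cong_imp:
  assumes eq: "\<And>i. i \<in> I \<Longrightarrow> x i = y i" and h: "hull_face I x J"
  shows "hull_face I y J"
proof -
  obtain z where J: "J \<subseteq> I"
    and z: "\<forall>i\<in>J. (\<forall>j\<in>J. (x j - x i) \<bullet> z = 0) \<and> (\<forall>j\<in>I - J. (x j - x i) \<bullet> z < 0)"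
    using h unfolding hull_face_def by (elim conjE exE)
  have "\<forall>i\<in>J. (\<forall>j\<in>J. (y j - y i) \<bullet> z = 0) \<and> (\<forall>j\<in>I - J. (y j - y i) \<bullet> z < 0)"
  proof (intro ballI conjI)
    fix i j assume i: "i \<in> J"
    have yi: "y i = x i" using eq[of i] i J by auto
    show "(y j - y i) \<bullet> z = 0" if "j \<in> J"
    proof -
      have "y j = x j" using eq[of j] that J by auto
      then show ?thesis using bspec[OF conjunct1[OF bspec[OF z i]] that] yi by simp
    qed
    show "(y j - y i) \<bullet> z < 0" if "j \<in> I - J"
    proof -
      have "y j = x j" using eq[of j] that by auto
      then show ?thesis using bspec[OF conjunct2[OF bspec[OF z i]] that] yi by simp
    qed
  qed
  then show ?thesis unfolding hull_face_def using J by (intro conjI exI[of _ z])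
qed

text \<open>Elements of the product space are functions restricted to the index set, whereas the
  family of random points is not.\<close>

lemma hull_face_restrict: "hull_face I (restrict x I) J \<longleftrightarrow> hull_face I x J"
  using hull_face_cong_imp[of I x "restrict x I" J] hull_face_cong_imp[of I "restrict x I" x J] by auto

lemma tie_space_restrict: "J \<subseteq> I \<Longrightarrow> tie_space (restrict x I) J = tie_space x J"
  unfolding tie_space_def by (intro Collect_cong ball_cong refl) (simp add: subsetD)

lemma card_eq_sum_indicator:
  assumes "finite A" "{G. P G} \<subseteq> A"
  shows "real (card {G. P G}) = (\<Sum>G\<in>A. if P G then 1 else 0)"
proof -
  have "A \<inter> {G. P G} = {G. P G}" using assms by blast
  then show ?thesis using assms(1) by (simp add: sum.If_cases)
qed

lemma (in prob_space) integral_card_eq: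
  assumes A: "finite A" and P: "\<And>\<omega>. \<omega> \<in> space M \<Longrightarrow> {G. P \<omega> G} \<subseteq> A"
    and meas: "\<And>G. G \<in> A \<Longrightarrow> {\<omega> \<in> space M. P \<omega> G} \<in> sets M"
  shows "integrable M (\<lambda>\<omega>. real (card {G. P \<omega> G}))"
    and "(\<integral>\<omega>. real (card {G. P \<omega> G}) \<partial>M) = (\<Sum>G\<in>A. prob {\<omega> \<in> space M. P \<omega> G})"
proof -
  have eq: "real (card {G. P \<omega> G}) = (\<Sum>G\<in>A. indicator {\<omega> \<in> space M. P \<omega> G} \<omega>)" if "\<omega> \<in> space M" for \<omega>
    unfolding card_eq_sum_indicator[OF A P[OF that]] using that by (intro sum.cong) auto
  have int: "integrable M (\<lambda>\<omega>. indicator {\<omega> \<in> space M. P \<omega> G} \<omega> :: real)" if "G \<in> A" for G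
    using meas[OF that] by (simp add: integrable_indicator_iff emeasure_eq_measure)
  have "integrable M (\<lambda>\<omega>. real (card {G. P \<omega> G})) \<longleftrightarrow> integrable M (\<lambda>\<omega>. \<Sum>G\<in>A. indicator {\<omega> \<in> space M. P \<omega> G} \<omega> :: real)"
    by (rule Bochner_Integration.integrable_cong[OF refl eq])
  then show "integrable M (\<lambda>\<omega>. real (card {G. P \<omega> G}))"
    using int by (simp add: Bochner_Integration.integrable_sum)
  have "(\<integral>\<omega>. real (card {G. P \<omega> G}) \<partial>M) = (\<integral>\<omega>. (\<Sum>G\<in>A. indicator {\<omega> \<in> space M. P \<omega> G} \<omega>) \<partial>M)"
    by (rule Bochner_Integration.integral_cong[OF refl eq])
  also have "\<dots> = (\<Sum>G\<in>A. \<integral>\<omega>. indicator {\<omega> \<in> space M. P \<omega> G} \<omega> \<partial>M)"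
    by (rule Bochner_Integration.integral_sum[OF int])
  also have "\<dots> = (\<Sum>G\<in>A. prob {\<omega> \<in> space M. P \<omega> G})"
    by (intro sum.cong refl) (simp add: Int_absorb2 Collect_mono_iff subset_iff)
  finally show "(\<integral>\<omega>. real (card {G. P \<omega> G}) \<partial>M) = (\<Sum>G\<in>A. prob {\<omega> \<in> space M. P \<omega> G})" .
qed

section \<open>Mean face numbers of the random hull\<close>

abbreviation sphere_points :: "nat \<Rightarrow> (nat \<Rightarrow> real ^ 5) measure"
  where "sphere_points m \<equiv> PiM {1..m} (\<lambda>_. sphere_law)"

definition mean_hull_faces :: "nat \<Rightarrow> nat \<Rightarrow> real"
  where "mean_hull_faces m s = (\<integral>x. real (card {G. hull_face {1..m} x G \<and> card G = s}) \<partial>sphere_points m)"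

lemma prob_space_sphere_points: "prob_space (sphere_points m)"
  by (intro prob_space_PiM prob_space_sphere_law)

lemma sets_hull_face:
  assumes "G \<subseteq> {1..m}" "G \<noteq> {}"
  shows "{x \<in> space (sphere_points m). hull_face {1..m} x G} \<in> sets (sphere_points m)"
proof -
  obtain i where "i \<in> G" using assms by blast
  then show ?thesis
    using assms(1) by (intro sets_Collect_hull_face[of _ _ i] borel_measurable_PiM_sphere_law) auto
qed

lemma hull_face_integral:
  assumes s: "1 \<le> s"
  shows "integrable (sphere_points m) (\<lambda>x. real (card {G. hull_face {1..m} x G \<and> card G = s}))"
    and "mean_hull_faces m s =
      (\<Sum>G | G \<subseteq> {1..m} \<and> card G = s. measure (sphere_points m) {x \<in> space (sphere_points m). hull_face {1..m} x G})"
proof -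
  interpret prob_space "sphere_points m" by (rule prob_space_sphere_points)
  let ?A = "{G. G \<subseteq> {1..m} \<and> card G = s}"
  have A: "finite ?A" by (rule finite_subset[of _ "Pow {1..m}"]) auto
  have sub: "{G. hull_face {1..m} x G \<and> card G = s} \<subseteq> ?A" for x :: "nat \<Rightarrow> real ^ 5"
    using hull_face_subset by blast
  have meas: "{x \<in> space (sphere_points m). hull_face {1..m} x G \<and> card G = s} \<in> sets (sphere_points m)" if G: "G \<in> ?A" for G
  proof -
    have "G \<noteq> {}" using G s by auto
    then show ?thesis using G sets_hull_face[of G m] by simp
  qed
  show "integrable (sphere_points m) (\<lambda>x. real (card {G. hull_face {1..m} x G \<and> card G = s}))"
    by (rule integral_card_eq(1)[OF A sub meas])
  have "mean_hull_faces m s =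
      (\<Sum>G\<in>?A. prob {x \<in> space (sphere_points m). hull_face {1..m} x G \<and> card G = s})"
    unfolding mean_hull_faces_def by (rule integral_card_eq(2)[OF A sub meas])
  also have "\<dots> = (\<Sum>G\<in>?A. prob {x \<in> space (sphere_points m). hull_face {1..m} x G})"
    by (rule sum.cong) auto
  finally show "mean_hull_faces m s = (\<Sum>G\<in>?A. prob {x \<in> space (sphere_points m). hull_face {1..m} x G})" .
qed

text \<open>Six is the dimension plus one, the least number of points with a full-dimensional
  hull.\<close>

lemma AE_point_configuration:
  assumes m: "6 \<le> m"
  shows "AE x in sphere_points m. point_configuration {1..m} x \<and> (\<forall>i\<in>{1..m}. norm (x i) = 1)"
proof -
  have "AE x in sphere_points m. \<forall>i\<in>{1..m}. norm (x i) = 1"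
  proof (intro AE_finite_allI)
    fix i assume "i \<in> {1..m}"
    then show "AE x in sphere_points m. norm (x i) = 1"
      by (intro AE_PiM_component prob_space_sphere_law AE_sphere_law_norm)
  qed simp
  moreover have "AE x in sphere_points m. general_position {1..m} x"
    by (rule AE_general_position) simp
  ultimately show ?thesis
  proof eventually_elim
    case (elim x)
    then show ?case using m by (simp add: point_configuration_def DIM_cart)
  qed
qed

lemma mean_hull_faces_relations:
  assumes m: "6 \<le> m"
  shows "2 * mean_hull_faces m 4 = 5 * mean_hull_faces m 5"
    and "3 * mean_hull_faces m 3 = 2 * mean_hull_faces m 2 + 5 * mean_hull_faces m 5"
    and "2 * mean_hull_faces m 2 + 12 = 6 * real m + mean_hull_faces m 5"
proof -
  interpret prob_space "sphere_points m" by (rule prob_space_sphere_points)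
  define f where "f s x = real (card {G. hull_face {1..m} x G \<and> card G = s})" for s and x :: "nat \<Rightarrow> real ^ 5"
  have int: "integrable (sphere_points m) (f s)" if "1 \<le> s" for s
    using hull_face_integral(1)[OF that, of m] unfolding f_def .
  have mean: "mean_hull_faces m s = (\<integral>x. f s x \<partial>sphere_points m)" for s
    by (simp add: mean_hull_faces_def f_def)
  have meas: "f s \<in> borel_measurable (sphere_points m)" if "1 \<le> s" for s
    using int[OF that] by (rule borel_measurable_integrable)
  have AE_rel: "AE x in sphere_points m. 2 * f 4 x = 5 * f 5 x \<and> 3 * f 3 x = 2 * f 2 x + 5 * f 5 x \<and>
      2 * f 2 x + 12 = 6 * real m + f 5 x"
    using AE_point_configuration[OF m]
  proof eventually_elim
    fix x :: "nat \<Rightarrow> real ^ 5" assume x: "point_configuration {1..m} x \<and> (\<forall>i\<in>{1..m}. norm (x i) = 1)"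
    then have pc: "point_configuration {1..m} x" by blast
    have fc: "f s x = real (point_configuration.face_count {1..m} x s)" for s
      unfolding f_def point_configuration.face_count_def[OF pc] ..
    have "2 * point_configuration.face_count {1..m} x 4 = 5 * point_configuration.face_count {1..m} x 5"
      "3 * point_configuration.face_count {1..m} x 3 =
        2 * point_configuration.face_count {1..m} x 2 + 5 * point_configuration.face_count {1..m} x 5"
      "2 * point_configuration.face_count {1..m} x 2 + 12 = 6 * card {1..m} + point_configuration.face_count {1..m} x 5"
      by (rule dehn_sommerville_dim5[OF pc]; use x in blast)+
    then show "2 * f 4 x = 5 * f 5 x \<and> 3 * f 3 x = 2 * f 2 x + 5 * f 5 x \<and> 2 * f 2 x + 12 = 6 * real m + f 5 x"
      unfolding fc by simp
  qed
  have "(\<integral>x. 2 * f 4 x \<partial>sphere_points m) = (\<integral>x. 5 * f 5 x \<partial>sphere_points m)"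
    by (rule integral_cong_AE) (use AE_rel meas in auto)
  then show "2 * mean_hull_faces m 4 = 5 * mean_hull_faces m 5"
    using int by (simp add: mean)
  have "(\<integral>x. 3 * f 3 x \<partial>sphere_points m) = (\<integral>x. 2 * f 2 x + 5 * f 5 x \<partial>sphere_points m)"
    by (rule integral_cong_AE) (use AE_rel meas in auto)
  then show "3 * mean_hull_faces m 3 = 2 * mean_hull_faces m 2 + 5 * mean_hull_faces m 5"
    using int by (simp add: mean)
  have "(\<integral>x. 2 * f 2 x + 12 \<partial>sphere_points m) = (\<integral>x. 6 * real m + f 5 x \<partial>sphere_points m)"
    by (rule integral_cong_AE) (use AE_rel meas in auto)
  then show "2 * mean_hull_faces m 2 + 12 = 6 * real m + mean_hull_faces m 5"
    using int by (simp add: mean prob_space[unfolded One_nat_def] integrable_const[unfolded One_nat_def])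
qed

lemma mean_facets:
  assumes m: "6 \<le> m"
  shows "mean_hull_faces m 5 = real (m choose 5) * (6435 / 2048 * (3 / 48) ^ (m - 5) *
    integral {- (pi/2)..pi/2} (\<lambda>x. cos x ^ 15 * (8 + 9 * sin x + sin (3 * x)) ^ (m - 5)))"
    (is "_ = _ * ?p")
proof -
  \<comment> \<open>Nonnegativity allows the real probability to be read off from its
    \<open>ennreal\<close> value.\<close>
  have "0 \<le> integral {- (pi/2)..pi/2} (\<lambda>x. cos x ^ 15 * (8 + 9 * sin x + sin (3 * x)) ^ (m - 5))"
  proof (rule integral_nonneg)
    show "(\<lambda>x. cos x ^ 15 * (8 + 9 * sin x + sin (3 * x)) ^ (m - 5)) integrable_on {- (pi/2)..pi/2}"
      by (intro integrable_continuous_interval continuous_intros)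
    fix x :: real assume "x \<in> {- (pi/2)..pi/2}"
    then have "0 \<le> cos x" by (simp add: cos_ge_zero)
    moreover have "0 \<le> 8 + 9 * sin x + sin (3 * x)"
      using cap_cdf_nonneg[of "sin x"] unfolding cap_cdf_sin by simp
    ultimately show "0 \<le> cos x ^ 15 * (8 + 9 * sin x + sin (3 * x)) ^ (m - 5)" by simp
  qed
  then have p: "0 \<le> ?p" by simp
  have "measure (sphere_points m) {x \<in> space (sphere_points m). hull_face {1..m} x G} = ?p"
    if G: "G \<subseteq> {1..m}" "card G = 5" for G
  proof -
    have "G \<noteq> {1..m}" using G(2) m by auto
    moreover have "card ({1..m} - G) = m - 5"
      using G by (subst card_Diff_subset) (auto intro: finite_subset)
    ultimately have "emeasure (sphere_points m) {x \<in> space (sphere_points m). hull_face {1..m} x G} = ennreal ?p"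
      using emeasure_facet[of "{1..m}" G] G facet_probability_integral[of "m - 5"] by simp
    then show ?thesis using p by (simp add: measure_def)
  qed
  then have "mean_hull_faces m 5 = (\<Sum>G | G \<subseteq> {1..m} \<and> card G = 5. ?p)"
    unfolding hull_face_integral(2)[of 5 m, simplified] by (intro sum.cong) auto
  also have "\<dots> = real (card {G. G \<subseteq> {1..m} \<and> card G = 5}) * ?p"
    by simp
  also have "card {G. G \<subseteq> {1..m} \<and> card G = 5} = m choose 5"
    by (simp add: n_subsets)
  finally show ?thesis .
qed

text \<open>Only the sum over all cells is evaluated, by double counting; a uniformly chosen cell
  asks for nothing more. The other two claims resolve the mean of each cell into probabilities of
  measurable events.\<close>

lemma sum_mean_cell_faces:
  assumes m: "6 \<le> m" and k: "k < 5"
  shows "(\<Sum>i\<in>{1..m}. \<integral>x. real (card {J. i \<in> J \<and> hull_face {1..m} x J \<and> dim (tie_space x J) = Suc k}) \<partial>sphere_points m) =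
    real (5 - k) * mean_hull_faces m (5 - k)"
    and "\<And>i. i \<in> {1..m} \<Longrightarrow>
      (\<integral>x. real (card {J. i \<in> J \<and> hull_face {1..m} x J \<and> dim (tie_space x J) = Suc k}) \<partial>sphere_points m) =
      (\<Sum>J | J \<subseteq> {1..m} \<and> i \<in> J. measure (sphere_points m)
        {x \<in> space (sphere_points m). hull_face {1..m} x J \<and> dim (tie_space x J) = Suc k})"
    and "\<And>i J. J \<subseteq> {1..m} \<Longrightarrow> i \<in> J \<Longrightarrow>
      {x \<in> space (sphere_points m). hull_face {1..m} x J \<and> dim (tie_space x J) = Suc k} \<in> sets (sphere_points m)"
proof -
  interpret prob_space "sphere_points m" by (rule prob_space_sphere_points)
  define c where "c i x = real (card {J. i \<in> J \<and> hull_face {1..m} x J \<and> dim (tie_space x J) = Suc k})"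
    for i and x :: "nat \<Rightarrow> real ^ 5"
  have sets: "{x \<in> space (sphere_points m). hull_face {1..m} x J \<and> dim (tie_space x J) = Suc k} \<in> sets (sphere_points m)"
    if J: "J \<subseteq> {1..m}" "i \<in> J" for i J
  proof -
    have "finite J" using J(1) finite_subset by blast
    have "{x \<in> space (sphere_points m). hull_face {1..m} x J \<and> dim (tie_space x J) = Suc k} =
        {x \<in> space (sphere_points m). hull_face {1..m} x J} \<inter> {x \<in> space (sphere_points m). dim (tie_space x J) = Suc k}"
      by blast
    also have "\<dots> \<in> sets (sphere_points m)"
    proof (rule sets.Int)
      show "{x \<in> space (sphere_points m). hull_face {1..m} x J} \<in> sets (sphere_points m)"
        using J by (intro sets_hull_face) auto
      show "{x \<in> space (sphere_points m). dim (tie_space x J) = Suc k} \<in> sets (sphere_points m)"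
        by (rule sets_Collect_dim_tie_space[OF \<open>finite J\<close> J(2)])
           (rule borel_measurable_PiM_sphere_law, use J(1) in blast)
    qed
    finally show ?thesis .
  qed
  then show "\<And>i J. J \<subseteq> {1..m} \<Longrightarrow> i \<in> J \<Longrightarrow>
      {x \<in> space (sphere_points m). hull_face {1..m} x J \<and> dim (tie_space x J) = Suc k} \<in> sets (sphere_points m)" .
  have A: "finite {J. J \<subseteq> {1..m} \<and> i \<in> J}" for i
    by (rule finite_subset[of _ "Pow {1..m}"]) auto
  have sub: "{J. i \<in> J \<and> hull_face {1..m} x J \<and> dim (tie_space x J) = Suc k} \<subseteq> {J. J \<subseteq> {1..m} \<and> i \<in> J}"
    for i and x :: "nat \<Rightarrow> real ^ 5"
  proof (rule subsetI, unfold mem_Collect_eq, elim conjE)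
    fix J assume i: "i \<in> J" and h: "hull_face {1..m} x J"
    show "J \<subseteq> {1..m} \<and> i \<in> J" by (rule conjI[OF hull_face_subset[OF h] i])
  qed
  have meas: "{x \<in> space (sphere_points m). i \<in> J \<and> hull_face {1..m} x J \<and> dim (tie_space x J) = Suc k} \<in> sets (sphere_points m)"
    if "J \<in> {J. J \<subseteq> {1..m} \<and> i \<in> J}" for i J
  proof -
    have J: "J \<subseteq> {1..m}" "i \<in> J" using that by blast+
    show ?thesis using sets[OF J] by (simp only: J(2) simp_thms)
  qed
  show "(\<integral>x. real (card {J. i \<in> J \<and> hull_face {1..m} x J \<and> dim (tie_space x J) = Suc k}) \<partial>sphere_points m) =
      (\<Sum>J | J \<subseteq> {1..m} \<and> i \<in> J. measure (sphere_points m)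
        {x \<in> space (sphere_points m). hull_face {1..m} x J \<and> dim (tie_space x J) = Suc k})" for i
  proof -
    have "(\<integral>x. real (card {J. i \<in> J \<and> hull_face {1..m} x J \<and> dim (tie_space x J) = Suc k}) \<partial>sphere_points m) =
      (\<Sum>J | J \<subseteq> {1..m} \<and> i \<in> J. prob
        {x \<in> space (sphere_points m). i \<in> J \<and> hull_face {1..m} x J \<and> dim (tie_space x J) = Suc k})"
      by (rule integral_card_eq(2)[OF A sub meas])
    also have "\<dots> = (\<Sum>J | J \<subseteq> {1..m} \<and> i \<in> J. prob
        {x \<in> space (sphere_points m). hull_face {1..m} x J \<and> dim (tie_space x J) = Suc k})"
      by (rule sum.cong[OF refl]) (simp only: mem_Collect_eq simp_thms)
    finally show ?thesis .
  qed
  have int: "integrable (sphere_points m) (c i)" for i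
    unfolding c_def by (rule integral_card_eq(1)[OF A sub meas])
  have AE_rel: "AE x in sphere_points m. (\<Sum>i\<in>{1..m}. c i x) =
      real (5 - k) * real (card {G. hull_face {1..m} x G \<and> card G = 5 - k})"
    using AE_point_configuration[OF m]
  proof eventually_elim
    fix x :: "nat \<Rightarrow> real ^ 5" assume x: "point_configuration {1..m} x \<and> (\<forall>i\<in>{1..m}. norm (x i) = 1)"
    then have pc: "point_configuration {1..m} x" by blast
    have "(\<Sum>i\<in>{1..m}. card {J. i \<in> J \<and> hull_face {1..m} x J \<and> dim (tie_space x J) = Suc k}) =
        (5 - k) * card {G. hull_face {1..m} x G \<and> card G = 5 - k}"
    proof -
      have dim: "DIM(real ^ 5) = 5" by (simp add: DIM_cart)
      show ?thesis
        using point_configuration.sum_card_hull_faces[OF pc, of k] k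
        unfolding point_configuration.face_count_def[OF pc] dim by (simp only: simp_thms)
    qed
    then show "(\<Sum>i\<in>{1..m}. c i x) = real (5 - k) * real (card {G. hull_face {1..m} x G \<and> card G = 5 - k})"
      unfolding c_def of_nat_sum[symmetric] of_nat_mult[symmetric] by (rule arg_cong[where f = real])
  qed
  have intF: "integrable (sphere_points m) (\<lambda>x. real (card {G. hull_face {1..m} x G \<and> card G = 5 - k}))"
    using k by (intro hull_face_integral(1)) simp
  have "(\<Sum>i\<in>{1..m}. \<integral>x. c i x \<partial>sphere_points m) = (\<integral>x. (\<Sum>i\<in>{1..m}. c i x) \<partial>sphere_points m)"
    by (rule Bochner_Integration.integral_sum[symmetric]) (rule int)
  also have "\<dots> = (\<integral>x. real (5 - k) * real (card {G. hull_face {1..m} x G \<and> card G = 5 - k}) \<partial>sphere_points m)"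
  proof (rule integral_cong_AE[OF _ _ AE_rel])
    show "(\<lambda>x. \<Sum>i\<in>{1..m}. c i x) \<in> borel_measurable (sphere_points m)"
      by (intro borel_measurable_integrable Bochner_Integration.integrable_sum int)
    show "(\<lambda>x. real (5 - k) * real (card {G. hull_face {1..m} x G \<and> card G = 5 - k})) \<in> borel_measurable (sphere_points m)"
      by (intro borel_measurable_times borel_measurable_const borel_measurable_integrable intF)
  qed
  also have "\<dots> = real (5 - k) * mean_hull_faces m (5 - k)"
    unfolding mean_hull_faces_def by (rule integral_mult_right_zero)
  finally show "(\<Sum>i\<in>{1..m}. \<integral>x. real (card {J. i \<in> J \<and> hull_face {1..m} x J \<and> dim (tie_space x J) = Suc k}) \<partial>sphere_points m) =
    real (5 - k) * mean_hull_faces m (5 - k)"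
    unfolding c_def .
qed

text \<open>The expectation is a sum of probabilities over pairs of a cell and an index set
  containing it. Independence splits off the factor \<open>1 / m\<close> from each, and what remains
  is the sum over all cells from \<open>sum_mean_cell_faces\<close>.\<close>

lemma expected_face_number_eq:
  fixes M :: "'w measure" and X :: "nat \<Rightarrow> 'w \<Rightarrow> real ^ 5"
  assumes m: "6 \<le> m" and k: "k < 5"
    and M: "prob_space M"
    and indep: "prob_space.indep_vars M (\<lambda>_. sphere_borel) X {1..m}"
    and law: "\<And>i. i \<in> {1..m} \<Longrightarrow> distr M sphere_borel (X i) = spherical_measure"
    and N: "N \<in> measurable M (count_space {1..m})"
    and N_law: "distr M (count_space {1..m}) N = uniform_count_measure {1..m}"
    and NX: "prob_space.indep_set M
           (sets (vimage_algebra (space M) N (count_space {1..m})))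
           (sets (vimage_algebra (space M) (\<lambda>\<omega>. \<lambda>i\<in>{1..m}. X i \<omega>) (\<Pi>\<^sub>M i\<in>{1..m}. sphere_borel)))"
    and R: "measurable_rotations_to_pole R"
  shows "expected_face_number M R m X N k = real (5 - k) / real m * mean_hull_faces m (5 - k)"
proof -
  interpret prob_space M by (rule M)
  let ?I = "{1..m}"
  let ?Q = "sphere_points m"
  define X' where "X' \<omega> = (\<lambda>i\<in>?I. X i \<omega>)" for \<omega>
  define F where "F J = {x \<in> space ?Q. hull_face ?I x J \<and> dim (tie_space x J) = Suc k}" for J
  have F_sets: "F J \<in> sets ?Q" if "J \<subseteq> ?I" "i \<in> J" for i J
    unfolding F_def using that by (rule sum_mean_cell_faces(3)[OF m k])
  have rv: "X i \<in> measurable M sphere_borel" if "i \<in> ?I" for i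
    using indep that unfolding indep_vars_def by blast
  have on_sphere: "X i \<omega> \<in> unit_sphere" if "i \<in> ?I" "\<omega> \<in> space M" for i \<omega>
    using measurable_space[OF rv[OF that(1)] that(2)] by (simp add: space_restrict_space)
  have inc: "(\<lambda>v. v) \<in> measurable sphere_borel (borel :: (real ^ 5) measure)"
    by (intro measurable_restrict_space1) simp
  have rv': "X i \<in> borel_measurable M" if "i \<in> ?I" for i
    using measurable_compose[OF rv[OF that] inc] .
  have law': "distr M borel (X i) = sphere_law" if i: "i \<in> ?I" for i
  proof -
    have "distr M borel (X i) = distr (distr M sphere_borel (X i)) borel (\<lambda>v. v)"
      using distr_distr[OF inc rv[OF i]] by (simp add: comp_def)
    then show ?thesis by (simp add: law[OF i] distr_spherical_measure)
  qed
  have "indep_vars (\<lambda>_. borel) (\<lambda>i \<omega>. X i \<omega>) ?I"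
    by (rule indep_vars_compose2[OF indep, of "\<lambda>_ v. v"]) (rule inc)
  then have joint: "distr M (PiM ?I (\<lambda>_. borel)) X' = PiM ?I (\<lambda>i. distr M borel (X i))"
    using m unfolding X'_def by (subst (asm) indep_vars_iff_distr_eq_PiM') (auto simp: rv')
  have Q_eq: "PiM ?I (\<lambda>i. distr M borel (X i)) = ?Q"
    by (rule PiM_cong) (simp_all add: law')
  have X'_Q: "X' \<in> measurable M (PiM ?I (\<lambda>_. borel))"
    unfolding X'_def by (rule measurable_restrict) (rule rv')
  have sets_Q: "sets ?Q = sets (PiM ?I (\<lambda>_. borel :: (real ^ 5) measure))"
    by (rule sets_PiM_cong) simp_all
  have space_Q: "space ?Q = space (PiM ?I (\<lambda>_. borel :: (real ^ 5) measure))"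
    by (rule sets_eq_imp_space_eq[OF sets_Q])
  have X'_space: "X' \<omega> \<in> space ?Q" if "\<omega> \<in> space M" for \<omega>
    unfolding space_Q by (rule measurable_space[OF X'_Q that])
  have prob_X': "prob (X' -` A \<inter> space M) = measure ?Q A" if "A \<in> sets ?Q" for A
    using that X'_Q unfolding joint[unfolded Q_eq, symmetric] by (subst measure_distr) simp_all
  have N_I: "N \<omega> \<in> ?I" if "\<omega> \<in> space M" for \<omega>
    using measurable_space[OF N that] by simp
  have prob_N: "prob (N -` {i} \<inter> space M) = 1 / m" if i: "i \<in> ?I" for i
  proof -
    have "prob (N -` {i} \<inter> space M) = measure (distr M (count_space ?I) N) {i}"
      using i by (subst measure_distr[OF N]) auto
    also have "\<dots> = 1 / m"
      unfolding N_law using i by (subst measure_uniform_count_measure) auto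
    finally show ?thesis .
  qed
  have prob_NX: "prob {\<omega> \<in> space M. N \<omega> = i \<and> X' \<omega> \<in> A} = 1 / m * measure ?Q A"
    if i: "i \<in> ?I" and A: "A \<in> sets ?Q" for i A
  proof -
    \<comment> \<open>Independence is given for the product of the Borel algebras of the sphere,
      while the hull events live in the full Borel product; the trace of the event on the smaller
      space connects the two.\<close>
    let ?S = "\<Pi>\<^sub>M i\<in>?I. sphere_borel :: (real ^ 5) measure"
    have "(\<lambda>x. x) \<in> measurable ?S (PiM ?I (\<lambda>_. borel))"
    proof (rule measurable_PiM_single')
      show "(\<lambda>x. x j) \<in> measurable ?S borel" if "j \<in> ?I" for j
        using measurable_compose[OF measurable_component_singleton[OF that] inc] .
      show "(\<lambda>x. x) \<in> space ?S \<rightarrow> (\<Pi>\<^sub>E i\<in>?I. space borel)"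
        by (auto simp: space_PiM PiE_iff)
    qed
    then have A': "A \<inter> space ?S \<in> sets ?S"
      using measurable_sets[of "\<lambda>x. x" ?S "PiM ?I (\<lambda>_. borel)" A] A sets_Q by simp
    have X'_S: "X' \<omega> \<in> space ?S" if "\<omega> \<in> space M" for \<omega>
      using on_sphere that by (auto simp: X'_def space_PiM PiE_iff space_restrict_space)
    have 1: "N -` {i} \<inter> space M \<in> sets (vimage_algebra (space M) N (count_space ?I))"
      using i by (intro in_vimage_algebra) simp
    have 2: "X' -` (A \<inter> space ?S) \<inter> space M \<in> sets (vimage_algebra (space M) (\<lambda>\<omega>. \<lambda>i\<in>?I. X i \<omega>) ?S)"
      unfolding X'_def using A' by (rule in_vimage_algebra)
    have 3: "X' -` (A \<inter> space ?S) \<inter> space M = X' -` A \<inter> space M"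
      using X'_S by blast
    have "{\<omega> \<in> space M. N \<omega> = i \<and> X' \<omega> \<in> A} = (N -` {i} \<inter> space M) \<inter> (X' -` A \<inter> space M)"
      by blast
    then show ?thesis
      using indep_setD[OF NX 1 2] unfolding 3 prob_N[OF i] prob_X'[OF A] by simp
  qed
  have fn: "face_number k (typical_cell R m X N \<omega>) = card {J. N \<omega> \<in> J \<and> X' \<omega> \<in> F J}" if \<omega>: "\<omega> \<in> space M" for \<omega>
  proof -
    have "orthogonal_transformation (R (X (N \<omega>) \<omega>))"
      using R on_sphere[OF N_I[OF \<omega>] \<omega>] unfolding measurable_rotations_to_pole_def by blast
    then have "face_number k (typical_cell R m X N \<omega>) =
        card {J. N \<omega> \<in> J \<and> hull_face ?I (\<lambda>i. X i \<omega>) J \<and> dim (tie_space (\<lambda>i. X i \<omega>) J) = Suc k}"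
      unfolding typical_cell_def
      by (rule face_number_orthogonal_image_voronoi_cell) (use on_sphere \<omega> N_I in auto)
    also have "{J. N \<omega> \<in> J \<and> hull_face ?I (\<lambda>i. X i \<omega>) J \<and> dim (tie_space (\<lambda>i. X i \<omega>) J) = Suc k} =
        {J. N \<omega> \<in> J \<and> X' \<omega> \<in> F J}"
    proof (intro Collect_cong conj_cong refl)
      fix J
      have hf: "hull_face ?I (X' \<omega>) J \<longleftrightarrow> hull_face ?I (\<lambda>i. X i \<omega>) J"
        unfolding X'_def by (rule hull_face_restrict)
      have ts: "tie_space (X' \<omega>) J = tie_space (\<lambda>i. X i \<omega>) J" if "hull_face ?I (\<lambda>i. X i \<omega>) J"
        unfolding X'_def by (rule tie_space_restrict[OF hull_face_subset[OF that]])
      show "(hull_face ?I (\<lambda>i. X i \<omega>) J \<and> dim (tie_space (\<lambda>i. X i \<omega>) J) = Suc k) = (X' \<omega> \<in> F J)"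
        unfolding F_def mem_Collect_eq hf by (simp only: X'_space[OF \<omega>] ts simp_thms cong: conj_cong)
    qed
    finally show ?thesis .
  qed
  \<comment> \<open>Recording the cell together with the index set makes each event fix the value of
    \<open>N\<close>, so that independence applies to it.\<close>
  have card_pair: "card {J. i \<in> J \<and> P J} = card {p. (fst p = i \<and> fst p \<in> snd p) \<and> P (snd p)}"
    for i :: nat and P
  proof -
    have "{p. (fst p = i \<and> fst p \<in> snd p) \<and> P (snd p)} = Pair i ` {J. i \<in> J \<and> P J}"
      by (auto simp: image_iff)
    then show ?thesis by (simp add: card_image inj_on_def)
  qed
  define A where "A = (SIGMA i:?I. {J. J \<subseteq> ?I \<and> i \<in> J})"
  have finA: "finite A"
    unfolding A_def by (intro finite_SigmaI) (auto intro: finite_subset[of _ "Pow ?I"])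
  have subA: "{p. (fst p = N \<omega> \<and> fst p \<in> snd p) \<and> X' \<omega> \<in> F (snd p)} \<subseteq> A" if "\<omega> \<in> space M" for \<omega>
  proof (rule subsetI, unfold mem_Collect_eq, elim conjE)
    fix p assume p: "fst p = N \<omega>" "fst p \<in> snd p" and "X' \<omega> \<in> F (snd p)"
    then have h: "hull_face ?I (X' \<omega>) (snd p)" unfolding F_def by (elim CollectE conjE)
    show "p \<in> A"
      unfolding A_def mem_Sigma_iff[of "fst p" "snd p", unfolded prod.collapse] mem_Collect_eq
      using N_I[OF that] p hull_face_subset[OF h] by (simp only: simp_thms)
  qed
  have ev: "{\<omega> \<in> space M. (fst p = N \<omega> \<and> fst p \<in> snd p) \<and> X' \<omega> \<in> F (snd p)} =
      {\<omega> \<in> space M. N \<omega> = fst p \<and> X' \<omega> \<in> F (snd p)}" if "p \<in> A" for p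
  proof (rule Collect_cong, rule conj_cong[OF refl])
    have "fst p \<in> snd p" using that unfolding A_def by auto
    then show "((fst p = N \<omega> \<and> fst p \<in> snd p) \<and> X' \<omega> \<in> F (snd p)) = (N \<omega> = fst p \<and> X' \<omega> \<in> F (snd p))" for \<omega>
      by (simp only: simp_thms eq_commute)
  qed
  have A_D: "fst p \<in> ?I" "snd p \<subseteq> ?I" "fst p \<in> snd p" if "p \<in> A" for p
    using that unfolding A_def by auto
  have evM: "{\<omega> \<in> space M. (fst p = N \<omega> \<and> fst p \<in> snd p) \<and> X' \<omega> \<in> F (snd p)} \<in> events" if p: "p \<in> A" for p
  proof -
    have 1: "N -` {fst p} \<inter> space M \<in> events"
      using A_D(1)[OF p] by (intro measurable_sets[OF N]) simp
    have "F (snd p) \<in> sets (PiM ?I (\<lambda>_. borel))"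
      unfolding sets_Q[symmetric] by (rule F_sets[OF A_D(2,3)[OF p]])
    then have 2: "X' -` F (snd p) \<inter> space M \<in> events"
      by (rule measurable_sets[OF X'_Q])
    have "{\<omega> \<in> space M. N \<omega> = fst p \<and> X' \<omega> \<in> F (snd p)} =
        (N -` {fst p} \<inter> space M) \<inter> (X' -` F (snd p) \<inter> space M)" by blast
    then show ?thesis unfolding ev[OF p] using sets.Int[OF 1 2] by (simp only:)
  qed
  have "expected_face_number M R m X N k =
      (\<integral>\<omega>. real (card {p. (fst p = N \<omega> \<and> fst p \<in> snd p) \<and> X' \<omega> \<in> F (snd p)}) \<partial>M)"
    unfolding expected_face_number_def
    by (rule Bochner_Integration.integral_cong[OF refl]) (simp only: fn card_pair[of _ "\<lambda>J. X' \<omega> \<in> F J" for \<omega>])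
  also have "\<dots> = (\<Sum>p\<in>A. prob {\<omega> \<in> space M. (fst p = N \<omega> \<and> fst p \<in> snd p) \<and> X' \<omega> \<in> F (snd p)})"
    by (rule integral_card_eq(2)[OF finA subA evM])
  also have "\<dots> = (\<Sum>p\<in>A. 1 / m * measure ?Q (F (snd p)))"
  proof (rule sum.cong[OF refl])
    fix p assume p: "p \<in> A"
    show "prob {\<omega> \<in> space M. (fst p = N \<omega> \<and> fst p \<in> snd p) \<and> X' \<omega> \<in> F (snd p)} = 1 / m * measure ?Q (F (snd p))"
      unfolding ev[OF p] by (intro prob_NX F_sets[OF A_D(2,3)] A_D(1) p)
  qed
  also have "\<dots> = (\<Sum>i\<in>?I. \<Sum>J | J \<subseteq> ?I \<and> i \<in> J. 1 / m * measure ?Q (F J))"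
    unfolding A_def by (subst sum.Sigma) (auto intro!: sum.cong finite_subset[of _ "Pow ?I"])
  also have "\<dots> = 1 / m * (\<Sum>i\<in>?I. \<Sum>J | J \<subseteq> ?I \<and> i \<in> J. measure ?Q (F J))"
    by (simp only: sum_distrib_left)
  also have "(\<Sum>i\<in>?I. \<Sum>J | J \<subseteq> ?I \<and> i \<in> J. measure ?Q (F J)) =
      (\<Sum>i\<in>?I. \<integral>x. real (card {J. i \<in> J \<and> hull_face ?I x J \<and> dim (tie_space x J) = Suc k}) \<partial>?Q)"
    unfolding F_def by (rule sum.cong[OF refl]) (rule sum_mean_cell_faces(2)[OF m k, symmetric])
  also have "\<dots> = real (5 - k) * mean_hull_faces m (5 - k)"
    by (rule sum_mean_cell_faces(1)[OF m k])
  finally show ?thesis by simp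
qed

theorem corollary3p9:
  fixes M :: "'w measure"
    and X :: "nat \<Rightarrow> 'w \<Rightarrow> real ^ 5"
    and N :: "'w \<Rightarrow> nat"
    and R :: "real ^ 5 \<Rightarrow> real ^ 5 \<Rightarrow> real ^ 5"
    and n :: nat
  assumes "n \<ge> 5"
    and "prob_space M"
    and "prob_space.indep_vars M (\<lambda>_. sphere_borel) X {1..n + 1}"
    and "\<And>i. i \<in> {1..n + 1} \<Longrightarrow> distr M sphere_borel (X i) = spherical_measure"
    and "N \<in> measurable M (count_space {1..n + 1})"
    and "distr M (count_space {1..n + 1}) N = uniform_count_measure {1..n + 1}"
    and "prob_space.indep_set M
           (sets (vimage_algebra (space M) N (count_space {1..n + 1})))
           (sets (vimage_algebra (space M) (\<lambda>\<omega>. \<lambda>i\<in>{1..n + 1}. X i \<omega>)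
             (\<Pi>\<^sub>M i\<in>{1..n + 1}. sphere_borel)))"
    and "measurable_rotations_to_pole R"
  shows "expected_face_number M R (n + 1) X N 0 =
           6435 / 2048 * (3 / 48) ^ (n - 4) * real (n choose 4) *
           integral {- (pi / 2)..pi / 2}
             (\<lambda>x. (cos x) ^ 15 * (8 + 9 * sin x + sin (3 * x)) ^ (n - 4)) \<and>
         expected_face_number M R (n + 1) X N 1 =
           2 * expected_face_number M R (n + 1) X N 0 \<and>
         expected_face_number M R (n + 1) X N 2 =
           6 * ((real n - 1) / (real n + 1)) + 6 / 5 * expected_face_number M R (n + 1) X N 0 \<and>
         expected_face_number M R (n + 1) X N 3 =
           6 * ((real n - 1) / (real n + 1)) + 1 / 5 * expected_face_number M R (n + 1) X N 0"
proof -
  let ?m = "n + 1"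
  have m: "6 \<le> ?m" using assms(1) by simp
  define A where "A s = mean_hull_faces ?m s" for s
  have E: "expected_face_number M R ?m X N k = real (5 - k) / real ?m * A (5 - k)" if "k < 5" for k
    unfolding A_def by (rule expected_face_number_eq[OF m that assms(2-8)])
  have E0: "expected_face_number M R ?m X N 0 = 5 / real ?m * A 5"
    and E1: "expected_face_number M R ?m X N 1 = 4 / real ?m * A 4"
    and E2: "expected_face_number M R ?m X N 2 = 3 / real ?m * A 3"
    and E3: "expected_face_number M R ?m X N 3 = 2 / real ?m * A 2"
    using E[of 0] E[of 1] E[of 2] E[of 3] by simp_all
  have rel: "2 * A 4 = 5 * A 5" "3 * A 3 = 2 * A 2 + 5 * A 5" "2 * A 2 + 12 = 6 * real ?m + A 5"
    unfolding A_def by (rule mean_hull_faces_relations[OF m])+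
  have pos: "real n + 1 > 0" by simp
  \<comment> \<open>The absorption identity: it cancels the number \<open>n + 1\<close> of cells
    over which the five vertices of each facet are averaged.\<close>
  have "5 * (?m choose 5) = ?m * (n choose 4)"
    using Suc_times_binomial_eq[of n 4] by (simp add: mult.commute)
  then have "real (5 * (?m choose 5)) = real (?m * (n choose 4))" by (rule arg_cong)
  then have bin: "5 * real (?m choose 5) = (real n + 1) * real (n choose 4)" by (simp add: algebra_simps)
  define P where "P = 6435 / 2048 * (3 / 48) ^ (n - 4) *
    integral {- (pi/2)..pi/2} (\<lambda>x. cos x ^ 15 * (8 + 9 * sin x + sin (3 * x)) ^ (n - 4))"
  have "?m - 5 = n - 4" by simp
  then have "A 5 = real (?m choose 5) * P"
    unfolding A_def P_def using mean_facets[OF m] by simp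
  then have "5 * A 5 = 5 * real (?m choose 5) * P" by simp
  then have A5: "5 * A 5 = (real n + 1) * real (n choose 4) * P"
    unfolding bin .
  have "expected_face_number M R ?m X N 0 = real (n choose 4) * P"
    unfolding E0 using A5 pos by (simp add: field_simps)
  moreover have "expected_face_number M R ?m X N 1 = 2 * expected_face_number M R ?m X N 0"
    unfolding E0 E1 using rel(1) pos by (simp add: field_simps)
  moreover have "expected_face_number M R ?m X N 2 =
      6 * ((real n - 1) / (real n + 1)) + 6 / 5 * expected_face_number M R ?m X N 0"
  proof -
    \<comment> \<open>The second and third relations combined, with
      \<open>6 * (n + 1) - 12 = 6 * (n - 1)\<close>.\<close>
    have "3 * A 3 = 6 * (real n - 1) + 6 * A 5" using rel(2,3) by simp
    then have "3 / real ?m * A 3 = (6 * (real n - 1) + 6 * A 5) / (real n + 1)" by simp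
    then show ?thesis unfolding E0 E2 by (simp add: add_divide_distrib)
  qed
  moreover have "expected_face_number M R ?m X N 3 =
      6 * ((real n - 1) / (real n + 1)) + 1 / 5 * expected_face_number M R ?m X N 0"
  proof -
    have "2 * A 2 = 6 * (real n - 1) + A 5" using rel(3) by simp
    then have "2 / real ?m * A 2 = (6 * (real n - 1) + A 5) / (real n + 1)" by simp
    then show ?thesis unfolding E0 E3 by (simp add: add_divide_distrib)
  qed
  ultimately show ?thesis
    by (simp add: P_def mult_ac)
qed

end
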